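(* Let $0<m\le M<\infty$, $\kappa=M/m$, and let $f:\mathbb{R}^p\to\mathbb{R}$ be twice differentiable with $m\mathbf{I}_p\preccurlyeq\nabla^2 f(\boldsymbol\theta)\preccurlyeq M\mathbf{I}_p$ for all $\boldsymbol\theta\in\mathbb{R}^p$. Let $\pi(\boldsymbol\theta)\propto\exp\{-f(\boldsymbol\theta)\}$. Let $h>0$ be such that $Mh+\sqrt{\kappa}\,(Mh)^{3/2}\le 1/4$. Then, for every $n\ge 1$, the distribution $\nu_n^{\mathsf{RLMC}}$ of the $n$-th iterate $\boldsymbol\vartheta_n^{\mathsf{RLMC}}$ of the RLMC algorithm with step-size $h$ and initial distribution $\nu_0$ satisfies $$\mathsf{W}_2(\nu_n^{\mathsf{RLMC}},\pi)\le 1.11\,e^{-mnh/2}\,\mathsf{W}_2(\nu_0,\pi)+\big(2.4\sqrt{\kappa Mh}+1.77\big)\,Mh\,\sqrt{p/m}.$$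
   Context: $\mathsf{W}_2$ denotes the Wasserstein-2 distance on $\mathbb{R}^p$ with respect to the Euclidean norm. RLMC (randomized midpoint Langevin Monte Carlo): let $\boldsymbol\vartheta_0\sim\nu_0$, a probability distribution on $\mathbb{R}^p$. At each iteration $k=0,1,2,\dots$, generate, independently of all previously generated variables, $U_k$ uniform on $[0,1]$ and independent vectors $\boldsymbol\xi_k',\boldsymbol\xi_k''\sim\mathcal N_p(0,\mathbf I_p)$, with $U_k$ independent of $(\boldsymbol\xi_k',\boldsymbol\xi_k'')$. Set $\boldsymbol\xi_k=\sqrt{U_k}\,\boldsymbol\xi_k'+\sqrt{1-U_k}\,\boldsymbol\xi_k''$ and $$\boldsymbol\vartheta_{k+U}=\boldsymbol\vartheta_k-hU_k\nabla f(\boldsymbol\vartheta_k)+\sqrt{2hU_k}\,\boldsymbol\xi_k',\qquad \boldsymbol\vartheta_{k+1}=\boldsymbol\vartheta_k-h\nabla f(\boldsymbol\vartheta_{k+U})+\sqrt{2h}\,\boldsymbol\xi_k .$$ The sequence $(\boldsymbol\vartheta_k)$ is denoted $(\boldsymbol\vartheta_k^{\mathsf{RLMC}})$. *)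

theory Defs
  imports "HOL-Probability.Probability"
begin

definition grad :: "('a::real_inner \<Rightarrow> real) \<Rightarrow> 'a \<Rightarrow> 'a" where
  "grad f x = (THE D. GDERIV f x :> D)"

definition hessian :: "(real ^ 'p \<Rightarrow> real) \<Rightarrow> real ^ 'p \<Rightarrow> real ^ 'p ^ 'p" where
  "hessian f x = matrix (frechet_derivative (grad f) (at x))"

definition twice_differentiable :: "(real ^ 'p \<Rightarrow> real) \<Rightarrow> bool" where
  "twice_differentiable f \<longleftrightarrow>
     (\<forall>x. f differentiable (at x)) \<and> (\<forall>x. grad f differentiable (at x))"

text \<open>Symmetry of the matrices is not part of this relation. It is only applied to scalar
  matrices and to Hessians of twice (Frechet) differentiable functions, which are symmetric.\<close>

definition loewner_le :: "real ^ 'p ^ 'p \<Rightarrow> real ^ 'p ^ 'p \<Rightarrow> bool" (infix "\<preceq>\<^sub>L" 50) where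
  "A \<preceq>\<^sub>L B \<longleftrightarrow> (\<forall>v. 0 \<le> v \<bullet> ((B - A) *v v))"

lemma grad_eqI:
  assumes "GDERIV f x :> D"
  shows "grad f x = D"
proof -
  have "D' = D" if "GDERIV f x :> D'" for D'
  proof -
    have "(\<lambda>v. v \<bullet> D') = (\<lambda>v. v \<bullet> D)"
      using that assms unfolding gderiv_def by (rule has_derivative_unique)
    then show ?thesis
      by (metis inner_commute vector_eq_rdot)
  qed
  with assms show ?thesis
    unfolding grad_def by blast
qed

lemma hessian_has_derivative:
  assumes "twice_differentiable f"
  shows "(grad f has_derivative (\<lambda>v. hessian f x *v v)) (at x)"
proof -
  have D: "(grad f has_derivative frechet_derivative (grad f) (at x)) (at x)"
    using assms frechet_derivative_works unfolding twice_differentiable_def by blast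
  then have "linear (frechet_derivative (grad f) (at x))"
    by (rule has_derivative_linear)
  with D show ?thesis
    unfolding hessian_def by (simp add: matrix_works)
qed

definition couplings ::
    "'a::euclidean_space measure \<Rightarrow> 'a measure \<Rightarrow> ('a \<times> 'a) measure set" where
  "couplings \<mu> \<nu> = {\<gamma>. sets \<gamma> = sets (borel \<Otimes>\<^sub>M borel) \<and>
     distr \<gamma> borel fst = \<mu> \<and> distr \<gamma> borel snd = \<nu>}"

definition sqrt_ennreal :: "ennreal \<Rightarrow> ennreal" where
  "sqrt_ennreal x = (if x = \<infinity> then \<infinity> else ennreal (sqrt (enn2real x)))"

text \<open>The value is infinite if no coupling has finite quadratic cost, so no moment
  condition is imposed on the two distributions.\<close>

definition W2 :: "'a::euclidean_space measure \<Rightarrow> 'a measure \<Rightarrow> ennreal" where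
  "W2 \<mu> \<nu> =
     sqrt_ennreal (INF \<gamma>\<in>couplings \<mu> \<nu>. \<integral>\<^sup>+ (x, y). ennreal ((norm (x - y))\<^sup>2) \<partial>\<gamma>)"

definition gibbs :: "('a::euclidean_space \<Rightarrow> real) \<Rightarrow> 'a measure" where
  "gibbs f = density lborel
     (\<lambda>x. ennreal (exp (- f x)) / (\<integral>\<^sup>+ y. ennreal (exp (- f y)) \<partial>lborel))"

definition std_gaussian :: "'a::euclidean_space measure" where
  "std_gaussian = density lborel
     (\<lambda>x. ennreal (exp (- (norm x)\<^sup>2 / 2) / sqrt (2 * pi) ^ DIM('a)))"

text \<open>An index type for the random inputs of the algorithm, so that their mutual
  independence can be stated although they have values in different spaces.\<close>

datatype rlmc_index = Init | Unif nat | Noise1 nat | Noise2 nat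

locale rlmc_inputs = prob_space \<Omega>
  for \<Omega> :: "'w measure" +
  fixes \<nu>0 :: "(real ^ 'p) measure"
    and \<theta>0 :: "'w \<Rightarrow> real ^ 'p"
    and U :: "nat \<Rightarrow> 'w \<Rightarrow> real"
    and \<xi>' \<xi>'' :: "nat \<Rightarrow> 'w \<Rightarrow> real ^ 'p"
  assumes measurable_init: "random_variable borel \<theta>0"
    and measurable_unif: "\<And>k. random_variable borel (U k)"
    and measurable_noise1: "\<And>k. random_variable borel (\<xi>' k)"
    and measurable_noise2: "\<And>k. random_variable borel (\<xi>'' k)"
    and distr_init: "distr \<Omega> borel \<theta>0 = \<nu>0"
    and distr_unif: "\<And>k. distr \<Omega> borel (U k) = uniform_measure lborel {0..1}"
    and distr_noise1: "\<And>k. distr \<Omega> borel (\<xi>' k) = std_gaussian"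
    and distr_noise2: "\<And>k. distr \<Omega> borel (\<xi>'' k) = std_gaussian"
    and indep_inputs: "indep_sets
      (\<lambda>i. case i of
          Init \<Rightarrow> sets (vimage_algebra (space \<Omega>) \<theta>0 borel)
        | Unif k \<Rightarrow> sets (vimage_algebra (space \<Omega>) (U k) borel)
        | Noise1 k \<Rightarrow> sets (vimage_algebra (space \<Omega>) (\<xi>' k) borel)
        | Noise2 k \<Rightarrow> sets (vimage_algebra (space \<Omega>) (\<xi>'' k) borel)) UNIV"

definition rlmc_mid ::
    "(real ^ 'p \<Rightarrow> real) \<Rightarrow> real \<Rightarrow> real \<Rightarrow> real ^ 'p \<Rightarrow> real ^ 'p \<Rightarrow> real ^ 'p" where
  "rlmc_mid f h u z' x = x - (h * u) *\<^sub>R grad f x + sqrt (2 * h * u) *\<^sub>R z'"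

definition rlmc_step ::
    "(real ^ 'p \<Rightarrow> real) \<Rightarrow> real \<Rightarrow> real \<Rightarrow> real ^ 'p \<Rightarrow> real ^ 'p \<Rightarrow> real ^ 'p \<Rightarrow> real ^ 'p" where
  "rlmc_step f h u z' z'' x =
     x - h *\<^sub>R grad f (rlmc_mid f h u z' x)
       + sqrt (2 * h) *\<^sub>R (sqrt u *\<^sub>R z' + sqrt (1 - u) *\<^sub>R z'')"

primrec rlmc ::
    "(real ^ 'p \<Rightarrow> real) \<Rightarrow> real \<Rightarrow> ('w \<Rightarrow> real ^ 'p) \<Rightarrow> (nat \<Rightarrow> 'w \<Rightarrow> real) \<Rightarrow>
     (nat \<Rightarrow> 'w \<Rightarrow> real ^ 'p) \<Rightarrow> (nat \<Rightarrow> 'w \<Rightarrow> real ^ 'p) \<Rightarrow> nat \<Rightarrow> 'w \<Rightarrow> real ^ 'p" where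
  "rlmc f h \<theta>0 U \<xi>' \<xi>'' 0 \<omega> = \<theta>0 \<omega>"
| "rlmc f h \<theta>0 U \<xi>' \<xi>'' (Suc k) \<omega> =
     rlmc_step f h (U k \<omega>) (\<xi>' k \<omega>) (\<xi>'' k \<omega>) (rlmc f h \<theta>0 U \<xi>' \<xi>'' k \<omega>)"

end

theory Submission
  imports Defs
begin

text \<open>
  Let \<open>g\<close> be the gradient of \<open>f\<close>. No stochastic differential equation is needed: the stationary
  Langevin diffusion on an interval of length \<open>h\<close> is replaced by \<open>N\<close> steps of size \<open>\<eta> = h / N\<close> of the
  Metropolis-adjusted Langevin algorithm, started from the Gibbs measure. By detailed balance all its
  states \<open>X 0, \<dots>, X N\<close> have exactly the law \<open>\<pi>\<close>, and since \<open>f\<close> is twice differentiable a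
  rejection changes an Euler step by only \<open>o(\<eta>)\<close> in \<open>L\<^sup>2\<close>. Hence
  \<open>X j = X 0 - \<eta> (\<Sum>i<j. g (X i)) + sqrt (2 \<eta>) W j + o(1)\<close> with a Gaussian random walk \<open>W\<close>,
  which also drives one step of the randomized midpoint method.

  With \<open>D = \<theta> - X 0\<close>, \<open>\<theta>' j\<close> the midpoint for \<open>u = j / N\<close>, \<open>\<Delta> j = g (\<theta>' j) - g (X j)\<close> and
  \<open>r j = D - (\<theta>' j - X j)\<close>, averaging over \<open>j\<close> before taking norms and the inequality
  \<open>2 D \<bullet> \<Delta> j \<ge> m |D|\<^sup>2 + |\<Delta> j|\<^sup>2 / M - M |r j|\<^sup>2\<close> show that the squared distance after one step is at
  most \<open>(1 - m h) |D|\<^sup>2\<close> plus \<open>h M |r j|\<^sup>2 - (h / M) |\<Delta> j|\<^sup>2\<close> plus a variance term. The point is that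
  \<open>M |r j|\<close> is itself at most \<open>0.22 |\<Delta> j|\<close> plus a quantity of order \<open>(M h)\<^bsup>3/2\<^esup> sqrt (M p)\<close>, so that the
  negative term absorbs it. This gives the recursion
  \<open>W2\<^sup>2 (\<nu> (k + 1), \<pi>) \<le> (1 - m h) W2\<^sup>2 (\<nu> k, \<pi>) + h p (M h)\<^sup>2 (25.05 M h + 2.26)\<close> as \<open>N \<rightarrow> \<infinity>\<close>.
\<close>

section \<open>Strongly convex potentials with Lipschitz gradient\<close>

text \<open>The obstacle is the size of the rejections. The errors of \<open>N\<close> steps are
  added by the triangle inequality in \<open>L^2\<close>, so each may cost only o(\<eta>) with
  \<eta> = h / N, that is, o(\<eta>^2) in mean square. As the squared proposal step has order
  \<eta>, the rejection probability itself must be o(\<eta>). A second derivative at each point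
  gives exactly this: in the Metropolis ratio \<open>f\<close> enters through its trapezoidal error,
  which is o(|d|^2). That limit is only pointwise; fourth moments and dominated convergence make it
  a statement in the mean.

  No limit process is constructed. Every \<open>N\<close> yields a coupling whose marginals are
  exactly the required ones, and the infimum of the transport cost does not depend on
  \<open>N\<close>, so only numerical bounds have to converge. The marginals stay exact because
  \<open>u\<close> is rounded to the grid only when the noise is chosen, not in the midpoint step
  itself.

  The constants 25.05 and 2.26 are the halves of the 50.1 and 4.52 found at a single time
  \<open>u\<close>, since \<open>u\<close> has mean 1/2.\<close>

lemma norm_add_sq: "(norm (x + y))\<^sup>2 = (norm x)\<^sup>2 + 2 * (x \<bullet> y) + (norm (y::'a::real_inner))\<^sup>2"
  by (simp add: power2_norm_eq_inner inner_add_left inner_add_right inner_commute)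

lemma norm_diff_sq: "(norm (x - y))\<^sup>2 = (norm x)\<^sup>2 - 2 * (x \<bullet> y) + (norm (y::'a::real_inner))\<^sup>2"
  by (simp add: power2_norm_eq_inner inner_diff_left inner_diff_right inner_commute)

text \<open>The Hessian is kept out of these axioms and appears only in
  \<open>potential_grad\<close>. What survives of the second derivative is
  \<open>trapezoid_limit\<close>, the error of the trapezoidal rule for an increment of
  \<open>f\<close>, because this is how \<open>f\<close> occurs in the Metropolis ratio.\<close>

locale potential =
  fixes f :: "'a::euclidean_space \<Rightarrow> real" and g :: "'a \<Rightarrow> 'a" and m M :: real
  assumes m_pos: "0 < m" and m_le_M: "m \<le> M"
    and continuous_f: "continuous_on UNIV f"
    and lower: "\<And>x y. f x + g x \<bullet> (y - x) + m / 2 * (norm (y - x))\<^sup>2 \<le> f y"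
    and upper: "\<And>x y. f y \<le> f x + g x \<bullet> (y - x) + M / 2 * (norm (y - x))\<^sup>2"
    and trapezoid_limit:
      "\<And>x. ((\<lambda>d. (f (x + d) - f x - (g x + g (x + d)) \<bullet> d / 2) / (norm d)\<^sup>2) \<longlongrightarrow> 0) (at 0)"
begin

lemma M_pos: "0 < M"
  using m_pos m_le_M by simp

text \<open>The Baillon--Haddad argument, applied to the convex function
  \<open>z \<mapsto> f z - m / 2 * (norm z)\<^sup>2\<close>: compare the lower bound at \<open>x\<close> with the upper bound at
  \<open>y\<close> in the point reached from \<open>y\<close> by a gradient step of length \<open>t\<close>.\<close>

lemma shifted_cocoercive:
  defines "G \<equiv> \<lambda>z. g z - m *\<^sub>R z"
  shows "(norm (G y - G x))\<^sup>2 \<le> (M - m) * ((G y - G x) \<bullet> (y - x))"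
proof -
  define F where "F z = f z - m / 2 * (norm z)\<^sup>2" for z
  have lo: "F x + G x \<bullet> (y - x) \<le> F y" for x y
    using lower[of x y] unfolding F_def G_def norm_diff_sq
    by (simp add: inner_diff_left inner_diff_right inner_commute power2_norm_eq_inner field_simps)
  have up: "F y \<le> F x + G x \<bullet> (y - x) + (M - m) / 2 * (norm (y - x))\<^sup>2" for x y
    using upper[of y x] unfolding F_def G_def norm_diff_sq
    by (simp add: inner_diff_left inner_diff_right inner_commute power2_norm_eq_inner field_simps)
  have one: "t * (norm (G y - G x))\<^sup>2 - (M - m) / 2 * t\<^sup>2 * (norm (G y - G x))\<^sup>2
      \<le> F y - F x - G x \<bullet> (y - x)" for x y t
  proof -
    define z where "z = y - t *\<^sub>R (G y - G x)"
    have "F x + G x \<bullet> (z - x) \<le> F y + G y \<bullet> (z - y) + (M - m) / 2 * (norm (z - y))\<^sup>2"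
      using lo[of x z] up[of z y] by linarith
    moreover have "G y \<bullet> (z - y) - G x \<bullet> (z - x) = - t * (norm (G y - G x))\<^sup>2 - G x \<bullet> (y - x)"
      unfolding z_def
      by (simp add: inner_diff_left inner_diff_right inner_commute power2_norm_eq_inner algebra_simps)
    moreover have "(norm (z - y))\<^sup>2 = t\<^sup>2 * (norm (G y - G x))\<^sup>2"
      by (simp add: z_def power_mult_distrib)
    ultimately show ?thesis
      by (simp add: algebra_simps)
  qed
  have *: "(2 * t - (M - m) * t\<^sup>2) * (norm (G y - G x))\<^sup>2 \<le> (G y - G x) \<bullet> (y - x)" for t
  proof -
    have "G x \<bullet> (y - x) + G y \<bullet> (x - y) = - ((G y - G x) \<bullet> (y - x))"
      by (simp add: inner_diff_left inner_diff_right)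
    then show ?thesis
      using one[of t y x] one[of t x y] norm_minus_commute[of "G x" "G y"]
      by (simp add: field_simps)
  qed
  show ?thesis
  proof (cases "M = m")
    case True
    \<comment> \<open>For \<open>M = m\<close> there is no optimal \<open>t\<close>, but then
      \<open>*\<close> is linear in \<open>t\<close>, and a large \<open>t\<close> contradicts it
      unless \<open>G y = G x\<close>.\<close>
    have "(norm (G y - G x))\<^sup>2 \<le> 0"
    proof (rule ccontr)
      assume "\<not> ?thesis"
      then have n: "0 < (norm (G y - G x))\<^sup>2" by simp
      let ?s = "(G y - G x) \<bullet> (y - x)"
      have "2 * (?s + 1) = 2 * ((?s + 1) / (norm (G y - G x))\<^sup>2) * (norm (G y - G x))\<^sup>2"
        using n by (simp del: zero_less_norm_iff)
      also have "\<dots> \<le> ?s"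
        using *[of "(?s + 1) / (norm (G y - G x))\<^sup>2"] True by simp
      finally have "?s \<le> - 2" by argo
      then show False using *[of 0] by simp
    qed
    then show ?thesis using True by simp
  next
    case False
    then have "0 < M - m" using m_le_M by simp
    \<comment> \<open>The choice \<open>t = 1 / (M - m)\<close> maximizes the factor
      \<open>2 t - (M - m) t^2\<close> in \<open>*\<close>.\<close>
    moreover from this have "2 * (1 / (M - m)) - (M - m) * (1 / (M - m))\<^sup>2 = 1 / (M - m)"
      by (simp add: power2_eq_square)
    ultimately show ?thesis
      using *[of "1 / (M - m)"] by (simp add: divide_le_eq mult.commute)
  qed
qed

text \<open>\<open>shifted_cocoercive\<close> expanded in terms of \<open>g\<close>; it combines
  strong monotonicity and cocoercivity of \<open>g\<close> in one inequality.\<close>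

lemma gradient_interpolation:
  "(norm (g y - g x))\<^sup>2 + m * M * (norm (y - x))\<^sup>2 \<le> (m + M) * ((g y - g x) \<bullet> (y - x))"
proof -
  have eq: "(g y - m *\<^sub>R y) - (g x - m *\<^sub>R x) = (g y - g x) - m *\<^sub>R (y - x)"
    by (simp add: algebra_simps)
  show ?thesis
    using shifted_cocoercive[of y x] unfolding eq norm_diff_sq[of "g y - g x"] inner_diff_left[of "g y - g x"]
    by (simp add: power2_norm_eq_inner[symmetric] power_mult_distrib)
      (simp add: power2_eq_square algebra_simps)
qed

text \<open>By the Cauchy-Schwarz inequality, \<open>gradient_interpolation\<close> becomes
  \<open>(d - m e) (d - M e) \<le> 0\<close> for the norms \<open>d\<close> and \<open>e\<close> of
  the two increments, so \<open>d\<close> lies between \<open>m e\<close> and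
  \<open>M e\<close>.\<close>

lemma gradient_lipschitz: "norm (g y - g x) \<le> M * norm (y - x)"
proof -
  let ?d = "norm (g y - g x)" and ?e = "norm (y - x)"
  have "?d\<^sup>2 + m * M * ?e\<^sup>2 \<le> (m + M) * (?d * ?e)"
    using gradient_interpolation[of y x] norm_cauchy_schwarz[of "g y - g x" "y - x"] m_pos m_le_M
    by (smt (verit) mult_left_mono)
  then have *: "(?d - m * ?e) * (?d - M * ?e) \<le> 0"
    by (simp add: power2_eq_square algebra_simps)
  show ?thesis
  proof (rule ccontr)
    assume "\<not> ?thesis"
    then have "?d - M * ?e > 0" by simp
    moreover have "m * ?e \<le> M * ?e" using m_le_M by (simp add: mult_right_mono)
    ultimately show False using * mult_pos_pos[of "?d - m * ?e" "?d - M * ?e"] by linarith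
  qed
qed

lemma continuous_g: "continuous_on UNIV g"
proof -
  have "M-lipschitz_on UNIV g"
    using M_pos gradient_lipschitz by (intro lipschitz_onI) (auto simp: dist_norm)
  then show ?thesis by (rule lipschitz_on_continuous_on)
qed

lemma borel_measurable_f [measurable]: "f \<in> borel_measurable borel"
  using continuous_f by (rule borel_measurable_continuous_onI)

lemma borel_measurable_g [measurable]: "g \<in> borel_measurable borel"
  using continuous_g by (rule borel_measurable_continuous_onI)

text \<open>The contraction estimate. The gradients are compared at \<open>x\<close> and \<open>y\<close>, whereas the
  distance to be contracted is that of \<open>y - x + r\<close>. With \<open>L = M - m\<close> and \<open>d = g y - g x - m (y - x)\<close>,
  the difference of the two sides is \<open>m L / M * |y - x - d / L|\<^sup>2 + L * |r + d / L|\<^sup>2\<close> plus twice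
  the gap in cocoercivity.\<close>

lemma perturbed_contraction:
  "m * (norm (y - x + r))\<^sup>2 + (norm (g y - g x))\<^sup>2 / M - M * (norm r)\<^sup>2
    \<le> 2 * ((y - x + r) \<bullet> (g y - g x))"
proof -
  define E where "E = y - x"
  define d where "d = g y - g x - m *\<^sub>R E"
  define L where "L = M - m"
  have co: "(norm d)\<^sup>2 \<le> L * (d \<bullet> E)"
    using shifted_cocoercive[of y x] by (simp add: d_def E_def L_def algebra_simps)
  have gd: "g y - g x = d + m *\<^sub>R E" by (simp add: d_def)
  have M0: "M > 0" by (rule M_pos)
  have Meq: "M = L + m" by (simp add: L_def)
  have exp: "2 * ((E + r) \<bullet> (d + m *\<^sub>R E)) - m * (norm (E + r))\<^sup>2 - (norm (d + m *\<^sub>R E))\<^sup>2 / M + M * (norm r)\<^sup>2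
    = 2 * (1 - m / M) * (d \<bullet> E) + m * (1 - m / M) * (norm E)\<^sup>2 + 2 * (r \<bullet> d) - (norm d)\<^sup>2 / M
      + (M - m) * (norm r)\<^sup>2"
    using M0 unfolding norm_add_sq
    by (simp add: inner_add_left inner_add_right inner_commute power2_norm_eq_inner field_simps)
       (simp add: power2_eq_square algebra_simps)
  have "0 \<le> 2 * (1 - m / M) * (d \<bullet> E) + m * (1 - m / M) * (norm E)\<^sup>2 + 2 * (r \<bullet> d) - (norm d)\<^sup>2 / M
      + (M - m) * (norm r)\<^sup>2"
  proof (cases "L = 0")
    \<comment> \<open>Here cocoercivity forces \<open>d = 0\<close>, and \<open>M = m\<close> makes
      all other terms vanish.\<close>
    case True
    then show ?thesis using co Meq M0 by simp
  next
    case False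
    then have L0: "0 < L" using m_le_M by (simp add: L_def)
    have n1: "(norm (E - (1 / L) *\<^sub>R d))\<^sup>2 = (norm E)\<^sup>2 - 2 / L * (d \<bullet> E) + (norm d)\<^sup>2 / L\<^sup>2"
      unfolding norm_diff_sq by (simp add: inner_commute power_divide)
    have n2: "(norm (r + (1 / L) *\<^sub>R d))\<^sup>2 = (norm r)\<^sup>2 + 2 / L * (r \<bullet> d) + (norm d)\<^sup>2 / L\<^sup>2"
      unfolding norm_add_sq by (simp add: inner_commute power_divide)
    have "2 * (1 - m / M) * (d \<bullet> E) + m * (1 - m / M) * (norm E)\<^sup>2 + 2 * (r \<bullet> d) - (norm d)\<^sup>2 / M
      + (M - m) * (norm r)\<^sup>2
      = m * L / M * (norm (E - (1 / L) *\<^sub>R d))\<^sup>2 + L * (norm (r + (1 / L) *\<^sub>R d))\<^sup>2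
        + 2 / L * (L * (d \<bullet> E) - (norm d)\<^sup>2)"
    proof -
      have "m * L / M * (norm (E - (1 / L) *\<^sub>R d))\<^sup>2
          = m * (L / M) * (norm E)\<^sup>2 - 2 * m / M * (d \<bullet> E) + m / (M * L) * (norm d)\<^sup>2"
        using L0 M0 unfolding n1 by (simp add: field_simps power2_eq_square)
      moreover have "L * (norm (r + (1 / L) *\<^sub>R d))\<^sup>2 = L * (norm r)\<^sup>2 + 2 * (r \<bullet> d) + (norm d)\<^sup>2 / L"
        using L0 unfolding n2 by (simp add: field_simps power2_eq_square)
      moreover have "2 / L * (L * (d \<bullet> E) - (norm d)\<^sup>2) = 2 * (d \<bullet> E) - 2 * ((norm d)\<^sup>2 / L)"
        using L0 by (simp add: field_simps)
      moreover have "m / (M * L) * (norm d)\<^sup>2 - (norm d)\<^sup>2 / L = - ((norm d)\<^sup>2 / M)"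
      proof -
        have "m / (M * L) = 1 / L - 1 / M"
          using L0 M0 by (simp add: diff_frac_eq L_def)
        then have "m / (M * L) * (norm d)\<^sup>2 = (1 / L - 1 / M) * (norm d)\<^sup>2"
          by (rule arg_cong)
        then show ?thesis
          by (simp add: left_diff_distrib)
      qed
      moreover have "L / M = 1 - m / M" "M - m = L"
        using M0 by (simp_all add: Meq field_simps)
      ultimately show ?thesis
        by (simp add: algebra_simps)
    qed
    also have "\<dots> \<ge> 0"
      using L0 M0 m_pos co by (intro add_nonneg_nonneg mult_nonneg_nonneg) auto
    finally show ?thesis .
  qed
  then show ?thesis
    using exp unfolding gd E_def[symmetric] by linarith
qed

end

section \<open>From Hessian bounds to the axioms of \<open>potential\<close>\<close>

text \<open>Since \<open>\<phi>''\<close> need not be continuous, nothing is integrated: first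
  \<open>\<phi>' t - c t\<close> and then \<open>\<phi> t - \<phi>' 0 t - c t^2 / 2\<close> are
  shown to be nondecreasing for nonnegative \<open>t\<close>.\<close>

lemma second_order_lower_bound:
  fixes \<phi> :: "real \<Rightarrow> real"
  assumes d1: "\<And>t. (\<phi> has_real_derivative \<phi>' t) (at t)"
    and d2: "\<And>t. (\<phi>' has_real_derivative \<phi>'' t) (at t)"
    and c: "\<And>t. c \<le> \<phi>'' t"
  shows "\<phi> 0 + \<phi>' 0 + c / 2 \<le> \<phi> 1"
proof -
  have 1: "\<phi>' 0 - c * 0 \<le> \<phi>' t - c * t" if "0 \<le> t" for t
  proof (rule DERIV_nonneg_imp_nondecreasing[OF that])
    fix s
    have "((\<lambda>t. \<phi>' t - c * t) has_real_derivative \<phi>'' s - c) (at s)"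
      by (auto intro!: derivative_eq_intros d2)
    then show "\<exists>y. ((\<lambda>t. \<phi>' t - c * t) has_real_derivative y) (at s) \<and> 0 \<le> y"
      using c[of s] by auto
  qed
  have "\<phi> 0 - \<phi>' 0 * 0 - c / 2 * 0\<^sup>2 \<le> \<phi> 1 - \<phi>' 0 * 1 - c / 2 * 1\<^sup>2"
  proof (rule DERIV_nonneg_imp_nondecreasing[where f = "\<lambda>t. \<phi> t - \<phi>' 0 * t - c / 2 * t\<^sup>2"])
    fix s :: real assume "0 \<le> s" "s \<le> 1"
    have "((\<lambda>t. \<phi> t - \<phi>' 0 * t - c / 2 * t\<^sup>2) has_real_derivative \<phi>' s - \<phi>' 0 - c * s) (at s)"
      by (auto intro!: derivative_eq_intros d1)
    then show "\<exists>y. ((\<lambda>t. \<phi> t - \<phi>' 0 * t - c / 2 * t\<^sup>2) has_real_derivative y) (at s) \<and> 0 \<le> y"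
      using 1[OF \<open>0 \<le> s\<close>] by auto
  qed simp
  then show ?thesis by simp
qed

lemma GDERIV_grad:
  fixes f :: "'a::euclidean_space \<Rightarrow> real"
  assumes "f differentiable (at x)"
  shows "GDERIV f x :> grad f x"
proof -
  obtain l where l: "(f has_derivative l) (at x)"
    using assms by (auto simp: differentiable_def)
  then have lin: "linear l" by (rule has_derivative_linear)
  define D where "D = (\<Sum>b\<in>Basis. l b *\<^sub>R b)"
  have "l v = v \<bullet> D" for v
  proof -
    have "l v = l (\<Sum>b\<in>Basis. (v \<bullet> b) *\<^sub>R b)" by (simp add: euclidean_representation)
    also have "\<dots> = v \<bullet> D"
      unfolding D_def by (simp add: linear_sum[OF lin] linear_scale[OF lin] inner_sum_right mult.commute)
    finally show ?thesis .
  qed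
  then have "l = (\<lambda>v. v \<bullet> D)" by auto
  with l have "GDERIV f x :> D" by (simp add: gderiv_def)
  then show ?thesis using grad_eqI by metis
qed

lemma potential_grad:
  fixes f :: "real ^ 'p \<Rightarrow> real"
  assumes m: "0 < m" and mM: "m \<le> M"
    and td: "twice_differentiable f"
    and lo: "\<And>x. m *\<^sub>R mat 1 \<preceq>\<^sub>L hessian f x"
    and up: "\<And>x. hessian f x \<preceq>\<^sub>L M *\<^sub>R mat 1"
  shows "potential f (grad f) m M"
proof -
  let ?g = "grad f" and ?H = "hessian f"
  have G: "GDERIV f x :> ?g x" for x
    using td by (intro GDERIV_grad) (simp add: twice_differentiable_def)
  have dg: "(?g has_derivative (\<lambda>v. ?H x *v v)) (at x)" for x
    by (rule hessian_has_derivative[OF td])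
  have lo': "m * (norm v)\<^sup>2 \<le> (?H x *v v) \<bullet> v" for x v
    using lo[of x] unfolding loewner_le_def
    by (simp add: matrix_vector_mult_diff_rdistrib scaleR_matrix_vector_assoc[symmetric]
        inner_diff_right power2_norm_eq_inner inner_commute)
  have up': "(?H x *v v) \<bullet> v \<le> M * (norm v)\<^sup>2" for x v
    using up[of x] unfolding loewner_le_def
    by (simp add: matrix_vector_mult_diff_rdistrib scaleR_matrix_vector_assoc[symmetric]
        inner_diff_right power2_norm_eq_inner inner_commute)
  have d1: "((\<lambda>t. f (x + t *\<^sub>R d)) has_real_derivative ?g (x + t *\<^sub>R d) \<bullet> d) (at t)" for x d t
  proof -
    have "((\<lambda>t. f (x + t *\<^sub>R d)) has_derivative (\<lambda>s. (s *\<^sub>R d) \<bullet> ?g (x + t *\<^sub>R d))) (at t)"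
      by (rule has_derivative_compose[where g=f, OF _ G[unfolded gderiv_def]])
        (auto intro!: derivative_eq_intros)
    then show ?thesis
      by (simp add: has_field_derivative_def inner_commute mult.commute[of _ "d \<bullet> _"])
  qed
  have d2: "((\<lambda>t. ?g (x + t *\<^sub>R d) \<bullet> d) has_real_derivative (?H (x + t *\<^sub>R d) *v d) \<bullet> d) (at t)" for x d t
  proof -
    have "((\<lambda>t. ?g (x + t *\<^sub>R d)) has_derivative (\<lambda>s. ?H (x + t *\<^sub>R d) *v (s *\<^sub>R d))) (at t)"
      by (rule has_derivative_compose[where g="?g", OF _ dg]) (auto intro!: derivative_eq_intros)
    then have "((\<lambda>t. ?g (x + t *\<^sub>R d) \<bullet> d) has_derivative (\<lambda>s. (?H (x + t *\<^sub>R d) *v (s *\<^sub>R d)) \<bullet> d)) (at t)"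
      by (rule has_derivative_inner_left)
    then show ?thesis
      by (simp add: has_field_derivative_def matrix_vector_mult_scaleR mult.commute[of _ "_ \<bullet> d"])
  qed
  show ?thesis
  proof
    show "0 < m" "m \<le> M" by fact+
    show "continuous_on UNIV f"
      using td by (auto simp: twice_differentiable_def intro!: differentiable_imp_continuous_on
          simp: differentiable_on_def intro: differentiable_at_withinI)
    show "f x + ?g x \<bullet> (y - x) + m / 2 * (norm (y - x))\<^sup>2 \<le> f y" for x y
      using second_order_lower_bound[OF d1 d2 lo', of x "y - x"] by simp
    \<comment> \<open>The lower bound, applied to \<open>- f\<close> along the segment.\<close>
    show "f y \<le> f x + ?g x \<bullet> (y - x) + M / 2 * (norm (y - x))\<^sup>2" for x y
      using second_order_lower_bound[where \<phi> = "\<lambda>t. - f (x + t *\<^sub>R (y - x))" and c = "- (M * (norm (y - x))\<^sup>2)",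
          OF DERIV_minus[OF d1] DERIV_minus[OF d2]] up' by simp
    show "((\<lambda>d. (f (x + d) - f x - (?g x + ?g (x + d)) \<bullet> d / 2) / (norm d)\<^sup>2) \<longlongrightarrow> 0) (at 0)" for x
    proof (rule LIM_I)
      fix e :: real assume e: "0 < e"
      obtain \<delta> where \<delta>: "\<delta> > 0" "\<And>y. norm (y - x) < \<delta> \<Longrightarrow> norm (?g y - ?g x - ?H x *v (y - x)) \<le> e / 2 * norm (y - x)"
        using dg[of x] e unfolding has_derivative_at_alt by (meson half_gt_zero)
      show "\<exists>s>0. \<forall>d. d \<noteq> 0 \<and> norm (d - 0) < s \<longrightarrow>
          norm ((f (x + d) - f x - (?g x + ?g (x + d)) \<bullet> d / 2) / (norm d)\<^sup>2 - 0) < e"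
      proof (intro exI[of _ \<delta>] conjI allI impI \<delta>(1))
        fix d :: "real ^ 'p" assume d: "d \<noteq> 0 \<and> norm (d - 0) < \<delta>"
        \<comment> \<open>The deviation of the gradient from its linearization at \<open>x\<close>,
          paired with \<open>d\<close>. Differentiability of the gradient at the single point
          \<open>x\<close> makes it o(|d|^2), uniformly for \<open>t\<close> in [0, 1].\<close>
        define \<rho> where "\<rho> t = (?g (x + t *\<^sub>R d) - ?g x - ?H x *v (t *\<^sub>R d)) \<bullet> d" for t
        have \<rho>: "\<bar>\<rho> t\<bar> \<le> e / 2 * (norm d)\<^sup>2" if "0 \<le> t" "t \<le> 1" for t
        proof -
          have t: "norm (t *\<^sub>R d) \<le> norm d"
            using that by (simp add: mult_left_le_one_le)
          then have "norm (?g (x + t *\<^sub>R d) - ?g x - ?H x *v (t *\<^sub>R d)) \<le> e / 2 * norm (t *\<^sub>R d)"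
            using \<delta>(2)[of "x + t *\<^sub>R d"] d le_less_trans[OF t, of \<delta>] by simp
          also have "\<dots> \<le> e / 2 * norm d"
            using t e by (intro mult_left_mono) auto
          finally have "norm (?g (x + t *\<^sub>R d) - ?g x - ?H x *v (t *\<^sub>R d)) * norm d \<le> e / 2 * norm d * norm d"
            by (rule mult_right_mono) simp
          then show ?thesis
            unfolding \<rho>_def using Cauchy_Schwarz_ineq2 by (smt (verit) power2_eq_square mult.assoc)
        qed
        \<comment> \<open>\<open>f\<close> on the line minus its first- and second-order terms, so
          that \<open>\<psi>' = \<rho>\<close>. In the trapezoidal error the Hessian cancels between
          \<open>\<psi> 1 - \<psi> 0 = \<rho> z\<close> and \<open>\<rho> 1 / 2\<close>.\<close>
        define \<psi> where "\<psi> t = f (x + t *\<^sub>R d) - t * (?g x \<bullet> d) - t\<^sup>2 / 2 * ((?H x *v d) \<bullet> d)" for t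
        have "(\<psi> has_real_derivative \<rho> t) (at t)" for t
          unfolding \<psi>_def \<rho>_def
          by (auto intro!: derivative_eq_intros d1 simp: matrix_vector_mult_scaleR inner_diff_left algebra_simps)
        then obtain z where z: "0 < z" "z < 1" "\<psi> 1 - \<psi> 0 = (1 - 0) * \<rho> z"
          using MVT2[of 0 1 \<psi> \<rho>] by auto
        have "f (x + d) - f x - (?g x + ?g (x + d)) \<bullet> d / 2 = (\<psi> 1 - \<psi> 0) - \<rho> 1 / 2"
          unfolding \<psi>_def \<rho>_def by (simp add: inner_add_left inner_diff_left field_simps)
        then have "\<bar>f (x + d) - f x - (?g x + ?g (x + d)) \<bullet> d / 2\<bar> \<le> 3 / 4 * (e * (norm d)\<^sup>2)"
        proof -
          have "\<bar>\<rho> z\<bar> \<le> e / 2 * (norm d)\<^sup>2" "\<bar>\<rho> 1\<bar> \<le> e / 2 * (norm d)\<^sup>2"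
            using \<rho> z by auto
          moreover have "\<psi> 1 - \<psi> 0 = \<rho> z" using z by simp
          moreover have "\<bar>a\<bar> \<le> q \<Longrightarrow> \<bar>b\<bar> \<le> q \<Longrightarrow> \<bar>a - b / 2\<bar> \<le> 3 / 2 * q" for a b q :: real
            by linarith
          ultimately have "\<bar>(\<psi> 1 - \<psi> 0) - \<rho> 1 / 2\<bar> \<le> 3 / 2 * (e / 2 * (norm d)\<^sup>2)"
            by metis
          then show ?thesis
            unfolding \<open>f (x + d) - f x - _ = _\<close> by simp
        qed
        also have "\<dots> < e * (norm d)\<^sup>2" using e d by simp
        finally show "norm ((f (x + d) - f x - (?g x + ?g (x + d)) \<bullet> d / 2) / (norm d)\<^sup>2 - 0) < e"
          using d by (simp add: divide_less_eq)
      qed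
    qed
  qed
qed

section \<open>The standard Gaussian and Gibbs measures\<close>

lemma nn_integral_lborel_affine:
  fixes t :: "'a::euclidean_space"
  assumes [measurable]: "F \<in> borel_measurable borel" and c: "c \<noteq> 0"
  shows "(\<integral>\<^sup>+x. F x \<partial>lborel) = ennreal (\<bar>c\<bar> ^ DIM('a)) * (\<integral>\<^sup>+x. F (t + c *\<^sub>R x) \<partial>lborel)"
  by (subst lborel_affine[OF c, of t])
    (simp add: nn_integral_density nn_integral_distr nn_integral_cmult)

lemma norm_sq_Basis: "(norm (x::'a::euclidean_space))\<^sup>2 = (\<Sum>b\<in>Basis. (x \<bullet> b)\<^sup>2)"
  unfolding power2_norm_eq_inner by (subst euclidean_inner) (simp add: power2_eq_square)

lemma nn_integral_exp_neg_sq_finite: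
  assumes c: "0 < c"
  shows "(\<integral>\<^sup>+x. ennreal (exp (- c * (norm (x::'a::euclidean_space))\<^sup>2)) \<partial>lborel) < \<infinity>"
proof -
  define \<sigma> where "\<sigma> = 1 / sqrt (2 * c)"
  have \<sigma>: "0 < \<sigma>" "2 * \<sigma>\<^sup>2 = 1 / c"
    using c by (auto simp: \<sigma>_def power_divide)
  have one: "(\<integral>\<^sup>+t. ennreal (exp (- c * t\<^sup>2)) \<partial>lborel) < \<infinity>"
  proof -
    have "integrable lborel (normal_density 0 \<sigma>)"
      using \<sigma> by simp
    then have "integrable lborel (\<lambda>t. sqrt (2 * pi * \<sigma>\<^sup>2) * normal_density 0 \<sigma> t)"
      by (rule integrable_mult_right)
    moreover have "sqrt (2 * pi * \<sigma>\<^sup>2) * normal_density 0 \<sigma> t = exp (- c * t\<^sup>2)" for t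
      using \<sigma> unfolding normal_density_def by simp
    ultimately have "integrable lborel (\<lambda>t. exp (- c * t\<^sup>2))" by simp
    then show ?thesis
      by (simp add: integrable_iff_bounded)
  qed
  have "(\<integral>\<^sup>+x. ennreal (exp (- c * (norm (x::'a))\<^sup>2)) \<partial>lborel)
      = (\<integral>\<^sup>+x. (\<Prod>b\<in>Basis. ennreal (exp (- c * ((x::'a) \<bullet> b)\<^sup>2))) \<partial>lborel)"
    by (simp add: norm_sq_Basis sum_distrib_left exp_sum prod_ennreal sum_negf[symmetric])
  also have "\<dots> = (\<Prod>b\<in>(Basis::'a set). \<integral>\<^sup>+t. ennreal (exp (- c * t\<^sup>2)) \<partial>lborel)"
    by (rule nn_integral_lborel_prod) auto
  also have "\<dots> < \<infinity>"
    using one by (simp add: power_less_top_ennreal)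
  finally show ?thesis .
qed

lemma sq_le_exp: "0 \<le> t \<Longrightarrow> t\<^sup>2 \<le> 2 * exp (t::real)"
  using exp_lower_Taylor_quadratic[of t] by simp

lemma norm_power4_le_exp: "0 < c \<Longrightarrow> norm x ^ 4 \<le> 2 / c\<^sup>2 * exp (c * (norm x)\<^sup>2)"
  using sq_le_exp[of "c * (norm x)\<^sup>2"] by (simp add: power_mult_distrib field_simps)

lemma sets_std_gaussian [simp, measurable_cong]: "sets std_gaussian = sets borel"
  and space_std_gaussian [simp]: "space std_gaussian = UNIV"
  by (simp_all add: std_gaussian_def)

definition gaussian_density :: "'a::euclidean_space \<Rightarrow> real" where
  "gaussian_density x = exp (- (norm x)\<^sup>2 / 2) / sqrt (2 * pi) ^ DIM('a)"

lemma borel_measurable_gaussian_density [measurable]: "gaussian_density \<in> borel_measurable borel"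
  unfolding gaussian_density_def by measurable

lemma gaussian_density_pos: "0 < gaussian_density x"
  by (simp add: gaussian_density_def)

lemma std_gaussian_eq: "std_gaussian = density lborel (\<lambda>x. ennreal (gaussian_density x))"
  by (simp add: std_gaussian_def gaussian_density_def)

lemma gaussian_density_prod: "gaussian_density x = (\<Prod>b\<in>Basis. std_normal_density (x \<bullet> b))"
proof -
  have "exp (- (norm x)\<^sup>2 / 2) = (\<Prod>b\<in>Basis. exp (- (x \<bullet> b)\<^sup>2 / 2))"
    by (simp add: norm_sq_Basis exp_sum[symmetric] sum_divide_distrib sum_negf)
  then show ?thesis
    by (simp add: gaussian_density_def std_normal_density_def prod_dividef)
qed

lemma nn_integral_std_gaussian:
  assumes [measurable]: "F \<in> borel_measurable borel"
  shows "(\<integral>\<^sup>+z. F z \<partial>std_gaussian) = (\<integral>\<^sup>+z. ennreal (gaussian_density z) * F z \<partial>lborel)"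
  unfolding std_gaussian_eq by (simp add: nn_integral_density)

lemma nn_integral_std_normal_density: "(\<integral>\<^sup>+t. ennreal (std_normal_density t) \<partial>lborel) = 1"
  using prob_space.emeasure_space_1[OF prob_space_normal_density[of 1 0]]
  by (simp add: emeasure_density)

lemma prob_space_std_gaussian: "prob_space (std_gaussian :: 'a::euclidean_space measure)"
proof
  have "emeasure (std_gaussian :: 'a measure) (space std_gaussian)
      = (\<integral>\<^sup>+x. (\<Prod>b\<in>Basis. ennreal (std_normal_density ((x::'a) \<bullet> b))) \<partial>lborel)"
    by (simp add: std_gaussian_eq emeasure_density gaussian_density_prod prod_ennreal)
  also have "\<dots> = (\<Prod>b\<in>(Basis::'a set). \<integral>\<^sup>+t. ennreal (std_normal_density t) \<partial>lborel)"
    by (rule nn_integral_lborel_prod) auto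
  finally show "emeasure (std_gaussian :: 'a measure) (space std_gaussian) = 1"
    by (simp add: nn_integral_std_normal_density)
qed

lemma nn_integral_std_gaussian_inner_sq:
  assumes b: "b \<in> (Basis :: 'a::euclidean_space set)"
  shows "(\<integral>\<^sup>+z. ennreal ((z \<bullet> b)\<^sup>2) \<partial>std_gaussian) = 1"
proof -
  \<comment> \<open>The square sits in the factor of coordinate \<open>b\<close> alone, so the
    integrand still factorizes.\<close>
  define \<phi> :: "'a \<Rightarrow> real \<Rightarrow> real" where
    "\<phi> c t = (if c = b then t\<^sup>2 else 1) * std_normal_density t" for c t
  have "has_bochner_integral lborel (\<lambda>t. std_normal_density t * t ^ (2 * 1)) 1"
    using std_normal_moment_even[of 1] by (simp add: fact_numeral)
  then have "(\<integral>\<^sup>+t. ennreal (std_normal_density t * t\<^sup>2) \<partial>lborel) = 1"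
    by (subst nn_integral_eq_integral)
      (auto simp: has_bochner_integral_iff)
  then have I: "(\<integral>\<^sup>+t. ennreal (\<phi> c t) \<partial>lborel) = 1" for c
    by (cases "c = b") (simp_all add: \<phi>_def nn_integral_std_normal_density mult.commute)
  have gp: "gaussian_density z * (z \<bullet> b)\<^sup>2 = (\<Prod>c\<in>Basis. \<phi> c (z \<bullet> c))" for z
    unfolding \<phi>_def prod.distrib gaussian_density_prod using b by (simp add: prod.delta)
  have "(\<integral>\<^sup>+z. ennreal ((z \<bullet> b)\<^sup>2) \<partial>std_gaussian)
      = (\<integral>\<^sup>+z. (\<Prod>c\<in>Basis. ennreal (\<phi> c ((z::'a) \<bullet> c))) \<partial>lborel)"
  proof (subst nn_integral_std_gaussian, simp, rule nn_integral_cong)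
    fix z :: 'a
    have "(\<Prod>c\<in>Basis. ennreal (\<phi> c (z \<bullet> c))) = ennreal (\<Prod>c\<in>Basis. \<phi> c (z \<bullet> c))"
      by (rule prod_ennreal) (simp add: \<phi>_def)
    then show "ennreal (gaussian_density z) * ennreal ((z \<bullet> b)\<^sup>2) = (\<Prod>c\<in>Basis. ennreal (\<phi> c (z \<bullet> c)))"
      unfolding gp[symmetric] by (simp only: ennreal_mult less_imp_le[OF gaussian_density_pos] zero_le_power2)
  qed
  also have "\<dots> = (\<Prod>c\<in>(Basis::'a set). \<integral>\<^sup>+t. ennreal (\<phi> c t) \<partial>lborel)"
    by (rule nn_integral_lborel_prod) (auto simp: \<phi>_def)
  finally show ?thesis by (simp add: I)
qed

lemma nn_integral_std_gaussian_norm_sq: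
  "(\<integral>\<^sup>+z. ennreal ((norm z)\<^sup>2) \<partial>(std_gaussian :: 'a::euclidean_space measure)) = DIM('a)"
proof -
  have "(\<integral>\<^sup>+z. ennreal ((norm z)\<^sup>2) \<partial>(std_gaussian :: 'a measure))
      = (\<Sum>b\<in>(Basis::'a set). \<integral>\<^sup>+z. ennreal ((z \<bullet> b)\<^sup>2) \<partial>std_gaussian)"
    unfolding norm_sq_Basis
    by (simp add: sum_ennreal[symmetric] nn_integral_sum del: sum_ennreal)
  then show ?thesis
    by (simp add: nn_integral_std_gaussian_inner_sq)
qed

lemma nn_integral_std_gaussian_norm_power4:
  "(\<integral>\<^sup>+z. ennreal (norm z ^ 4) \<partial>(std_gaussian :: 'a::euclidean_space measure)) < \<infinity>"
proof -
  have "(\<integral>\<^sup>+z. ennreal (norm z ^ 4) \<partial>(std_gaussian :: 'a measure))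
      \<le> (\<integral>\<^sup>+z. ennreal 32 * ennreal (exp (- (1 / 4) * (norm (z::'a))\<^sup>2)) \<partial>lborel)"
  proof (subst nn_integral_std_gaussian, simp, rule nn_integral_mono)
    fix z :: 'a
    have pi: "1 \<le> sqrt (2 * pi) ^ DIM('a)"
      using pi_gt3 by (intro one_le_power) simp
    have "gaussian_density z * norm z ^ 4 \<le> exp (- (norm z)\<^sup>2 / 2) * norm z ^ 4"
      unfolding gaussian_density_def using pi by (intro mult_right_mono) (auto simp: divide_le_eq)
    \<comment> \<open>\<open>32 = 2 / (1/4)^2\<close> comes from \<open>norm_power4_le_exp\<close>;
      half of the Gaussian exponent is spent on the fourth power.\<close>
    also have "\<dots> \<le> exp (- (norm z)\<^sup>2 / 2) * (32 * exp ((norm z)\<^sup>2 / 4))"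
      using norm_power4_le_exp[of "1 / 4" z] by (intro mult_left_mono) (auto simp: power2_eq_square)
    also have "\<dots> = 32 * exp (- (1 / 4) * (norm z)\<^sup>2)"
      by (simp add: exp_add[symmetric] field_simps)
    finally show "ennreal (gaussian_density z) * ennreal (norm z ^ 4)
        \<le> ennreal 32 * ennreal (exp (- (1 / 4) * (norm z)\<^sup>2))"
      by (simp only: ennreal_mult[symmetric] less_imp_le[OF gaussian_density_pos] ennreal_leI
          zero_le_power norm_ge_zero exp_ge_zero zero_le_numeral)
  qed
  also have "\<dots> < \<infinity>"
    using nn_integral_exp_neg_sq_finite[of "1 / 4", where 'a='a]
    by (subst nn_integral_cmult) (auto simp: ennreal_mult_less_top)
  finally show ?thesis .
qed

text \<open>Substitute \<open>w = c x + s y\<close> for \<open>y\<close>. The joint density of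
  \<open>(x, w)\<close> is symmetric in its two arguments (\<open>swap\<close>), so after Fubini the
  inner integral over \<open>x\<close> is that of a shifted and rescaled Gaussian density and equals
  1 (\<open>one\<close>).\<close>

lemma nn_integral_std_gaussian_rotation:
  fixes F :: "'a::euclidean_space \<Rightarrow> ennreal"
  assumes [measurable]: "F \<in> borel_measurable borel" and cs: "c\<^sup>2 + s\<^sup>2 = 1" and s: "s \<noteq> 0"
  shows "(\<integral>\<^sup>+x. \<integral>\<^sup>+y. F (c *\<^sub>R x + s *\<^sub>R y) \<partial>std_gaussian \<partial>std_gaussian) = (\<integral>\<^sup>+w. F w \<partial>std_gaussian)"
proof -
  let ?\<phi> = "gaussian_density :: 'a \<Rightarrow> real" and ?k = "\<bar>1 / s\<bar> ^ DIM('a)"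
  have k: "0 \<le> ?k" by simp
  note pos [simp] = less_imp_le[OF gaussian_density_pos]
  have swap: "?\<phi> x * ?\<phi> ((1 / s) *\<^sub>R (w - c *\<^sub>R x)) = ?\<phi> w * ?\<phi> ((1 / s) *\<^sub>R (x - c *\<^sub>R w))" for x w
  proof -
    have "(norm x)\<^sup>2 + (norm ((1 / s) *\<^sub>R (w - c *\<^sub>R x)))\<^sup>2 = (norm w)\<^sup>2 + (norm ((1 / s) *\<^sub>R (x - c *\<^sub>R w)))\<^sup>2"
    proof -
      have "s\<^sup>2 * (norm x)\<^sup>2 + (norm (w - c *\<^sub>R x))\<^sup>2 = s\<^sup>2 * (norm w)\<^sup>2 + (norm (x - c *\<^sub>R w))\<^sup>2"
        using cs unfolding norm_diff_sq
        by (simp add: power_mult_distrib inner_commute) algebra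
      then show ?thesis
        using s unfolding norm_scaleR power_mult_distrib by (simp add: power_divide field_simps)
    qed
    then have "- (norm x)\<^sup>2 / 2 + - (norm ((1 / s) *\<^sub>R (w - c *\<^sub>R x)))\<^sup>2 / 2
        = - (norm w)\<^sup>2 / 2 + - (norm ((1 / s) *\<^sub>R (x - c *\<^sub>R w)))\<^sup>2 / 2" by argo
    then have "exp (- (norm x)\<^sup>2 / 2) * exp (- (norm ((1 / s) *\<^sub>R (w - c *\<^sub>R x)))\<^sup>2 / 2)
        = exp (- (norm w)\<^sup>2 / 2) * exp (- (norm ((1 / s) *\<^sub>R (x - c *\<^sub>R w)))\<^sup>2 / 2)"
      unfolding exp_add[symmetric] by (rule arg_cong)
    then show ?thesis
      unfolding gaussian_density_def by (simp del: norm_scaleR)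
  qed
  have sub: "(\<integral>\<^sup>+y. ennreal (?\<phi> y) * F (c *\<^sub>R x + s *\<^sub>R y) \<partial>lborel)
      = ennreal ?k * (\<integral>\<^sup>+w. ennreal (?\<phi> ((1 / s) *\<^sub>R (w - c *\<^sub>R x))) * F w \<partial>lborel)" for x
    by (subst nn_integral_lborel_affine[where c = "1 / s" and t = "- (c / s) *\<^sub>R x"])
      (use s in \<open>auto simp: algebra_simps intro!: arg_cong2[where f="(*)"] nn_integral_cong\<close>)
  have one: "ennreal ?k * (\<integral>\<^sup>+x. ennreal (?\<phi> ((1 / s) *\<^sub>R (x - c *\<^sub>R w))) \<partial>lborel) = 1" for w
  proof -
    have "(1::ennreal) = (\<integral>\<^sup>+x. ennreal (?\<phi> x) \<partial>lborel)"
      using prob_space.emeasure_space_1[OF prob_space_std_gaussian[where 'a='a]]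
      by (simp add: std_gaussian_eq emeasure_density)
    also have "\<dots> = ennreal ?k * (\<integral>\<^sup>+x. ennreal (?\<phi> ((1 / s) *\<^sub>R (x - c *\<^sub>R w))) \<partial>lborel)"
      by (subst nn_integral_lborel_affine[where c = "1 / s" and t = "- (c / s) *\<^sub>R w"])
        (use s in \<open>auto simp: algebra_simps intro!: arg_cong2[where f="(*)"] nn_integral_cong\<close>)
    finally show ?thesis by simp
  qed
  have "(\<integral>\<^sup>+x. \<integral>\<^sup>+y. F (c *\<^sub>R x + s *\<^sub>R y) \<partial>std_gaussian \<partial>std_gaussian)
      = (\<integral>\<^sup>+x. ennreal (?\<phi> x) * (ennreal ?k * (\<integral>\<^sup>+w. ennreal (?\<phi> ((1 / s) *\<^sub>R (w - c *\<^sub>R x))) * F w \<partial>lborel)) \<partial>lborel)"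
    by (simp add: nn_integral_std_gaussian sub)
  also have "\<dots> = (\<integral>\<^sup>+x. \<integral>\<^sup>+w. ennreal ?k * (ennreal (?\<phi> x * ?\<phi> ((1 / s) *\<^sub>R (w - c *\<^sub>R x))) * F w) \<partial>lborel \<partial>lborel)"
    by (intro nn_integral_cong) (simp add: nn_integral_cmult[symmetric] ennreal_mult mult_ac)
  also have "\<dots> = (\<integral>\<^sup>+w. \<integral>\<^sup>+x. ennreal ?k * (ennreal (?\<phi> x * ?\<phi> ((1 / s) *\<^sub>R (w - c *\<^sub>R x))) * F w) \<partial>lborel \<partial>lborel)"
    by (rule lborel_pair.Fubini') measurable
  also have "\<dots> = (\<integral>\<^sup>+w. (ennreal ?k * (\<integral>\<^sup>+x. ennreal (?\<phi> ((1 / s) *\<^sub>R (x - c *\<^sub>R w))) \<partial>lborel)) * (ennreal (?\<phi> w) * F w) \<partial>lborel)"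
    unfolding swap
    by (intro nn_integral_cong) (simp add: nn_integral_cmult[symmetric] nn_integral_multc[symmetric] ennreal_mult mult_ac)
  finally show ?thesis
    unfolding one by (simp add: nn_integral_std_gaussian)
qed

section \<open>The Gibbs measure: normalization and fourth moments\<close>

context potential
begin

text \<open>Half of the quadratic growth that \<open>lower\<close> gives at 0 absorbs the linear
  term \<open>g 0 \<bullet> x\<close>.\<close>

lemma exp_neg_f_bound: "\<exists>C>0. \<forall>x. exp (- f x) \<le> C * exp (- (m / 4) * (norm x)\<^sup>2)"
proof (intro exI conjI allI)
  fix x :: 'a
  have "norm (g 0) * norm x \<le> m / 4 * (norm x)\<^sup>2 + (norm (g 0))\<^sup>2 / m"
  proof -
    have "0 \<le> (m / 2 * norm x - norm (g 0))\<^sup>2 / m" using m_pos by simp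
    also have "\<dots> = m / 4 * (norm x)\<^sup>2 + (norm (g 0))\<^sup>2 / m - norm (g 0) * norm x"
      using m_pos by (simp add: power2_eq_square field_simps)
    finally show ?thesis by simp
  qed
  moreover have "- (g 0 \<bullet> x) \<le> norm (g 0) * norm x"
    using norm_cauchy_schwarz[of "- g 0" x] by simp
  ultimately have "- f x \<le> (- f 0 + (norm (g 0))\<^sup>2 / m) + - (m / 4) * (norm x)\<^sup>2"
    using lower[of 0 x] by simp
  then have "exp (- f x) \<le> exp ((- f 0 + (norm (g 0))\<^sup>2 / m) + - (m / 4) * (norm x)\<^sup>2)"
    by simp
  then show "exp (- f x) \<le> exp (- f 0 + (norm (g 0))\<^sup>2 / m) * exp (- (m / 4) * (norm x)\<^sup>2)"
    unfolding exp_add .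
qed simp

lemma gibbs_normalization:
  obtains c where "0 < c" "gibbs f = density lborel (\<lambda>x. ennreal (c * exp (- f x)))"
    "prob_space (gibbs f)"
proof -
  let ?Z = "\<integral>\<^sup>+ y. ennreal (exp (- f y)) \<partial>lborel"
  obtain C where C: "0 < C" "\<And>x. exp (- f x) \<le> C * exp (- (m / 4) * (norm x)\<^sup>2)"
    using exp_neg_f_bound by blast
  have "?Z \<le> (\<integral>\<^sup>+x. ennreal C * ennreal (exp (- (m / 4) * (norm (x::'a))\<^sup>2)) \<partial>lborel)"
    using C by (intro nn_integral_mono) (simp add: ennreal_mult'[symmetric] ennreal_leI)
  also have "\<dots> < \<infinity>"
    using nn_integral_exp_neg_sq_finite[of "m / 4", where 'a='a] m_pos
    by (subst nn_integral_cmult) (auto simp: ennreal_mult_less_top)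
  finally have fin: "?Z < \<infinity>" .
  have "?Z \<noteq> 0"
  proof
    assume "?Z = 0"
    then have "AE x in lborel. ennreal (exp (- f x)) = 0"
      by (subst (asm) nn_integral_0_iff_AE) auto
    then have "AE x in (lborel :: 'a measure). False" by simp
    then have "emeasure lborel (UNIV :: 'a set) = 0"
      by (subst (asm) AE_iff_null) (auto simp: null_sets_def)
    then show False by simp
  qed
  then have z: "0 < enn2real ?Z" "?Z = ennreal (enn2real ?Z)"
    using fin by (auto simp: enn2real_positive_iff less_top zero_less_iff_neq_zero)
  let ?c = "1 / enn2real ?Z"
  have eq: "gibbs f = density lborel (\<lambda>x. ennreal (?c * exp (- f x)))"
    unfolding gibbs_def
    by (rule arg_cong[where f="density lborel"], rule ext, subst z(2)) (use z(1) in \<open>simp add: divide_ennreal\<close>)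
  moreover have "prob_space (gibbs f)"
  proof
    have "emeasure (gibbs f) (space (gibbs f)) = (\<integral>\<^sup>+ x. ennreal ?c * ennreal (exp (- f x)) \<partial>lborel)"
      unfolding eq using z(1) by (simp add: emeasure_density ennreal_mult'[symmetric])
    also have "\<dots> = ennreal ?c * ennreal (enn2real ?Z)"
      using z by (subst nn_integral_cmult) auto
    also have "\<dots> = 1"
      using z(1) by (simp add: ennreal_mult'[symmetric] del: ennreal_enn2real)
    finally show "emeasure (gibbs f) (space (gibbs f)) = 1" .
  qed
  ultimately show thesis
    using z(1) by (intro that[of ?c]) auto
qed

lemma sets_gibbs [simp, measurable_cong]: "sets (gibbs f) = sets borel"
  and space_gibbs [simp]: "space (gibbs f) = UNIV"
  by (simp_all add: gibbs_def)

lemma prob_space_gibbs: "prob_space (gibbs f)"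
  using gibbs_normalization by blast

text \<open>Fourth moments are needed because the function dominating \<open>rejection_rate\<close>
  is quadratic in \<open>|g x|^2 + |z|^2\<close>.\<close>

lemma nn_integral_gibbs_norm_power4: "(\<integral>\<^sup>+x. ennreal (norm x ^ 4) \<partial>gibbs f) < \<infinity>"
proof -
  obtain c where c: "0 < c" "gibbs f = density lborel (\<lambda>x. ennreal (c * exp (- f x)))"
    using gibbs_normalization by blast
  obtain C where C: "0 < C" "\<And>x. exp (- f x) \<le> C * exp (- (m / 4) * (norm x)\<^sup>2)"
    using exp_neg_f_bound by blast
  define K where "K = c * C * (2 / (m / 8)\<^sup>2)"
  have K: "0 \<le> K" using c C by (simp add: K_def)
  have "(\<integral>\<^sup>+x. ennreal (norm x ^ 4) \<partial>gibbs f)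
      \<le> (\<integral>\<^sup>+x. ennreal K * ennreal (exp (- (m / 8) * (norm (x::'a))\<^sup>2)) \<partial>lborel)"
    unfolding c(2)
  proof (subst nn_integral_density, simp, simp, rule nn_integral_mono)
    fix x :: 'a
    have "c * exp (- f x) * norm x ^ 4
        \<le> c * (C * exp (- (m / 4) * (norm x)\<^sup>2)) * (2 / (m / 8)\<^sup>2 * exp (m / 8 * (norm x)\<^sup>2))"
      using c C norm_power4_le_exp[of "m / 8" x] m_pos by (intro mult_mono) auto
    also have "\<dots> = K * (exp (- (m / 4) * (norm x)\<^sup>2) * exp (m / 8 * (norm x)\<^sup>2))"
      by (simp add: K_def)
    also have "exp (- (m / 4) * (norm x)\<^sup>2) * exp (m / 8 * (norm x)\<^sup>2) = exp (- (m / 8) * (norm x)\<^sup>2)"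
      by (simp add: exp_add[symmetric])
    finally show "ennreal (c * exp (- f x)) * ennreal (norm x ^ 4)
        \<le> ennreal K * ennreal (exp (- (m / 8) * (norm x)\<^sup>2))"
      using c K by (simp add: ennreal_mult'[symmetric] ennreal_leI)
  qed
  also have "\<dots> < \<infinity>"
    using nn_integral_exp_neg_sq_finite[of "m / 8", where 'a='a] m_pos
    by (subst nn_integral_cmult) (auto simp: ennreal_mult_less_top)
  finally show ?thesis .
qed

end

section \<open>The \<open>L\<^sup>2\<close> norm of random vectors\<close>

definition square_integrable :: "'w measure \<Rightarrow> ('w \<Rightarrow> 'a::euclidean_space) \<Rightarrow> bool" where
  "square_integrable P F \<longleftrightarrow> F \<in> borel_measurable P \<and> integrable P (\<lambda>\<omega>. (norm (F \<omega>))\<^sup>2)"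

definition l2norm :: "'w measure \<Rightarrow> ('w \<Rightarrow> 'a::euclidean_space) \<Rightarrow> real" where
  "l2norm P F = sqrt (\<integral>\<omega>. (norm (F \<omega>))\<^sup>2 \<partial>P)"

lemma square_integrable_measurable: "square_integrable P F \<Longrightarrow> F \<in> borel_measurable P"
  and square_integrable_integrable: "square_integrable P F \<Longrightarrow> integrable P (\<lambda>\<omega>. (norm (F \<omega>))\<^sup>2)"
  by (simp_all add: square_integrable_def)

lemma l2norm_nonneg [simp]: "0 \<le> l2norm P F"
  by (simp add: l2norm_def)

lemma l2norm_sq: "(l2norm P F)\<^sup>2 = (\<integral>\<omega>. (norm (F \<omega>))\<^sup>2 \<partial>P)"
  by (simp add: l2norm_def)

lemma square_integrable_bound:
  assumes "F \<in> borel_measurable P" "square_integrable P G"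
    and "\<And>\<omega>. \<omega> \<in> space P \<Longrightarrow> norm (F \<omega>) \<le> norm (G \<omega>)"
  shows "square_integrable P F" "l2norm P F \<le> l2norm P G"
proof -
  show F: "square_integrable P F"
    unfolding square_integrable_def
  proof
    show "integrable P (\<lambda>\<omega>. (norm (F \<omega>))\<^sup>2)"
      using assms by (intro Bochner_Integration.integrable_bound[OF square_integrable_integrable[OF assms(2)]])
        (auto intro!: AE_I2 power_mono)
  qed (rule assms)
  show "l2norm P F \<le> l2norm P G"
    unfolding l2norm_def using F assms
    by (intro real_sqrt_le_mono integral_mono square_integrable_integrable) (auto intro!: power_mono)
qed

lemma square_integrable_add:
  assumes "square_integrable P F" "square_integrable P G"
  shows "square_integrable P (\<lambda>\<omega>. F \<omega> + G \<omega>)"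
proof -
  have [measurable]: "F \<in> borel_measurable P" "G \<in> borel_measurable P"
    using assms by (auto intro: square_integrable_measurable)
  have "integrable P (\<lambda>\<omega>. 2 * (norm (F \<omega>))\<^sup>2 + 2 * (norm (G \<omega>))\<^sup>2)"
    using assms[THEN square_integrable_integrable] by simp
  then have "integrable P (\<lambda>\<omega>. (norm (F \<omega> + G \<omega>))\<^sup>2)"
  proof (rule Bochner_Integration.integrable_bound; (intro AE_I2)?)
    fix \<omega>
    have "(norm (F \<omega> + G \<omega>))\<^sup>2 \<le> (norm (F \<omega>) + norm (G \<omega>))\<^sup>2"
      by (intro power_mono norm_triangle_ineq) simp
    also have "\<dots> \<le> 2 * (norm (F \<omega>))\<^sup>2 + 2 * (norm (G \<omega>))\<^sup>2"
      using zero_le_power2[of "norm (F \<omega>) - norm (G \<omega>)"] by (simp add: power2_eq_square algebra_simps)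
    finally show "norm ((norm (F \<omega> + G \<omega>))\<^sup>2) \<le> norm (2 * (norm (F \<omega>))\<^sup>2 + 2 * (norm (G \<omega>))\<^sup>2)"
      by simp
  qed measurable
  then show ?thesis by (simp add: square_integrable_def)
qed

lemma square_integrable_scaleR:
  "square_integrable P F \<Longrightarrow> square_integrable P (\<lambda>\<omega>. c *\<^sub>R F \<omega>)"
  by (auto simp: square_integrable_def power_mult_distrib)

lemma l2norm_scaleR: "l2norm P (\<lambda>\<omega>. c *\<^sub>R F \<omega>) = \<bar>c\<bar> * l2norm P F"
  by (simp add: l2norm_def power_mult_distrib real_sqrt_mult)

lemma square_integrable_diff:
  assumes "square_integrable P F" "square_integrable P G"
  shows "square_integrable P (\<lambda>\<omega>. F \<omega> - G \<omega>)"
  using square_integrable_add[OF assms(1) square_integrable_scaleR[OF assms(2), of "-1"]] by simp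

lemma square_integrable_zero: "square_integrable P (\<lambda>\<omega>. 0)"
  by (simp add: square_integrable_def)

lemma square_integrable_sum:
  "(\<And>i. i \<in> I \<Longrightarrow> square_integrable P (F i)) \<Longrightarrow> square_integrable P (\<lambda>\<omega>. \<Sum>i\<in>I. F i \<omega>)"
  by (induction I rule: infinite_finite_induct) (auto simp: square_integrable_zero intro: square_integrable_add)

lemma square_integrable_inner:
  assumes "square_integrable P F" "square_integrable P G"
  shows "integrable P (\<lambda>\<omega>. F \<omega> \<bullet> G \<omega>)"
proof -
  have "integrable P (\<lambda>\<omega>. ((norm (F \<omega> + G \<omega>))\<^sup>2 - (norm (F \<omega>))\<^sup>2 - (norm (G \<omega>))\<^sup>2) / 2)"
    using assms[THEN square_integrable_integrable]
      square_integrable_add[OF assms, THEN square_integrable_integrable] by simp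
  then show ?thesis by (simp add: norm_add_sq)
qed

text \<open>The integral of \<open>|t F - G|^2\<close> is nonnegative for all \<open>t\<close>, and
  \<open>t = b / a\<close> is optimal. If one of the norms vanishes, a large or a small
  \<open>t\<close>, respectively, excludes a positive inner product.\<close>

lemma l2norm_Cauchy_Schwarz:
  assumes F: "square_integrable P F" and G: "square_integrable P G"
  shows "(\<integral>\<omega>. F \<omega> \<bullet> G \<omega> \<partial>P) \<le> l2norm P F * l2norm P G"
proof -
  let ?I = "\<integral>\<omega>. F \<omega> \<bullet> G \<omega> \<partial>P" and ?a = "l2norm P F" and ?b = "l2norm P G"
  have *: "2 * t * ?I \<le> t\<^sup>2 * ?a\<^sup>2 + ?b\<^sup>2" for t
  proof -
    note i = square_integrable_inner[OF F G] square_integrable_integrable[OF F] square_integrable_integrable[OF G]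
    have "0 \<le> (\<integral>\<omega>. (norm (t *\<^sub>R F \<omega> - G \<omega>))\<^sup>2 \<partial>P)" by simp
    also have "\<dots> = (\<integral>\<omega>. t\<^sup>2 * (norm (F \<omega>))\<^sup>2 - 2 * t * (F \<omega> \<bullet> G \<omega>) + (norm (G \<omega>))\<^sup>2 \<partial>P)"
      unfolding norm_diff_sq by (simp add: power_mult_distrib mult.assoc)
    also have "\<dots> = t\<^sup>2 * ?a\<^sup>2 - 2 * t * ?I + ?b\<^sup>2"
      using i unfolding l2norm_sq by simp
    finally show ?thesis by simp
  qed
  consider "?a = 0" | "?b = 0" | "?a > 0" "?b > 0"
    by (metis l2norm_nonneg order_le_less)
  then show ?thesis
  proof cases
    case 1
    have "?I \<le> 0"
    proof (rule ccontr)
      assume "\<not> ?I \<le> 0"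
      then have "2 * ((?b\<^sup>2 + 1) / ?I) * ?I = 2 * (?b\<^sup>2 + 1)" by simp
      with *[of "(?b\<^sup>2 + 1) / ?I"] 1 have "2 * (?b\<^sup>2 + 1) \<le> ?b\<^sup>2"
        by simp
      then have "?b\<^sup>2 \<le> - 2" by argo
      then show False using zero_le_power2[of ?b] by simp
    qed
    then show ?thesis using 1 by simp
  next
    case 2
    have "?I \<le> 0"
    proof (rule ccontr)
      assume I: "\<not> ?I \<le> 0"
      have "0 < ?a\<^sup>2 + 1" by (simp add: add_nonneg_pos)
      define t where "t = ?I / (?a\<^sup>2 + 1)"
      have t: "0 < t" "?I = t * (?a\<^sup>2 + 1)"
        using I \<open>0 < ?a\<^sup>2 + 1\<close> by (auto simp: t_def)
      have "2 * t * (t * (?a\<^sup>2 + 1)) \<le> t\<^sup>2 * ?a\<^sup>2"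
        using *[of t] 2 t(2) by simp
      then have "t\<^sup>2 * (?a\<^sup>2 + 2) \<le> 0" by (simp add: power2_eq_square algebra_simps)
      moreover have "0 < t\<^sup>2 * (?a\<^sup>2 + 2)"
        using t by (intro mult_pos_pos) (auto simp: add_nonneg_pos)
      ultimately show False by simp
    qed
    then show ?thesis using 2 by simp
  next
    case 3
    then have "2 * (?b / ?a) * ?I \<le> 2 * ?b\<^sup>2"
      using *[of "?b / ?a"] by (simp add: power_divide)
    then show ?thesis using 3 by (simp add: field_simps power2_eq_square)
  qed
qed

lemma l2norm_triangle:
  assumes F: "square_integrable P F" and G: "square_integrable P G"
  shows "l2norm P (\<lambda>\<omega>. F \<omega> + G \<omega>) \<le> l2norm P F + l2norm P G"
proof (rule power2_le_imp_le)
  note i = square_integrable_inner[OF F G] square_integrable_integrable[OF F] square_integrable_integrable[OF G]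
  have "(l2norm P (\<lambda>\<omega>. F \<omega> + G \<omega>))\<^sup>2 = (l2norm P F)\<^sup>2 + 2 * (\<integral>\<omega>. F \<omega> \<bullet> G \<omega> \<partial>P) + (l2norm P G)\<^sup>2"
    unfolding l2norm_sq norm_add_sq using i by simp
  also have "\<dots> \<le> (l2norm P F + l2norm P G)\<^sup>2"
    using l2norm_Cauchy_Schwarz[OF F G] by (simp add: power2_sum)
  finally show "(l2norm P (\<lambda>\<omega>. F \<omega> + G \<omega>))\<^sup>2 \<le> (l2norm P F + l2norm P G)\<^sup>2" .
qed simp

lemma l2norm_triangle_diff:
  assumes F: "square_integrable P F" and G: "square_integrable P G"
  shows "l2norm P (\<lambda>\<omega>. F \<omega> - G \<omega>) \<le> l2norm P F + l2norm P G"
  using l2norm_triangle[OF F square_integrable_scaleR[OF G, of "-1"]] l2norm_scaleR[of P "-1" G] by simp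

lemma l2norm_sum:
  "finite I \<Longrightarrow> (\<And>i. i \<in> I \<Longrightarrow> square_integrable P (F i)) \<Longrightarrow>
    l2norm P (\<lambda>\<omega>. \<Sum>i\<in>I. F i \<omega>) \<le> (\<Sum>i\<in>I. l2norm P (F i))"
proof (induction I rule: finite_induct)
  case empty
  then show ?case by (simp add: l2norm_def)
next
  case (insert i I)
  then have "l2norm P (\<lambda>\<omega>. F i \<omega> + (\<Sum>i\<in>I. F i \<omega>)) \<le> l2norm P (F i) + l2norm P (\<lambda>\<omega>. \<Sum>i\<in>I. F i \<omega>)"
    by (intro l2norm_triangle square_integrable_sum) auto
  with insert show ?case by simp
qed

lemma nn_integral_norm_sq:
  "square_integrable P F \<Longrightarrow> (\<integral>\<^sup>+\<omega>. ennreal ((norm (F \<omega>))\<^sup>2) \<partial>P) = ennreal ((l2norm P F)\<^sup>2)"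
  unfolding l2norm_sq by (rule nn_integral_eq_integral) (auto intro: square_integrable_integrable)

text \<open>The bridge from laws, which are computed as nonnegative integrals, to the
  \<open>L^2\<close> calculus.\<close>

lemma square_integrable_nn_integral:
  assumes [measurable]: "F \<in> borel_measurable P" and le: "(\<integral>\<^sup>+\<omega>. ennreal ((norm (F \<omega>))\<^sup>2) \<partial>P) \<le> ennreal c"
    and c: "0 \<le> c"
  shows "square_integrable P F" "l2norm P F \<le> sqrt c"
proof -
  have "(\<integral>\<^sup>+\<omega>. ennreal ((norm (F \<omega>))\<^sup>2) \<partial>P) < \<infinity>"
    using le_less_trans[OF le] by simp
  then show F: "square_integrable P F"
    unfolding square_integrable_def by (auto simp: integrable_iff_bounded)
  have "(l2norm P F)\<^sup>2 \<le> c"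
    using le c unfolding nn_integral_norm_sq[OF F] by simp
  then show "l2norm P F \<le> sqrt c"
    by (rule real_le_rsqrt)
qed

section \<open>The Metropolis-adjusted Langevin algorithm\<close>

abbreviation unif01 :: "real measure" where
  "unif01 \<equiv> uniform_measure lborel {0..1}"

lemma prob_space_unif01: "prob_space unif01"
  by (rule prob_space_uniform_measure) auto

lemma nn_integral_unif01_threshold:
  assumes c: "0 \<le> c"
  shows "(\<integral>\<^sup>+v. (if v \<le> c then A else B) \<partial>unif01) = ennreal (min 1 c) * A + ennreal (1 - min 1 c) * B"
proof -
  have "(\<integral>\<^sup>+v. (if v \<le> c then A else B) \<partial>unif01)
      = (\<integral>\<^sup>+v. A * indicator {..c} v + B * indicator {c<..} v \<partial>unif01)"
    by (intro nn_integral_cong) (auto simp: indicator_def)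
  also have "\<dots> = A * emeasure unif01 {..c} + B * emeasure unif01 {c<..}"
    by (subst nn_integral_add) (auto simp: nn_integral_cmult_indicator)
  also have "emeasure unif01 {..c} = ennreal (min 1 c)"
  proof -
    have "{0..1} \<inter> {..c} = {0..min 1 c}" using c by auto
    then show ?thesis using c by (simp add: divide_ennreal_def)
  qed
  also have "emeasure unif01 {c<..} = ennreal (1 - min 1 c)"
  proof (cases "c \<le> 1")
    case True
    then have "{0..1} \<inter> {c<..} = {c<..1}" using c by auto
    then show ?thesis using True by (simp add: divide_ennreal_def)
  next
    case False
    then have "{0..1} \<inter> {c<..} = {}" by auto
    then show ?thesis using False by simp
  qed
  finally show ?thesis by (simp add: mult.commute)
qed

text \<open>The randomness of one Metropolis step: the Gaussian increment of the proposal and the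
  uniform variable that decides on acceptance.\<close>

definition noise :: "('a::euclidean_space \<times> real) measure" where
  "noise = std_gaussian \<Otimes>\<^sub>M unif01"

lemma sets_noise [simp, measurable_cong]: "sets noise = sets borel"
  unfolding noise_def borel_prod[symmetric] by (rule sets_pair_measure_cong) simp_all

lemma space_noise [simp]: "space noise = UNIV"
  by (simp add: noise_def space_pair_measure)

lemma prob_space_noise: "prob_space noise"
  unfolding noise_def by (intro prob_space_pair prob_space_std_gaussian prob_space_unif01)

lemma nn_integral_noise:
  assumes [measurable]: "F \<in> borel_measurable (borel :: ('a::euclidean_space \<times> real) measure)"
  shows "(\<integral>\<^sup>+s. F s \<partial>noise) = (\<integral>\<^sup>+z. \<integral>\<^sup>+v. F (z, v) \<partial>unif01 \<partial>std_gaussian)"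
proof -
  interpret prob_space unif01 by (rule prob_space_unif01)
  have "F \<in> borel_measurable (std_gaussian \<Otimes>\<^sub>M unif01)"
    using assms by (subst measurable_cong_sets[OF sets_noise[unfolded noise_def] refl])
  then show ?thesis
    unfolding noise_def by (simp add: nn_integral_fst[symmetric])
qed

context potential
begin

definition proposal :: "real \<Rightarrow> 'a \<Rightarrow> 'a \<Rightarrow> 'a" where
  "proposal \<eta> x z = x - \<eta> *\<^sub>R g x + sqrt (2 * \<eta>) *\<^sub>R z"

text \<open>The logarithm of \<pi>(y) q(y, x) / (\<pi>(x) q(x, y)), where q(x, -) is the Gaussian
  law of the proposal from \<open>x\<close>. The terms \<open>|y - x|^2 / (4 \<eta>)\<close> have
  cancelled, which leaves minus the trapezoidal error of \<open>f\<close> and a term of higher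
  order.\<close>

definition log_ratio :: "real \<Rightarrow> 'a \<Rightarrow> 'a \<Rightarrow> real" where
  "log_ratio \<eta> x y = f x - f y + (g x + g y) \<bullet> (y - x) / 2 - \<eta> / 4 * ((norm (g y))\<^sup>2 - (norm (g x))\<^sup>2)"

text \<open>One step of the Metropolis-adjusted Langevin algorithm. It leaves the Gibbs measure exactly
  invariant and differs from the Euler step \<^term>\<open>proposal \<eta> x (fst s)\<close> by \<open>o(\<eta>)\<close> in the mean square
  sense, so that \<open>1 / \<eta>\<close> such steps take the part of the stationary Langevin diffusion.\<close>

definition mala :: "real \<Rightarrow> 'a \<Rightarrow> 'a \<times> real \<Rightarrow> 'a" where
  "mala \<eta> x s = (if snd s \<le> exp (log_ratio \<eta> x (proposal \<eta> x (fst s))) then proposal \<eta> x (fst s) else x)"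

definition acceptance :: "real \<Rightarrow> 'a \<Rightarrow> 'a \<Rightarrow> real" where
  "acceptance \<eta> x y = min 1 (exp (log_ratio \<eta> x y))"

lemma acceptance_range: "0 \<le> acceptance \<eta> x y" "acceptance \<eta> x y \<le> 1"
  by (auto simp: acceptance_def)

lemma measurable_proposal [measurable (raw)]:
  assumes [measurable]: "X \<in> borel_measurable N" "Z \<in> borel_measurable N"
  shows "(\<lambda>\<omega>. proposal \<eta> (X \<omega>) (Z \<omega>)) \<in> borel_measurable N"
  unfolding proposal_def by measurable

lemma measurable_log_ratio [measurable (raw)]:
  assumes [measurable]: "X \<in> borel_measurable N" "Y \<in> borel_measurable N"
  shows "(\<lambda>\<omega>. log_ratio \<eta> (X \<omega>) (Y \<omega>)) \<in> borel_measurable N"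
  unfolding log_ratio_def by measurable

lemma measurable_acceptance [measurable (raw)]:
  assumes [measurable]: "X \<in> borel_measurable N" "Y \<in> borel_measurable N"
  shows "(\<lambda>\<omega>. acceptance \<eta> (X \<omega>) (Y \<omega>)) \<in> borel_measurable N"
  unfolding acceptance_def by measurable

lemma measurable_mala [measurable (raw)]:
  assumes [measurable]: "X \<in> borel_measurable N" and S: "S \<in> borel_measurable N"
  shows "(\<lambda>\<omega>. mala \<eta> (X \<omega>) (S \<omega>)) \<in> borel_measurable N"
proof -
  have "S \<in> N \<rightarrow>\<^sub>M borel \<Otimes>\<^sub>M borel"
    using S by (simp add: borel_prod)
  then have [measurable]: "(\<lambda>\<omega>. fst (S \<omega>)) \<in> borel_measurable N" "(\<lambda>\<omega>. snd (S \<omega>)) \<in> borel_measurable N"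
    by measurable
  show ?thesis unfolding mala_def by measurable
qed

text \<open>\<open>H\<close> also receives the Gaussian increment, so that the formula serves both
  the invariance of the Gibbs measure and the comparison with the Euler step.\<close>

lemma nn_integral_mala:
  assumes [measurable]: "(\<lambda>(y, z). H y z) \<in> borel_measurable (borel \<Otimes>\<^sub>M borel)"
  shows "(\<integral>\<^sup>+s. H (mala \<eta> x s) (fst s) \<partial>noise) = (\<integral>\<^sup>+z. ennreal (acceptance \<eta> x (proposal \<eta> x z)) * H (proposal \<eta> x z) z
    + ennreal (1 - acceptance \<eta> x (proposal \<eta> x z)) * H x z \<partial>std_gaussian)"
proof -
  have [measurable]: "(\<lambda>s. H (mala \<eta> x s) (fst s)) \<in> borel_measurable borel"
  proof -
    have [measurable]: "fst \<in> borel_measurable (borel :: ('a \<times> real) measure)"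
      unfolding borel_prod[symmetric] by measurable
    show ?thesis by measurable
  qed
  show ?thesis
    by (subst nn_integral_noise, measurable)
      (simp add: mala_def if_distrib[of "\<lambda>y. H y _"] nn_integral_unif01_threshold acceptance_def cong: if_cong)
qed

text \<open>The joint density of a Gibbs-distributed state and its proposal, up to a constant
  factor.\<close>

definition joint_density :: "real \<Rightarrow> 'a \<Rightarrow> 'a \<Rightarrow> real" where
  "joint_density \<eta> x y = exp (- f x) * gaussian_density ((1 / sqrt (2 * \<eta>)) *\<^sub>R (y - x + \<eta> *\<^sub>R g x))"

lemma measurable_joint_density [measurable (raw)]:
  assumes [measurable]: "X \<in> borel_measurable N" "Y \<in> borel_measurable N"
  shows "(\<lambda>\<omega>. joint_density \<eta> (X \<omega>) (Y \<omega>)) \<in> borel_measurable N"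
  unfolding joint_density_def by measurable

lemma joint_density_nonneg: "0 \<le> joint_density \<eta> x y"
  by (simp add: joint_density_def less_imp_le[OF gaussian_density_pos])

lemma joint_density_swap:
  assumes \<eta>: "0 < \<eta>"
  shows "joint_density \<eta> y x = joint_density \<eta> x y * exp (log_ratio \<eta> x y)"
proof -
  define d where "d = y - x"
  have dx: "x - y + \<eta> *\<^sub>R g y = \<eta> *\<^sub>R g y - d" by (simp add: d_def)
  have n: "(norm ((1 / sqrt (2 * \<eta>)) *\<^sub>R v))\<^sup>2 = (norm v)\<^sup>2 / (2 * \<eta>)" for v :: 'a
    using \<eta> by (simp add: power_divide)
  have "- f y - (norm (\<eta> *\<^sub>R g y - d))\<^sup>2 / (2 * \<eta>) / 2
      = - f x - (norm (d + \<eta> *\<^sub>R g x))\<^sup>2 / (2 * \<eta>) / 2 + log_ratio \<eta> x y"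
    unfolding log_ratio_def d_def[symmetric] norm_add_sq norm_diff_sq using \<eta>
    by (simp add: inner_add_left inner_add_right inner_commute power_mult_distrib power2_eq_square field_simps)
  then have e: "exp (- f y) * exp (- ((norm (\<eta> *\<^sub>R g y - d))\<^sup>2 / (2 * \<eta>)) / 2)
      = exp (- f x) * exp (- ((norm (d + \<eta> *\<^sub>R g x))\<^sup>2 / (2 * \<eta>)) / 2) * exp (log_ratio \<eta> x y)"
    unfolding exp_add[symmetric] by simp
  show ?thesis
    unfolding joint_density_def gaussian_density_def dx d_def[symmetric] n using e by simp
qed

text \<open>This is detailed balance: the right-hand side is symmetric in \<open>x\<close> and
  \<open>y\<close>.\<close>

lemma joint_density_acceptance:
  "0 < \<eta> \<Longrightarrow> joint_density \<eta> x y * acceptance \<eta> x y = min (joint_density \<eta> x y) (joint_density \<eta> y x)"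
  unfolding acceptance_def joint_density_swap[of \<eta> y x]
  by (simp add: min_mult_distrib_left joint_density_nonneg)

lemma nn_integral_proposal:
  assumes \<eta>: "0 < \<eta>" and [measurable]: "H \<in> borel_measurable borel"
  shows "(\<integral>\<^sup>+z. H (proposal \<eta> x z) \<partial>std_gaussian)
    = ennreal ((1 / sqrt (2 * \<eta>)) ^ DIM('a)) *
      (\<integral>\<^sup>+y. ennreal (gaussian_density ((1 / sqrt (2 * \<eta>)) *\<^sub>R (y - x + \<eta> *\<^sub>R g x))) * H y \<partial>lborel)"
proof -
  let ?c = "1 / sqrt (2 * \<eta>)"
  have [measurable]: "proposal \<eta> x \<in> borel_measurable borel"
    unfolding proposal_def by measurable
  have c: "0 < ?c" using \<eta> by simp
  have "proposal \<eta> x (?c *\<^sub>R (y - x + \<eta> *\<^sub>R g x)) = y" for y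
    using \<eta> by (simp add: proposal_def)
  moreover have "- (?c *\<^sub>R (x - \<eta> *\<^sub>R g x)) + ?c *\<^sub>R y = ?c *\<^sub>R (y - x + \<eta> *\<^sub>R g x)" for y
    by (simp add: algebra_simps)
  ultimately show ?thesis
    using c by (subst nn_integral_std_gaussian, simp,
        subst nn_integral_lborel_affine[where c = ?c and t = "- (?c *\<^sub>R (x - \<eta> *\<^sub>R g x))"]) simp_all
qed

text \<open>By symmetry of the accepted flow, integrating \<open>F\<close> over the end points of
  accepted moves equals integrating it over their starting points; together with the rejected moves
  these make up all of \<pi>. The auxiliary \<open>half\<close> rewrites the accepted part with the
  symmetric density, for a test function of both points.\<close>

lemma nn_integral_gibbs_mala:
  assumes \<eta>: "0 < \<eta>" and [measurable]: "F \<in> borel_measurable borel"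
  shows "(\<integral>\<^sup>+x. \<integral>\<^sup>+s. F (mala \<eta> x s) \<partial>noise \<partial>gibbs f) = (\<integral>\<^sup>+x. F x \<partial>gibbs f)"
proof -
  obtain c where c: "0 < c" "gibbs f = density lborel (\<lambda>x. ennreal (c * exp (- f x)))"
    using gibbs_normalization by blast
  let ?k = "ennreal ((1 / sqrt (2 * \<eta>)) ^ DIM('a))"
  let ?\<rho> = "joint_density \<eta>" and ?q = "\<lambda>x z. acceptance \<eta> x (proposal \<eta> x z)"
  interpret G: prob_space "std_gaussian :: 'a measure" by (rule prob_space_std_gaussian)
  interpret sg: sigma_finite_measure "std_gaussian :: 'a measure" ..
  have half: "(\<integral>\<^sup>+x. \<integral>\<^sup>+z. ennreal (?q x z) * H x (proposal \<eta> x z) \<partial>std_gaussian \<partial>gibbs f)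
      = ennreal c * ?k * (\<integral>\<^sup>+x. \<integral>\<^sup>+y. ennreal (min (?\<rho> x y) (?\<rho> y x)) * H x y \<partial>lborel \<partial>lborel)"
    if [measurable]: "(\<lambda>(x, y). H x y) \<in> borel_measurable (borel \<Otimes>\<^sub>M borel)" for H :: "'a \<Rightarrow> 'a \<Rightarrow> ennreal"
  proof -
    have "ennreal (c * exp (- f x)) * (\<integral>\<^sup>+z. ennreal (?q x z) * H x (proposal \<eta> x z) \<partial>std_gaussian)
        = ennreal c * ?k * (\<integral>\<^sup>+y. ennreal (min (?\<rho> x y) (?\<rho> y x)) * H x y \<partial>lborel)" for x
    proof -
      have "ennreal (c * exp (- f x)) * (\<integral>\<^sup>+z. ennreal (?q x z) * H x (proposal \<eta> x z) \<partial>std_gaussian)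
          = ennreal c * ?k * (ennreal (exp (- f x)) *
            (\<integral>\<^sup>+y. ennreal (gaussian_density ((1 / sqrt (2 * \<eta>)) *\<^sub>R (y - x + \<eta> *\<^sub>R g x))) *
              (ennreal (acceptance \<eta> x y) * H x y) \<partial>lborel))"
        using c by (subst nn_integral_proposal[OF \<eta>, where H = "\<lambda>y. ennreal (acceptance \<eta> x y) * H x y"], measurable)
          (simp add: ennreal_mult mult_ac)
      also have "\<dots> = ennreal c * ?k * (\<integral>\<^sup>+y. ennreal (?\<rho> x y * acceptance \<eta> x y) * H x y \<partial>lborel)"
        by (subst nn_integral_cmult[symmetric], measurable)
          (simp add: joint_density_def ennreal_mult acceptance_range less_imp_le[OF gaussian_density_pos] mult_ac)
      finally show ?thesis
        unfolding joint_density_acceptance[OF \<eta>] .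
    qed
    then show ?thesis
      unfolding c(2) by (subst nn_integral_density, measurable) (simp add: nn_integral_cmult)
  qed
  have "(\<integral>\<^sup>+x. \<integral>\<^sup>+s. F (mala \<eta> x s) \<partial>noise \<partial>gibbs f)
      = (\<integral>\<^sup>+x. \<integral>\<^sup>+z. ennreal (?q x z) * F (proposal \<eta> x z) + ennreal (1 - ?q x z) * F x \<partial>std_gaussian \<partial>gibbs f)"
    by (subst nn_integral_mala[where H = "\<lambda>y z. F y"]) auto
  also have "\<dots> = (\<integral>\<^sup>+x. \<integral>\<^sup>+z. ennreal (?q x z) * F (proposal \<eta> x z) \<partial>std_gaussian \<partial>gibbs f)
      + (\<integral>\<^sup>+x. \<integral>\<^sup>+z. ennreal (1 - ?q x z) * F x \<partial>std_gaussian \<partial>gibbs f)"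
    by (subst nn_integral_add[symmetric], measurable) (subst nn_integral_add[symmetric], measurable)
  also have "(\<integral>\<^sup>+x. \<integral>\<^sup>+z. ennreal (?q x z) * F (proposal \<eta> x z) \<partial>std_gaussian \<partial>gibbs f)
      = ennreal c * ?k * (\<integral>\<^sup>+x. \<integral>\<^sup>+y. ennreal (min (?\<rho> x y) (?\<rho> y x)) * F y \<partial>lborel \<partial>lborel)"
    by (rule half) measurable
  also have "(\<integral>\<^sup>+x. \<integral>\<^sup>+y. ennreal (min (?\<rho> x y) (?\<rho> y x)) * F y \<partial>lborel \<partial>lborel)
      = (\<integral>\<^sup>+y. \<integral>\<^sup>+x. ennreal (min (?\<rho> x y) (?\<rho> y x)) * F y \<partial>lborel \<partial>lborel)"
    by (rule lborel_pair.Fubini') measurable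
  also have "\<dots> = (\<integral>\<^sup>+x. \<integral>\<^sup>+y. ennreal (min (?\<rho> x y) (?\<rho> y x)) * F x \<partial>lborel \<partial>lborel)"
    by (simp add: min.commute)
  also have "ennreal c * ?k * \<dots> = (\<integral>\<^sup>+x. \<integral>\<^sup>+z. ennreal (?q x z) * F x \<partial>std_gaussian \<partial>gibbs f)"
    by (rule half[symmetric]) measurable
  also have "\<dots> + (\<integral>\<^sup>+x. \<integral>\<^sup>+z. ennreal (1 - ?q x z) * F x \<partial>std_gaussian \<partial>gibbs f)
      = (\<integral>\<^sup>+x. \<integral>\<^sup>+z. ennreal (?q x z) * F x + ennreal (1 - ?q x z) * F x \<partial>std_gaussian \<partial>gibbs f)"
    by (subst nn_integral_add[symmetric], measurable) (subst nn_integral_add[symmetric], measurable)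
  also have "\<dots> = (\<integral>\<^sup>+x. F x \<partial>gibbs f)"
    using G.emeasure_space_1
    by (simp add: distrib_right[symmetric] ennreal_plus[symmetric] acceptance_range del: ennreal_plus)
  finally show ?thesis .
qed

end

lemma distr_std_gaussian_uminus: "distr std_gaussian borel uminus = (std_gaussian :: 'a::euclidean_space measure)"
proof (rule measure_eqI)
  fix A assume "A \<in> sets (distr std_gaussian borel (uminus :: 'a \<Rightarrow> 'a))"
  then have [measurable]: "A \<in> sets borel" by simp
  have "emeasure (distr std_gaussian borel uminus) A = (\<integral>\<^sup>+x. indicator A (- x) \<partial>std_gaussian)"
    using nn_integral_distr[of uminus std_gaussian borel "indicator A"] by simp
  also have "\<dots> = (\<integral>\<^sup>+x. ennreal (gaussian_density x) * indicator A (- x) \<partial>lborel)"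
    by (subst nn_integral_std_gaussian) auto
  also have "\<dots> = (\<integral>\<^sup>+x. ennreal (gaussian_density x) * indicator A x \<partial>lborel)"
    by (subst nn_integral_lborel_affine[where c = "-1" and t = 0]) (auto simp: gaussian_density_def)
  also have "\<dots> = emeasure std_gaussian A"
    by (simp add: std_gaussian_eq emeasure_density)
  finally show "emeasure (distr std_gaussian borel uminus) A = emeasure std_gaussian A" .
qed simp

lemma integral_std_gaussian_inner: "(\<integral>z. v \<bullet> z \<partial>std_gaussian) = (0::real)"
proof -
  have "(\<integral>z. v \<bullet> z \<partial>std_gaussian) = (\<integral>z. v \<bullet> z \<partial>distr std_gaussian borel uminus)"
    by (simp add: distr_std_gaussian_uminus)
  also have "\<dots> = - (\<integral>z. v \<bullet> z \<partial>std_gaussian)"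
    by (subst integral_distr) auto
  finally show ?thesis by simp
qed

lemma power4_add_le: "(a + b) ^ 4 \<le> 8 * (a ^ 4 + b ^ 4)" if "0 \<le> a" "0 \<le> (b::real)"
proof -
  have "(a + b)\<^sup>2 \<le> 2 * (a\<^sup>2 + b\<^sup>2)"
    using zero_le_power2[of "a - b"] by (simp add: power2_eq_square algebra_simps)
  then have "((a + b)\<^sup>2)\<^sup>2 \<le> (2 * (a\<^sup>2 + b\<^sup>2))\<^sup>2"
    by (rule power_mono) simp
  also have "\<dots> \<le> 8 * (a ^ 4 + b ^ 4)"
    using zero_le_power2[of "a\<^sup>2 - b\<^sup>2"] by (simp add: power2_eq_square power4_eq_xxxx algebra_simps)
  finally show ?thesis by (simp flip: power_mult)
qed

section \<open>Size of the error caused by rejections\<close>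

context potential
begin

lemma norm_gradient_le: "norm (g x) \<le> norm (g 0) + M * norm x"
  using gradient_lipschitz[of x 0] norm_triangle_sub[of "g x" "g 0"] by simp

lemma nn_integral_gibbs_norm_gradient_power4: "(\<integral>\<^sup>+x. ennreal (norm (g x) ^ 4) \<partial>gibbs f) < \<infinity>"
proof -
  interpret prob_space "gibbs f" by (rule prob_space_gibbs)
  have "norm (g x) ^ 4 \<le> 8 * norm (g 0) ^ 4 + 8 * M ^ 4 * norm x ^ 4" for x
  proof -
    have "norm (g x) ^ 4 \<le> (norm (g 0) + M * norm x) ^ 4"
      using norm_gradient_le by (intro power_mono) auto
    also have "\<dots> \<le> 8 * (norm (g 0) ^ 4 + (M * norm x) ^ 4)"
      using M_pos by (intro power4_add_le) auto
    finally show ?thesis by (simp add: power_mult_distrib)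
  qed
  then have "(\<integral>\<^sup>+x. ennreal (norm (g x) ^ 4) \<partial>gibbs f)
      \<le> (\<integral>\<^sup>+x. ennreal (8 * norm (g 0) ^ 4) + ennreal (8 * M ^ 4) * ennreal (norm x ^ 4) \<partial>gibbs f)"
    using M_pos by (intro nn_integral_mono) (simp add: ennreal_mult'[symmetric] ennreal_plus[symmetric] del: ennreal_plus)
  also have "\<dots> < \<infinity>"
    using nn_integral_gibbs_norm_power4 emeasure_space_1
    by (simp add: nn_integral_add nn_integral_cmult ennreal_mult_less_top)
  finally show ?thesis .
qed

lemma log_ratio_bound:
  "\<bar>log_ratio \<eta> x (x + d)\<bar> \<le> \<bar>f (x + d) - f x - (g x + g (x + d)) \<bullet> d / 2\<bar>
    + \<bar>\<eta>\<bar> / 4 * (M * norm d * (2 * norm (g x) + M * norm d))"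
proof -
  have "\<bar>(norm (g (x + d)))\<^sup>2 - (norm (g x))\<^sup>2\<bar> = \<bar>(g (x + d) - g x) \<bullet> (g (x + d) + g x)\<bar>"
    by (simp add: power2_norm_eq_inner inner_diff_left inner_diff_right inner_add_right inner_commute)
  also have "\<dots> \<le> norm (g (x + d) - g x) * norm (g (x + d) + g x)"
    by (rule Cauchy_Schwarz_ineq2)
  also have "\<dots> \<le> (M * norm d) * (2 * norm (g x) + M * norm d)"
  proof (intro mult_mono)
    show 1: "norm (g (x + d) - g x) \<le> M * norm d"
      using gradient_lipschitz[of "x + d" x] by simp
    have "norm (g (x + d) + g x) = norm (2 *\<^sub>R g x + (g (x + d) - g x))" by (simp add: scaleR_2 add.commute)
    then show "norm (g (x + d) + g x) \<le> 2 * norm (g x) + M * norm d"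
      using norm_triangle_ineq[of "2 *\<^sub>R g x" "g (x + d) - g x"] 1 by simp
  qed (use M_pos in auto)
  finally have "\<bar>\<eta> / 4 * ((norm (g (x + d)))\<^sup>2 - (norm (g x))\<^sup>2)\<bar> \<le> \<bar>\<eta>\<bar> / 4 * (M * norm d * (2 * norm (g x) + M * norm d))"
    unfolding abs_mult by (intro mult_mono) auto
  then show ?thesis
    unfolding log_ratio_def by simp
qed

text \<open>The error is half the difference of the two Bregman divergences of \<open>f\<close>
  between \<open>x\<close> and \<open>x + d\<close>, both in \<open>[0, M / 2 * |d|^2]\<close>. This
  uniform bound complements the pointwise \<open>trapezoid_limit\<close> and supplies the
  domination.\<close>

lemma trapezoid_bound:
  "\<bar>f (x + d) - f x - (g x + g (x + d)) \<bullet> d / 2\<bar> \<le> M / 2 * (norm d)\<^sup>2"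
proof -
  have "0 \<le> m / 2 * (norm d)\<^sup>2" using m_pos by simp
  then have "0 \<le> f (x + d) - f x - g x \<bullet> d" "f (x + d) - f x - g x \<bullet> d \<le> M / 2 * (norm d)\<^sup>2"
    "0 \<le> f x - f (x + d) + g (x + d) \<bullet> d" "f x - f (x + d) + g (x + d) \<bullet> d \<le> M / 2 * (norm d)\<^sup>2"
    using lower[of x "x + d"] upper[of "x + d" x] lower[of "x + d" x] upper[of x "x + d"] by auto
  moreover have "f (x + d) - f x - (g x + g (x + d)) \<bullet> d / 2
      = ((f (x + d) - f x - g x \<bullet> d) - (f x - f (x + d) + g (x + d) \<bullet> d)) / 2"
    by (simp add: inner_add_left field_simps)
  moreover have "0 \<le> a \<Longrightarrow> a \<le> q \<Longrightarrow> 0 \<le> b \<Longrightarrow> b \<le> q \<Longrightarrow> \<bar>(a - b) / 2\<bar> \<le> q" for a b q :: real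
    by (simp add: abs_le_iff field_simps)
  ultimately show ?thesis by metis
qed

lemma proposal_step_bound:
  assumes "0 < \<eta>" "\<eta> \<le> h"
  shows "(norm (proposal \<eta> x z - x))\<^sup>2 \<le> (2 * h + 4) * \<eta> * ((norm (g x))\<^sup>2 + (norm z)\<^sup>2)"
proof -
  have "(norm (proposal \<eta> x z - x))\<^sup>2 \<le> (\<eta> * norm (g x) + sqrt (2 * \<eta>) * norm z)\<^sup>2"
    using assms norm_triangle_ineq[of "- \<eta> *\<^sub>R g x" "sqrt (2 * \<eta>) *\<^sub>R z"]
    by (intro power_mono) (auto simp: proposal_def algebra_simps)
  also have "\<dots> \<le> 2 * ((\<eta> * norm (g x))\<^sup>2 + (sqrt (2 * \<eta>) * norm z)\<^sup>2)"
    using zero_le_power2[of "\<eta> * norm (g x) - sqrt (2 * \<eta>) * norm z"]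
    unfolding power2_diff power2_sum by simp
  also have "\<dots> = 2 * \<eta> * \<eta> * (norm (g x))\<^sup>2 + 4 * \<eta> * (norm z)\<^sup>2"
    using assms by (simp add: power_mult_distrib power2_eq_square)
  also have "\<dots> \<le> (2 * h + 4) * \<eta> * (norm (g x))\<^sup>2 + (2 * h + 4) * \<eta> * (norm z)\<^sup>2"
    using assms by (intro add_mono mult_right_mono) (auto simp: algebra_simps)
  finally show ?thesis by (simp add: algebra_simps)
qed

text \<open>A rejection has probability at most \<open>|log_ratio|\<close> and costs the squared
  length of the proposed step. The division by \<open>\<eta>^2\<close> turns the required order
  o(\<eta>^2) into convergence to 0.\<close>

definition rejection_rate :: "real \<Rightarrow> 'a \<times> 'a \<Rightarrow> real" where
  "rejection_rate \<eta> = (\<lambda>(x, z). \<bar>log_ratio \<eta> x (proposal \<eta> x z)\<bar> * (norm (proposal \<eta> x z - x))\<^sup>2 / \<eta>\<^sup>2)"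

text \<open>With \<open>q = |g x|^2 + |z|^2\<close>, both the log ratio and the squared step are at
  most a constant times \<open>\<eta> q\<close>, so the quotient is bounded by a multiple of
  \<open>q^2\<close> that does not depend on \<eta>.\<close>

lemma rejection_rate_dominated:
  assumes "0 < \<eta>" "\<eta> \<le> h"
  defines "c \<equiv> 2 * h + 4"
  shows "rejection_rate \<eta> (x, z)
    \<le> (M / 2 * c + M / 4 * ((1 + M) * c * h + 1)) * c * ((norm (g x))\<^sup>2 + (norm z)\<^sup>2)\<^sup>2"
proof -
  define d where "d = proposal \<eta> x z - x"
  define q where "q = (norm (g x))\<^sup>2 + (norm z)\<^sup>2"
  define K where "K = M / 2 * c + M / 4 * ((1 + M) * c * h + 1)"
  have pos: "0 \<le> q" "0 \<le> c" "0 < M" "0 \<le> h" using assms M_pos by (auto simp: q_def c_def)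
  have d: "(norm d)\<^sup>2 \<le> c * \<eta> * q"
    using proposal_step_bound[OF assms(1,2)] by (simp add: d_def c_def q_def)
  have y: "proposal \<eta> x z = x + d" by (simp add: d_def)
  have "norm d * (2 * norm (g x) + M * norm d) \<le> (1 + M) * (norm d)\<^sup>2 + (norm (g x))\<^sup>2"
    using zero_le_power2[of "norm d - norm (g x)"] by (simp add: power2_eq_square algebra_simps)
  also have "\<dots> \<le> (1 + M) * (c * \<eta> * q) + q"
    using d pos by (intro add_mono mult_left_mono) (auto simp: q_def)
  also have "\<dots> \<le> (1 + M) * (c * h * q) + q"
    using assms pos by (intro add_mono mult_left_mono mult_right_mono) auto
  finally have "\<eta> / 4 * (M * (norm d * (2 * norm (g x) + M * norm d))) \<le> \<eta> / 4 * (M * ((1 + M) * (c * h * q) + q))"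
    using assms pos by (intro mult_left_mono) auto
  moreover have "M / 2 * (norm d)\<^sup>2 \<le> M / 2 * (c * \<eta> * q)"
    using d pos by (intro mult_left_mono) auto
  ultimately have "\<bar>log_ratio \<eta> x (x + d)\<bar> \<le> K * \<eta> * q"
    using log_ratio_bound[of \<eta> x d] trapezoid_bound[of x d] assms
    by (simp add: K_def algebra_simps)
  moreover have "0 \<le> K" using pos by (simp add: K_def)
  ultimately have "\<bar>log_ratio \<eta> x (x + d)\<bar> * (norm d)\<^sup>2 \<le> (K * \<eta> * q) * (c * \<eta> * q)"
    using d pos assms by (intro mult_mono) auto
  then have "\<bar>log_ratio \<eta> x (x + d)\<bar> * (norm d)\<^sup>2 / \<eta>\<^sup>2 \<le> (K * \<eta> * q) * (c * \<eta> * q) / \<eta>\<^sup>2"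
    by (rule divide_right_mono) simp
  also have "\<dots> = K * c * q\<^sup>2"
    using assms by (simp add: power2_eq_square)
  finally show ?thesis
    unfolding rejection_rate_def case_prod_conv y K_def q_def by simp
qed

lemma rejection_rate_tendsto:
  assumes \<eta>: "\<And>n. 0 < \<eta> n" "\<And>n. \<eta> n \<le> h" "\<eta> \<longlonglongrightarrow> 0"
  shows "(\<lambda>n. rejection_rate (\<eta> n) (x, z)) \<longlonglongrightarrow> 0"
proof -
  define c q where "c = 2 * h + 4" and "q = (norm (g x))\<^sup>2 + (norm z)\<^sup>2"
  have pos: "0 \<le> q" "0 \<le> c" using \<eta>(1,2)[of 0] by (auto simp: q_def c_def)
  define d where "d n = proposal (\<eta> n) x z - x" for n
  define \<tau> where "\<tau> v = (f (x + v) - f x - (g x + g (x + v)) \<bullet> v / 2) / (norm v)\<^sup>2" for v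
  have T: "f (x + v) - f x - (g x + g (x + v)) \<bullet> v / 2 = \<tau> v * (norm v)\<^sup>2" for v
    by (cases "v = 0") (auto simp: \<tau>_def)
  have d0: "d \<longlonglongrightarrow> 0"
    unfolding d_def proposal_def using \<eta>(3)
    by (auto intro!: tendsto_eq_intros simp: algebra_simps)
  \<comment> \<open>Division by zero yields 0, so \<open>trapezoid_limit\<close> becomes continuity
    of \<open>\<tau>\<close> at 0, and proposals with \<open>d n = 0\<close> need no separate
    treatment.\<close>
  have "\<tau> 0 = 0" by (simp add: \<tau>_def)
  then have "isCont \<tau> 0"
    using trapezoid_limit[of x] unfolding isCont_def \<tau>_def by simp
  then have \<tau>: "(\<lambda>n. \<tau> (d n)) \<longlonglongrightarrow> 0"
    using isCont_tendsto_compose[OF _ d0, of \<tau>] \<open>\<tau> 0 = 0\<close> by simp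
  have d: "(norm (d n))\<^sup>2 \<le> c * \<eta> n * q" for n
    using proposal_step_bound[OF \<eta>(1,2)] by (simp add: d_def c_def q_def)
  define B where "B n = (\<bar>\<tau> (d n)\<bar> * (c * q) + 1 / 4 * (M * norm (d n) * (2 * norm (g x) + M * norm (d n)))) * (c * q)" for n
  have "B \<longlonglongrightarrow> (\<bar>0\<bar> * (c * q) + 1 / 4 * (M * norm (0::'a) * (2 * norm (g x) + M * norm (0::'a)))) * (c * q)"
    unfolding B_def by (intro tendsto_intros \<tau> d0)
  then have B: "B \<longlonglongrightarrow> 0" by simp
  have "rejection_rate (\<eta> n) (x, z) \<le> B n" for n
  proof -
    have y: "proposal (\<eta> n) x z = x + d n" by (simp add: d_def)
    have "\<bar>log_ratio (\<eta> n) x (x + d n)\<bar> \<le> \<bar>\<tau> (d n)\<bar> * (c * \<eta> n * q) + \<eta> n / 4 * (M * norm (d n) * (2 * norm (g x) + M * norm (d n)))"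
    proof -
      have "\<bar>\<tau> (d n) * (norm (d n))\<^sup>2\<bar> \<le> \<bar>\<tau> (d n)\<bar> * (c * \<eta> n * q)"
        unfolding abs_mult using d[of n] by (intro mult_mono) auto
      then show ?thesis
        using log_ratio_bound[of "\<eta> n" x "d n"] \<eta>(1)[of n] unfolding T by simp
    qed
    also have "\<dots> = \<eta> n * (\<bar>\<tau> (d n)\<bar> * (c * q) + 1 / 4 * (M * norm (d n) * (2 * norm (g x) + M * norm (d n))))"
      by (simp add: algebra_simps)
    finally have "\<bar>log_ratio (\<eta> n) x (x + d n)\<bar> * (norm (d n))\<^sup>2
        \<le> (\<eta> n * (\<bar>\<tau> (d n)\<bar> * (c * q) + 1 / 4 * (M * norm (d n) * (2 * norm (g x) + M * norm (d n))))) * (c * \<eta> n * q)"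
      using d[of n] \<eta>(1)[of n] pos M_pos by (intro mult_mono) auto
    then have "\<bar>log_ratio (\<eta> n) x (x + d n)\<bar> * (norm (d n))\<^sup>2 / (\<eta> n)\<^sup>2
        \<le> (\<eta> n * (\<bar>\<tau> (d n)\<bar> * (c * q) + 1 / 4 * (M * norm (d n) * (2 * norm (g x) + M * norm (d n))))) * (c * \<eta> n * q) / (\<eta> n)\<^sup>2"
      by (rule divide_right_mono) simp
    also have "\<dots> = B n"
      using \<eta>(1)[of n] by (simp add: B_def power2_eq_square)
    finally show ?thesis
      unfolding rejection_rate_def case_prod_conv y by simp
  qed
  moreover have "0 \<le> rejection_rate (\<eta> n) (x, z)" for n
    by (simp add: rejection_rate_def)
  ultimately show ?thesis
    by (intro tendsto_sandwich[OF _ _ tendsto_const B]) (auto intro: always_eventually)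
qed

lemma measurable_rejection_rate [measurable]:
  "rejection_rate \<eta> \<in> borel_measurable (borel \<Otimes>\<^sub>M borel)"
  unfolding rejection_rate_def by measurable

lemma mala_error_le:
  assumes \<eta>: "0 < \<eta>"
  shows "(\<integral>\<^sup>+x. \<integral>\<^sup>+s. ennreal ((norm (mala \<eta> x s - proposal \<eta> x (fst s)))\<^sup>2) \<partial>noise \<partial>gibbs f)
    \<le> ennreal (\<eta>\<^sup>2) * (\<integral>\<^sup>+w. ennreal (rejection_rate \<eta> w) \<partial>(gibbs f \<Otimes>\<^sub>M std_gaussian))"
proof -
  interpret G: prob_space "std_gaussian :: 'a measure" by (rule prob_space_std_gaussian)
  have rej: "1 - acceptance \<eta> x y \<le> \<bar>log_ratio \<eta> x y\<bar>" for x y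
  proof -
    have "1 + log_ratio \<eta> x y \<le> exp (log_ratio \<eta> x y)" by (rule exp_ge_add_one_self)
    then have "1 - exp (log_ratio \<eta> x y) \<le> - log_ratio \<eta> x y" by linarith
    then show ?thesis by (auto simp: acceptance_def min_def abs_if)
  qed
  have "(\<integral>\<^sup>+x. \<integral>\<^sup>+s. ennreal ((norm (mala \<eta> x s - proposal \<eta> x (fst s)))\<^sup>2) \<partial>noise \<partial>gibbs f)
      = (\<integral>\<^sup>+x. \<integral>\<^sup>+z. ennreal (1 - acceptance \<eta> x (proposal \<eta> x z)) * ennreal ((norm (x - proposal \<eta> x z))\<^sup>2) \<partial>std_gaussian \<partial>gibbs f)"
  proof (rule nn_integral_cong)
    fix x
    show "(\<integral>\<^sup>+s. ennreal ((norm (mala \<eta> x s - proposal \<eta> x (fst s)))\<^sup>2) \<partial>noise)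
      = (\<integral>\<^sup>+z. ennreal (1 - acceptance \<eta> x (proposal \<eta> x z)) * ennreal ((norm (x - proposal \<eta> x z))\<^sup>2) \<partial>std_gaussian)"
      by (subst nn_integral_mala[where H = "\<lambda>y z. ennreal ((norm (y - proposal \<eta> x z))\<^sup>2)"]) simp_all
  qed
  also have "\<dots> \<le> (\<integral>\<^sup>+x. \<integral>\<^sup>+z. ennreal (\<eta>\<^sup>2) * ennreal (rejection_rate \<eta> (x, z)) \<partial>std_gaussian \<partial>gibbs f)"
  proof (intro nn_integral_mono)
    fix x z :: 'a
    have "(1 - acceptance \<eta> x (proposal \<eta> x z)) * (norm (x - proposal \<eta> x z))\<^sup>2
        \<le> \<bar>log_ratio \<eta> x (proposal \<eta> x z)\<bar> * (norm (proposal \<eta> x z - x))\<^sup>2"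
      using rej by (intro mult_mono) (auto simp: norm_minus_commute)
    also have "\<dots> = \<eta>\<^sup>2 * rejection_rate \<eta> (x, z)"
      using \<eta> by (simp add: rejection_rate_def)
    finally show "ennreal (1 - acceptance \<eta> x (proposal \<eta> x z)) * ennreal ((norm (x - proposal \<eta> x z))\<^sup>2)
        \<le> ennreal (\<eta>\<^sup>2) * ennreal (rejection_rate \<eta> (x, z))"
      by (simp add: ennreal_mult'[symmetric] acceptance_range ennreal_leI)
  qed
  also have "\<dots> = (\<integral>\<^sup>+w. ennreal (\<eta>\<^sup>2) * ennreal (rejection_rate \<eta> w) \<partial>(gibbs f \<Otimes>\<^sub>M std_gaussian))"
    by (subst G.nn_integral_fst[symmetric]) auto
  also have "\<dots> = ennreal (\<eta>\<^sup>2) * (\<integral>\<^sup>+w. ennreal (rejection_rate \<eta> w) \<partial>(gibbs f \<Otimes>\<^sub>M std_gaussian))"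
    by (rule nn_integral_cmult) measurable
  finally show ?thesis .
qed

text \<open>Dominated convergence over state and increment. The form
  \<open>(\<eta> n * \<epsilon> n)^2\<close> is chosen so that \<open>h / \<eta> n\<close> such
  errors add up to \<open>h * \<epsilon> n\<close> in \<open>L^2\<close>, which tends to 0.\<close>

lemma mala_error_rate:
  assumes \<eta>: "\<And>n. 0 < \<eta> n" "\<And>n. \<eta> n \<le> h" "\<eta> \<longlonglongrightarrow> 0"
  obtains \<epsilon> :: "nat \<Rightarrow> real" where "\<And>n. 0 \<le> \<epsilon> n" "\<epsilon> \<longlonglongrightarrow> 0"
    "\<And>n. (\<integral>\<^sup>+x. \<integral>\<^sup>+s. ennreal ((norm (mala (\<eta> n) x s - proposal (\<eta> n) x (fst s)))\<^sup>2) \<partial>noise \<partial>gibbs f)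
      \<le> ennreal ((\<eta> n * \<epsilon> n)\<^sup>2)"
proof -
  let ?P = "gibbs f \<Otimes>\<^sub>M (std_gaussian :: 'a measure)"
  interpret G: prob_space "std_gaussian :: 'a measure" by (rule prob_space_std_gaussian)
  interpret \<pi>: prob_space "gibbs f" by (rule prob_space_gibbs)
  define c where "c = 2 * h + 4"
  define K where "K = (M / 2 * c + M / 4 * ((1 + M) * c * h + 1)) * c"
  have K: "0 \<le> K" using \<eta>(1,2)[of 0] M_pos by (simp add: K_def c_def)
  define w where "w = (\<lambda>(x, z). ennreal (K * ((norm (g x))\<^sup>2 + (norm (z::'a))\<^sup>2)\<^sup>2))"
  have [measurable]: "w \<in> borel_measurable (borel \<Otimes>\<^sub>M borel)" unfolding w_def by measurable
  define I where "I n = (\<integral>\<^sup>+p. ennreal (rejection_rate (\<eta> n) p) \<partial>?P)" for n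
  have dom: "ennreal (rejection_rate (\<eta> n) p) \<le> w p" for n p
    using rejection_rate_dominated[OF \<eta>(1,2), of n "fst p" "snd p"]
    by (cases p) (auto simp: w_def K_def c_def intro!: ennreal_leI)
  have "(\<integral>\<^sup>+p. w p \<partial>?P) \<le> (\<integral>\<^sup>+p. ennreal (2 * K) * ennreal (norm (g (fst p)) ^ 4) + ennreal (2 * K) * ennreal (norm (snd p) ^ 4) \<partial>?P)"
  proof (rule nn_integral_mono)
    fix p :: "'a \<times> 'a"
    obtain x z where p: "p = (x, z)" by (cases p)
    have "K * ((norm (g x))\<^sup>2 + (norm z)\<^sup>2)\<^sup>2 \<le> K * (2 * (norm (g x)) ^ 4 + 2 * norm z ^ 4)"
      using zero_le_power2[of "(norm (g x))\<^sup>2 - (norm z)\<^sup>2"] K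
      by (intro mult_left_mono) (simp_all add: power2_eq_square power4_eq_xxxx algebra_simps)
    then show "w p \<le> ennreal (2 * K) * ennreal (norm (g (fst p)) ^ 4) + ennreal (2 * K) * ennreal (norm (snd p) ^ 4)"
      using K by (simp add: p w_def ennreal_mult'[symmetric] ennreal_plus[symmetric] algebra_simps del: ennreal_plus)
  qed
  also have "\<dots> = (\<integral>\<^sup>+x. \<integral>\<^sup>+z. ennreal (2 * K) * ennreal (norm (g x) ^ 4) + ennreal (2 * K) * ennreal (norm (z::'a) ^ 4) \<partial>std_gaussian \<partial>gibbs f)"
    by (subst G.nn_integral_fst[symmetric]) auto
  also have "\<dots> = ennreal (2 * K) * (\<integral>\<^sup>+x. ennreal (norm (g x) ^ 4) \<partial>gibbs f)
      + ennreal (2 * K) * (\<integral>\<^sup>+z. ennreal (norm (z::'a) ^ 4) \<partial>std_gaussian)"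
    using G.emeasure_space_1 \<pi>.emeasure_space_1 by (simp add: nn_integral_add nn_integral_cmult)
  also have "\<dots> < \<infinity>"
    using nn_integral_gibbs_norm_gradient_power4 nn_integral_std_gaussian_norm_power4[where 'a='a]
    by (simp add: ennreal_mult_less_top)
  finally have w: "(\<integral>\<^sup>+p. w p \<partial>?P) < \<infinity>" .
  have "I \<longlonglongrightarrow> (\<integral>\<^sup>+p. 0 \<partial>?P)"
    unfolding I_def
  proof (rule nn_integral_dominated_convergence[where w = w])
    show "AE p in ?P. (\<lambda>n. ennreal (rejection_rate (\<eta> n) p)) \<longlonglongrightarrow> 0"
    proof (rule AE_I2)
      fix p :: "'a \<times> 'a"
      have "(\<lambda>n. rejection_rate (\<eta> n) p) \<longlonglongrightarrow> 0"
        using rejection_rate_tendsto[OF \<eta>, of "fst p" "snd p"] by simp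
      then show "(\<lambda>n. ennreal (rejection_rate (\<eta> n) p)) \<longlonglongrightarrow> 0"
        using tendsto_ennrealI by fastforce
    qed
  qed (use dom w in auto)
  then have I: "I \<longlonglongrightarrow> 0" by simp
  have fin: "I n < \<infinity>" for n
    unfolding I_def using nn_integral_mono[of ?P "\<lambda>p. ennreal (rejection_rate (\<eta> n) p)" w] dom w
    by (meson le_less_trans)
  define \<epsilon> where "\<epsilon> n = sqrt (enn2real (I n))" for n
  show thesis
  proof
    show "0 \<le> \<epsilon> n" for n by (simp add: \<epsilon>_def)
    have "(\<lambda>n. enn2real (I n)) \<longlonglongrightarrow> 0"
      by (rule tendsto_enn2real) (use I in auto)
    then show "\<epsilon> \<longlonglongrightarrow> 0"
      unfolding \<epsilon>_def using tendsto_real_sqrt by fastforce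
    fix n
    have "ennreal ((\<eta> n)\<^sup>2) * I n = ennreal ((\<eta> n * \<epsilon> n)\<^sup>2)"
      using fin[of n] by (simp add: \<epsilon>_def power_mult_distrib ennreal_mult')
    then show "(\<integral>\<^sup>+x. \<integral>\<^sup>+s. ennreal ((norm (mala (\<eta> n) x s - proposal (\<eta> n) x (fst s)))\<^sup>2) \<partial>noise \<partial>gibbs f)
      \<le> ennreal ((\<eta> n * \<epsilon> n)\<^sup>2)"
      using mala_error_le[OF \<eta>(1)[of n]] by (simp add: I_def)
  qed
qed

section \<open>Stationarity and the second moment of the gradient\<close>

lemma distr_gibbs_mala:
  assumes \<eta>: "0 < \<eta>"
  shows "distr (gibbs f \<Otimes>\<^sub>M noise) borel (\<lambda>w. mala \<eta> (fst w) (snd w)) = gibbs f"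
proof (rule measure_eqI)
  interpret N: prob_space "noise :: ('a \<times> real) measure" by (rule prob_space_noise)
  fix A assume "A \<in> sets (distr (gibbs f \<Otimes>\<^sub>M noise) borel (\<lambda>w. mala \<eta> (fst w) (snd w)))"
  then have [measurable]: "A \<in> sets borel" by simp
  have "emeasure (distr (gibbs f \<Otimes>\<^sub>M noise) borel (\<lambda>w. mala \<eta> (fst w) (snd w))) A
      = (\<integral>\<^sup>+w. indicator A (mala \<eta> (fst w) (snd w)) \<partial>(gibbs f \<Otimes>\<^sub>M noise))"
    using nn_integral_distr[of "\<lambda>w. mala \<eta> (fst w) (snd w)" "gibbs f \<Otimes>\<^sub>M noise" borel "indicator A"] by simp
  also have "\<dots> = (\<integral>\<^sup>+x. \<integral>\<^sup>+s. indicator A (mala \<eta> x s) \<partial>noise \<partial>gibbs f)"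
    by (subst N.nn_integral_fst[symmetric]) auto
  also have "\<dots> = emeasure (gibbs f) A"
    by (subst nn_integral_gibbs_mala[OF \<eta>]) auto
  finally show "emeasure (distr (gibbs f \<Otimes>\<^sub>M noise) borel (\<lambda>w. mala \<eta> (fst w) (snd w))) A = emeasure (gibbs f) A" .
qed simp

lemma square_integrable_gibbs:
  "square_integrable (gibbs f) (\<lambda>x. x)" "square_integrable (gibbs f) g"
proof -
  interpret prob_space "gibbs f" by (rule prob_space_gibbs)
  have *: "square_integrable (gibbs f) F"
    if [measurable]: "F \<in> borel_measurable borel" and fin: "(\<integral>\<^sup>+x. ennreal (norm (F x) ^ 4) \<partial>gibbs f) < \<infinity>"
    for F :: "'a \<Rightarrow> 'a"
  proof -
    have "integrable (gibbs f) (\<lambda>x. norm (F x) ^ 4)"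
      using fin by (simp add: integrable_iff_bounded)
    then have "integrable (gibbs f) (\<lambda>x. 1 + norm (F x) ^ 4)" by simp
    then have "integrable (gibbs f) (\<lambda>x. (norm (F x))\<^sup>2)"
    proof (rule Bochner_Integration.integrable_bound; (intro AE_I2)?)
      fix x
      have "0 \<le> ((norm (F x))\<^sup>2 - 1)\<^sup>2" by simp
      then have "2 * (norm (F x))\<^sup>2 \<le> 1 + norm (F x) ^ 4"
        unfolding power2_diff by (simp add: power_mult[symmetric])
      then have "(norm (F x))\<^sup>2 \<le> 1 + norm (F x) ^ 4"
        using zero_le_power2[of "norm (F x)"] by linarith
      then show "norm ((norm (F x))\<^sup>2) \<le> norm (1 + norm (F x) ^ 4)"
        by simp
    qed measurable
    then show ?thesis by (simp add: square_integrable_def)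
  qed
  show "square_integrable (gibbs f) (\<lambda>x. x)" "square_integrable (gibbs f) g"
    using nn_integral_gibbs_norm_power4 nn_integral_gibbs_norm_gradient_power4 by (auto intro!: *)
qed

lemma integrable_gibbs_f: "integrable (gibbs f) f"
proof -
  interpret prob_space "gibbs f" by (rule prob_space_gibbs)
  note i = square_integrable_integrable[OF square_integrable_gibbs(1)]
  have "integrable (gibbs f) (\<lambda>x. \<bar>f 0\<bar> + ((norm (g 0))\<^sup>2 + (1 + M) * (norm x)\<^sup>2))"
    using i by simp
  then show ?thesis
  proof (rule Bochner_Integration.integrable_bound; (intro AE_I2)?)
    fix x
    have "\<bar>g 0 \<bullet> x\<bar> \<le> norm (g 0) * norm x" by (rule Cauchy_Schwarz_ineq2)
    also have "\<dots> \<le> (norm (g 0))\<^sup>2 + (norm x)\<^sup>2"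
      using zero_le_power2[of "norm (g 0) - norm x"] unfolding power2_diff
      using zero_le_power2[of "norm (g 0)"] zero_le_power2[of "norm x"] by linarith
    moreover have "0 \<le> m / 2 * (norm x)\<^sup>2" "M / 2 * (norm x)\<^sup>2 \<le> M * (norm x)\<^sup>2"
      using m_pos M_pos by auto
    ultimately have "\<bar>f x\<bar> \<le> \<bar>f 0\<bar> + ((norm (g 0))\<^sup>2 + (1 + M) * (norm x)\<^sup>2)"
      using lower[of 0 x] upper[of x 0] by (simp add: algebra_simps)
    then show "norm (f x) \<le> norm (\<bar>f 0\<bar> + ((norm (g 0))\<^sup>2 + (1 + M) * (norm x)\<^sup>2))"
      by simp
  qed measurable
qed

text \<open>Stationarity of \<open>f\<close> under a MALA step of size \<open>\<eta>\<close> yields \<open>\<eta> E |g|\<^sup>2 \<le> M \<eta> p + o(\<eta>)\<close>; no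
  integration by parts is needed.\<close>

lemma l2norm_gibbs_gradient: "l2norm (gibbs f) g \<le> sqrt (M * DIM('a))"
proof -
  let ?P = "gibbs f \<Otimes>\<^sub>M (noise :: ('a \<times> real) measure)"
  interpret \<pi>: prob_space "gibbs f" by (rule prob_space_gibbs)
  interpret N: prob_space "noise :: ('a \<times> real) measure" by (rule prob_space_noise)
  interpret pair_prob_space "gibbs f" "noise :: ('a \<times> real) measure" ..
  interpret U: prob_space unif01 by (rule prob_space_unif01)
  have [measurable]: "fst \<in> borel_measurable (borel :: ('a \<times> real) measure)"
    unfolding borel_prod[symmetric] by measurable
  define s where "s = l2norm (gibbs f) g"
  define p where "p = real DIM('a)"
  have dz: "distr noise borel fst = (std_gaussian :: 'a measure)"
    using U.distr_pair_fst[of std_gaussian]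
    by (simp add: noise_def cong: distr_cong)
  have dx: "distr ?P (gibbs f) fst = gibbs f" by (rule N.distr_pair_fst)
  have G: "square_integrable ?P (\<lambda>w. g (fst w))" and Gn: "l2norm ?P (\<lambda>w. g (fst w)) = s"
  proof -
    have "(\<integral>\<^sup>+w. ennreal ((norm (g (fst w)))\<^sup>2) \<partial>?P) = (\<integral>\<^sup>+x. ennreal ((norm (g x))\<^sup>2) \<partial>distr ?P (gibbs f) fst)"
      by (subst nn_integral_distr) auto
    also have "\<dots> = ennreal (s\<^sup>2)"
      unfolding dx s_def by (rule nn_integral_norm_sq[OF square_integrable_gibbs(2)])
    finally have e: "(\<integral>\<^sup>+w. ennreal ((norm (g (fst w)))\<^sup>2) \<partial>?P) = ennreal (s\<^sup>2)" .
    show 1: "square_integrable ?P (\<lambda>w. g (fst w))"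
      by (rule square_integrable_nn_integral(1)[where c = "s\<^sup>2"]) (use e in auto)
    show "l2norm ?P (\<lambda>w. g (fst w)) = s"
      using e unfolding nn_integral_norm_sq[OF 1] by (simp add: s_def)
  qed
  have Z: "square_integrable ?P (\<lambda>w. fst (snd w))" and Zn: "(l2norm ?P (\<lambda>w. fst (snd w)))\<^sup>2 = p"
  proof -
    have "(\<integral>\<^sup>+w. ennreal ((norm (fst (snd w)))\<^sup>2) \<partial>?P) = (\<integral>\<^sup>+y. ennreal ((norm (fst y :: 'a))\<^sup>2) \<partial>noise)"
      using \<pi>.emeasure_space_1 by (subst N.nn_integral_fst[symmetric]) auto
    also have "\<dots> = (\<integral>\<^sup>+z. ennreal ((norm (z :: 'a))\<^sup>2) \<partial>distr noise borel fst)"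
      by (subst nn_integral_distr) auto
    also have "\<dots> = ennreal p"
      unfolding dz nn_integral_std_gaussian_norm_sq p_def by (simp add: ennreal_of_nat_eq_real_of_nat)
    finally have e: "(\<integral>\<^sup>+w. ennreal ((norm (fst (snd w)))\<^sup>2) \<partial>?P) = ennreal p" .
    show 1: "square_integrable ?P (\<lambda>w. fst (snd w))"
      by (rule square_integrable_nn_integral(1)[where c = p]) (use e in \<open>auto simp: p_def\<close>)
    show "(l2norm ?P (\<lambda>w. fst (snd w)))\<^sup>2 = p"
      using e unfolding nn_integral_norm_sq[OF 1] by (simp add: p_def)
  qed
  \<comment> \<open>The increment is centred and independent of the state. Without this the cross
    term, of order \<open>sqrt \<eta>\<close>, would dominate the terms of order \<eta>.\<close>
  have GZ: "(\<integral>w. g (fst w) \<bullet> fst (snd w) \<partial>?P) = 0"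
  proof -
    have z0: "(\<integral>y. g x \<bullet> fst y \<partial>noise) = 0" for x
    proof -
      have "(\<integral>y. g x \<bullet> fst y \<partial>noise) = (\<integral>z. g x \<bullet> z \<partial>distr noise borel fst)"
        by (subst integral_distr) auto
      then show ?thesis unfolding dz by (simp add: integral_std_gaussian_inner)
    qed
    show ?thesis
      using integral_fst'[OF square_integrable_inner[OF G Z]] by (simp add: z0)
  qed
  define \<eta> where "\<eta> n = 1 / real (Suc n)" for n
  have \<eta>: "0 < \<eta> n" "\<eta> n \<le> 1" for n by (auto simp: \<eta>_def)
  have \<eta>0: "\<eta> \<longlonglongrightarrow> 0"
    unfolding \<eta>_def using LIMSEQ_inverse_real_of_nat by (simp add: inverse_eq_divide)
  obtain \<epsilon> :: "nat \<Rightarrow> real" where \<epsilon>: "\<And>n. 0 \<le> \<epsilon> n" "\<epsilon> \<longlonglongrightarrow> 0"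
    "\<And>n. (\<integral>\<^sup>+x. \<integral>\<^sup>+s. ennreal ((norm (mala (\<eta> n) x s - proposal (\<eta> n) x (fst s)))\<^sup>2) \<partial>noise \<partial>gibbs f)
      \<le> ennreal ((\<eta> n * \<epsilon> n)\<^sup>2)"
    using mala_error_rate[OF \<eta> \<eta>0] by blast
  have main: "s\<^sup>2 \<le> M * p + s * \<epsilon> n + M / 2 * \<eta> n * s\<^sup>2" for n
  proof -
    let ?t = "\<eta> n"
    define X where "X w = mala ?t (fst w) (snd w)" for w
    define E where "E w = mala ?t (fst w) (snd w) - proposal ?t (fst w) (fst (snd w))" for w
    have [measurable]: "X \<in> borel_measurable ?P" "E \<in> borel_measurable ?P"
      unfolding X_def E_def by measurable
    have dX: "distr ?P borel X = gibbs f"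
      unfolding X_def using distr_gibbs_mala[OF \<eta>(1)] .
    have E: "square_integrable ?P E" "l2norm ?P E \<le> ?t * \<epsilon> n"
    proof -
      have e: "(\<integral>\<^sup>+w. ennreal ((norm (E w))\<^sup>2) \<partial>?P) \<le> ennreal ((?t * \<epsilon> n)\<^sup>2)"
        using \<epsilon>(3)[of n] by (subst N.nn_integral_fst[symmetric]) (auto simp: E_def)
      show "square_integrable ?P E" "l2norm ?P E \<le> ?t * \<epsilon> n"
        using square_integrable_nn_integral[OF _ e] \<eta>(1)[of n] \<epsilon>(1)[of n] by (auto simp: real_sqrt_mult)
    qed
    have fX: "integrable ?P (\<lambda>w. f (X w))" "(\<integral>w. f (X w) \<partial>?P) = (\<integral>x. f x \<partial>gibbs f)"
      using integrable_distr_eq[of X ?P borel f] integral_distr[of X ?P borel f] integrable_gibbs_f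
      unfolding dX by simp_all
    have fx: "integrable ?P (\<lambda>w. f (fst w))" "(\<integral>w. f (fst w) \<partial>?P) = (\<integral>x. f x \<partial>gibbs f)"
      using integrable_distr_eq[of fst ?P "gibbs f" f] integral_distr[of fst ?P "gibbs f" f] integrable_gibbs_f
      unfolding dx by simp_all
    have pw: "f (X w) - f (fst w) \<le> (- ?t + M / 2 * ?t\<^sup>2) * (norm (g (fst w)))\<^sup>2
        + (sqrt (2 * ?t) - M * ?t * sqrt (2 * ?t)) * (g (fst w) \<bullet> fst (snd w))
        + g (fst w) \<bullet> E w + M * ?t * (norm (fst (snd w)))\<^sup>2" for w
    proof -
      define x z where "x = fst w" and "z = fst (snd w)"
      have "X w = x \<or> X w = proposal ?t x z"
        by (simp add: X_def mala_def x_def z_def)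
      \<comment> \<open>A rejected step does not move at all, so the quadratic term needs no
        comparison with the Euler step; the error \<open>E\<close> enters only linearly.\<close>
      then have "(norm (X w - x))\<^sup>2 \<le> (norm (proposal ?t x z - x))\<^sup>2" by auto
      also have "\<dots> = (norm (sqrt (2 * ?t) *\<^sub>R z - ?t *\<^sub>R g x))\<^sup>2"
        by (simp add: proposal_def)
      also have "\<dots> = 2 * ?t * (norm z)\<^sup>2 - 2 * ?t * sqrt (2 * ?t) * (g x \<bullet> z) + ?t\<^sup>2 * (norm (g x))\<^sup>2"
        unfolding norm_diff_sq using \<eta>(1)[of n] by (simp add: power_mult_distrib inner_commute)
      finally have "M / 2 * (norm (X w - x))\<^sup>2
          \<le> M / 2 * (2 * ?t * (norm z)\<^sup>2 - 2 * ?t * sqrt (2 * ?t) * (g x \<bullet> z) + ?t\<^sup>2 * (norm (g x))\<^sup>2)"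
        using M_pos by (intro mult_left_mono) auto
      moreover have "g x \<bullet> (X w - x) = - ?t * (norm (g x))\<^sup>2 + sqrt (2 * ?t) * (g x \<bullet> z) + g x \<bullet> E w"
      proof -
        have "X w - x = - ?t *\<^sub>R g x + sqrt (2 * ?t) *\<^sub>R z + E w"
          by (simp add: X_def E_def x_def z_def proposal_def)
        then show ?thesis by (simp add: inner_add_right inner_diff_right power2_norm_eq_inner)
      qed
      ultimately show ?thesis
        using upper[of "X w" x] unfolding x_def[symmetric] z_def[symmetric] by (simp add: algebra_simps)
    qed
    note int = square_integrable_integrable[OF G] square_integrable_integrable[OF Z]
      square_integrable_inner[OF G Z] square_integrable_inner[OF G E(1)]
    \<comment> \<open>State and successor have the same law, hence \<open>f\<close> has the same
      mean at both.\<close>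
    have "0 = (\<integral>w. f (X w) - f (fst w) \<partial>?P)"
      using fX fx by simp
    also have "\<dots> \<le> (\<integral>w. (- ?t + M / 2 * ?t\<^sup>2) * (norm (g (fst w)))\<^sup>2
        + (sqrt (2 * ?t) - M * ?t * sqrt (2 * ?t)) * (g (fst w) \<bullet> fst (snd w))
        + g (fst w) \<bullet> E w + M * ?t * (norm (fst (snd w)))\<^sup>2 \<partial>?P)"
      by (intro integral_mono pw) (use fX fx int in auto)
    also have "\<dots> = (- ?t + M / 2 * ?t\<^sup>2) * s\<^sup>2 + (\<integral>w. g (fst w) \<bullet> E w \<partial>?P) + M * ?t * p"
      using int GZ by (simp add: Gn[symmetric] Zn[symmetric] l2norm_sq)
    also have "(\<integral>w. g (fst w) \<bullet> E w \<partial>?P) \<le> s * (?t * \<epsilon> n)"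
      using l2norm_Cauchy_Schwarz[OF G E(1)] E(2) mult_left_mono[OF E(2), of s]
      unfolding Gn by (simp add: s_def)
    finally have "0 \<le> ?t * (- s\<^sup>2 + M / 2 * ?t * s\<^sup>2 + s * \<epsilon> n + M * p)"
      by (simp add: algebra_simps power2_eq_square)
    then show ?thesis
      using \<eta>(1)[of n] by (simp add: zero_le_mult_iff)
  qed
  have "(\<lambda>n. M * p + s * \<epsilon> n + M / 2 * \<eta> n * s\<^sup>2) \<longlonglongrightarrow> M * p + s * 0 + M / 2 * 0 * s\<^sup>2"
    by (intro tendsto_intros \<epsilon>(2) \<eta>0)
  then have "s\<^sup>2 \<le> M * p + s * 0 + M / 2 * 0 * s\<^sup>2"
    by (rule LIMSEQ_le_const) (use main in auto)
  then show ?thesis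
    unfolding s_def p_def by (intro real_le_rsqrt) simp
qed

end

section \<open>The stationary chain\<close>

abbreviation noise_stream :: "('a::euclidean_space \<times> real) stream measure" where
  "noise_stream \<equiv> stream_space noise"

lemma prob_space_noise_stream: "prob_space noise_stream"
  by (rule prob_space.prob_space_stream_space[OF prob_space_noise])

definition walk :: "nat \<Rightarrow> ('a::euclidean_space \<times> real) stream \<Rightarrow> 'a" where
  "walk j \<omega> = (\<Sum>i<j. fst (\<omega> !! i))"

lemma measurable_noise_fst [measurable]:
  "fst \<in> borel_measurable (noise :: ('a::euclidean_space \<times> real) measure)"
  unfolding measurable_cong_sets[OF sets_noise refl] borel_prod[symmetric] by measurable

lemma measurable_snth_noise [measurable (raw)]:
  "W \<in> N \<rightarrow>\<^sub>M noise_stream \<Longrightarrow> (\<lambda>\<omega>. W \<omega> !! i) \<in> N \<rightarrow>\<^sub>M noise"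
  using measurable_compose[OF _ measurable_snth] .

lemma measurable_walk [measurable (raw)]:
  assumes [measurable]: "W \<in> N \<rightarrow>\<^sub>M noise_stream"
  shows "(\<lambda>\<omega>. walk j (W \<omega>)) \<in> borel_measurable N"
  unfolding walk_def by measurable

lemma walk_0 [simp]: "walk 0 \<omega> = 0"
  by (simp add: walk_def)

lemma walk_Suc: "walk (Suc j) (s ## \<omega>) = fst s + walk j \<omega>"
  unfolding walk_def by (subst sum.lessThan_Suc_shift) simp

lemma walk_split: "j \<le> n \<Longrightarrow> walk n \<omega> = walk j \<omega> + walk (n - j) (sdrop j \<omega>)"
proof (induction j arbitrary: n \<omega>)
  case (Suc j)
  then obtain k where k: "n = Suc k" "j \<le> k" by (cases n) auto
  obtain s \<omega>' where w: "\<omega> = s ## \<omega>'" by (cases \<omega>)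
  show ?case using Suc.IH[OF k(2), of \<omega>'] by (simp add: k w walk_Suc add.assoc)
qed simp

text \<open>In one formula: \<open>walk j\<close> is Gaussian with covariance \<open>j\<close> times
  the identity, and it is independent of the noise after time \<open>j\<close>. The induction splits
  off the first increment and merges it with the rest by rotation invariance.\<close>

lemma nn_integral_walk:
  fixes F :: "'a::euclidean_space \<Rightarrow> ('a \<times> real) stream \<Rightarrow> ennreal"
  assumes F: "(\<lambda>(z, \<omega>). F z \<omega>) \<in> borel_measurable (borel \<Otimes>\<^sub>M noise_stream)"
  shows "(\<integral>\<^sup>+\<omega>. F (walk j \<omega>) (sdrop j \<omega>) \<partial>noise_stream)
    = (\<integral>\<^sup>+z. \<integral>\<^sup>+\<omega>. F (sqrt (real j) *\<^sub>R z) \<omega> \<partial>noise_stream \<partial>std_gaussian)"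
  using F
proof (induction j arbitrary: F)
  case 0
  interpret G: prob_space "std_gaussian :: 'a measure" by (rule prob_space_std_gaussian)
  show ?case using G.emeasure_space_1 by simp
next
  case (Suc j)
  note [measurable] = Suc.prems
  interpret G: prob_space "std_gaussian :: 'a measure" by (rule prob_space_std_gaussian)
  interpret N: prob_space "noise :: ('a \<times> real) measure" by (rule prob_space_noise)
  interpret U: prob_space unif01 by (rule prob_space_unif01)
  interpret S: prob_space "noise_stream :: ('a \<times> real) stream measure" by (rule prob_space_noise_stream)
  define H where "H z = (\<integral>\<^sup>+\<omega>. F z \<omega> \<partial>noise_stream)" for z
  have [measurable]: "H \<in> borel_measurable borel"
    unfolding H_def by measurable
  have "(\<integral>\<^sup>+\<omega>. F (walk (Suc j) \<omega>) (sdrop (Suc j) \<omega>) \<partial>noise_stream)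
      = (\<integral>\<^sup>+s. \<integral>\<^sup>+\<omega>. F (fst s + walk j \<omega>) (sdrop j \<omega>) \<partial>noise_stream \<partial>noise)"
    by (subst N.nn_integral_stream_space) (auto simp: walk_Suc)
  also have "\<dots> = (\<integral>\<^sup>+s. \<integral>\<^sup>+z. H (fst s + sqrt (real j) *\<^sub>R z) \<partial>std_gaussian \<partial>noise)"
    unfolding H_def by (subst Suc.IH[of "\<lambda>z \<omega>. F (fst s + z) \<omega>" for s]) auto
  also have "\<dots> = (\<integral>\<^sup>+x. \<integral>\<^sup>+z. H (x + sqrt (real j) *\<^sub>R z) \<partial>std_gaussian \<partial>std_gaussian)"
  proof -
    have "(\<lambda>s. \<integral>\<^sup>+z. H (fst s + sqrt (real j) *\<^sub>R z) \<partial>std_gaussian) \<in> borel_measurable (noise :: ('a \<times> real) measure)"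
      by measurable
    then show ?thesis
      using U.emeasure_space_1 by (subst nn_integral_noise) (auto simp: measurable_cong_sets[OF sets_noise refl])
  qed
  also have "\<dots> = (\<integral>\<^sup>+z. H (sqrt (real (Suc j)) *\<^sub>R z) \<partial>std_gaussian)"
  \<comment> \<open>For \<open>j = 0\<close> the second coefficient vanishes, which the rotation
    lemma excludes.\<close>
  proof (cases "j = 0")
    case True
    then show ?thesis using G.emeasure_space_1 by simp
  next
    case False
    let ?r = "sqrt (real (Suc j))"
    have r: "?r > 0" by simp
    have eq: "x + sqrt (real j) *\<^sub>R z = ?r *\<^sub>R ((1 / ?r) *\<^sub>R x + (sqrt (real j) / ?r) *\<^sub>R z)" for x z :: 'a
      using r by (simp add: scaleR_add_right)
    have "(\<integral>\<^sup>+x. \<integral>\<^sup>+z. H (?r *\<^sub>R ((1 / ?r) *\<^sub>R x + (sqrt (real j) / ?r) *\<^sub>R z)) \<partial>std_gaussian \<partial>std_gaussian)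
        = (\<integral>\<^sup>+z. H (?r *\<^sub>R z) \<partial>std_gaussian)"
      by (rule nn_integral_std_gaussian_rotation[where F = "\<lambda>y. H (?r *\<^sub>R y)"])
        (use False in \<open>auto simp: power_divide add_divide_distrib[symmetric]\<close>)
    then show ?thesis unfolding eq .
  qed
  finally show ?case unfolding H_def .
qed

context potential
begin

primrec chain :: "real \<Rightarrow> nat \<Rightarrow> 'a \<Rightarrow> ('a \<times> real) stream \<Rightarrow> 'a" where
  "chain \<eta> 0 x \<omega> = x"
| "chain \<eta> (Suc i) x \<omega> = mala \<eta> (chain \<eta> i x \<omega>) (\<omega> !! i)"

text \<open>\<open>chain\<close> is defined by its last step, whereas integrals over streams unfold
  at the head; the first step is moved into the starting point.\<close>

lemma chain_Suc_shift: "chain \<eta> (Suc i) x (s ## \<omega>) = chain \<eta> i (mala \<eta> x s) \<omega>"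
  by (induction i) simp_all

lemma measurable_chain [measurable (raw)]:
  assumes [measurable]: "X \<in> borel_measurable N" "W \<in> N \<rightarrow>\<^sub>M noise_stream"
  shows "(\<lambda>\<omega>. chain \<eta> i (X \<omega>) (W \<omega>)) \<in> borel_measurable N"
proof (induction i)
  case (Suc i)
  note [measurable] = Suc.IH
  have "(\<lambda>\<omega>. W \<omega> !! i) \<in> N \<rightarrow>\<^sub>M noise" by measurable
  then have [measurable]: "(\<lambda>\<omega>. W \<omega> !! i) \<in> borel_measurable N"
    by (simp add: measurable_cong_sets[OF refl sets_noise])
  show ?case unfolding chain.simps by measurable
qed simp

text \<open>The noise of the next step is included because the rejection error of step
  \<open>i\<close> depends on the state and on that noise; jointly they have the law of a fresh
  stationary step.\<close>

lemma nn_integral_chain: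
  assumes \<eta>: "0 < \<eta>" and H: "(\<lambda>(y, s). H y s) \<in> borel_measurable (borel \<Otimes>\<^sub>M noise)"
  shows "(\<integral>\<^sup>+x. \<integral>\<^sup>+\<omega>. H (chain \<eta> i x \<omega>) (\<omega> !! i) \<partial>noise_stream \<partial>gibbs f)
    = (\<integral>\<^sup>+x. \<integral>\<^sup>+s. H x s \<partial>noise \<partial>gibbs f)"
proof (induction i)
  case 0
  note [measurable] = H
  interpret N: prob_space "noise :: ('a \<times> real) measure" by (rule prob_space_noise)
  interpret S: prob_space "noise_stream :: ('a \<times> real) stream measure" by (rule prob_space_noise_stream)
  show ?case
    using S.emeasure_space_1 by (subst N.nn_integral_stream_space) auto
next
  case (Suc i)
  note [measurable] = H
  interpret N: prob_space "noise :: ('a \<times> real) measure" by (rule prob_space_noise)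
  interpret S: prob_space "noise_stream :: ('a \<times> real) stream measure" by (rule prob_space_noise_stream)
  define F where "F y = (\<integral>\<^sup>+\<omega>. H (chain \<eta> i y \<omega>) (\<omega> !! i) \<partial>noise_stream)" for y
  have [measurable]: "F \<in> borel_measurable borel"
    unfolding F_def by measurable
  have "(\<integral>\<^sup>+x. \<integral>\<^sup>+\<omega>. H (chain \<eta> (Suc i) x \<omega>) (\<omega> !! Suc i) \<partial>noise_stream \<partial>gibbs f)
      = (\<integral>\<^sup>+x. \<integral>\<^sup>+s. F (mala \<eta> x s) \<partial>noise \<partial>gibbs f)"
    unfolding F_def by (subst N.nn_integral_stream_space) (auto simp: chain_Suc_shift simp del: chain.simps)
  also have "\<dots> = (\<integral>\<^sup>+x. F x \<partial>gibbs f)"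
    by (rule nn_integral_gibbs_mala[OF \<eta>]) measurable
  finally show ?case
    using Suc.IH by (simp add: F_def)
qed

text \<open>The accumulated effect of rejections: a summand vanishes whenever its proposal is
  accepted.\<close>

definition residual :: "real \<Rightarrow> nat \<Rightarrow> 'a \<Rightarrow> ('a \<times> real) stream \<Rightarrow> 'a" where
  "residual \<eta> j x \<omega> =
    (\<Sum>i<j. mala \<eta> (chain \<eta> i x \<omega>) (\<omega> !! i) - proposal \<eta> (chain \<eta> i x \<omega>) (fst (\<omega> !! i)))"

lemma chain_decomposition:
  "chain \<eta> j x \<omega> = x - \<eta> *\<^sub>R (\<Sum>i<j. g (chain \<eta> i x \<omega>)) + sqrt (2 * \<eta>) *\<^sub>R walk j \<omega> + residual \<eta> j x \<omega>"
proof (induction j)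
  case 0
  then show ?case by (simp add: residual_def)
next
  case (Suc j)
  define K where "K = - (\<eta> *\<^sub>R g (chain \<eta> j x \<omega>)) + sqrt (2 * \<eta>) *\<^sub>R fst (\<omega> !! j)
    + (mala \<eta> (chain \<eta> j x \<omega>) (\<omega> !! j) - proposal \<eta> (chain \<eta> j x \<omega>) (fst (\<omega> !! j)))"
  have "chain \<eta> (Suc j) x \<omega> = chain \<eta> j x \<omega> + K"
    by (simp add: K_def proposal_def)
  also have "\<dots> = (x - \<eta> *\<^sub>R (\<Sum>i<j. g (chain \<eta> i x \<omega>)) + sqrt (2 * \<eta>) *\<^sub>R walk j \<omega> + residual \<eta> j x \<omega>) + K"
    by (rule arg_cong[where f = "\<lambda>v. v + K", OF Suc.IH])
  also have "\<dots> = x - \<eta> *\<^sub>R (\<Sum>i<Suc j. g (chain \<eta> i x \<omega>)) + sqrt (2 * \<eta>) *\<^sub>R walk (Suc j) \<omega>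
      + residual \<eta> (Suc j) x \<omega>"
    by (simp add: K_def residual_def walk_def scaleR_add_right)
  finally show ?case .
qed

end

section \<open>The averaged one-step estimate\<close>

text \<open>Young's inequality with weight \<open>\<rho>\<close>: both the factor of
  \<open>y\<^sup>2\<close> and the extra term become harmless as \<open>\<rho>\<close> tends to 0,
  and nothing is divided by \<open>\<rho>\<close>.\<close>

lemma sq_add_le:
  fixes y s :: real
  assumes "0 \<le> \<rho>"
  shows "(y + c * \<rho>)\<^sup>2 \<le> (1 + \<rho>) * y\<^sup>2 + c\<^sup>2 * (\<rho> + \<rho>\<^sup>2)"
proof -
  have "0 \<le> \<rho> * (y - c)\<^sup>2" using assms by simp
  then show ?thesis by (simp add: power2_eq_square algebra_simps)
qed

text \<open>The inequality between the \<open>L\<^sup>2\<close> norms behind the one-step estimate, with \<open>u = j / N\<close>,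
  \<open>a = M h\<close>, \<open>b = a u\<close> and \<open>c = sqrt (M p)\<close>. The numbers come from \<open>a \<le> 0.18\<close>:
  \<open>sqrt a + sqrt 2 \<le> 1.84\<close>, \<open>b / (1 - b) \<le> 0.22\<close> and \<open>1.84 * (2 / (1 - b) + 1) \<le> 6.33\<close>.\<close>

lemma one_step_numbers:
  fixes a b c u x G \<Delta> r \<rho> :: real
  assumes u: "0 \<le> u" "u \<le> 1" and b: "b = a * u" and a: "0 \<le> a" "a \<le> 9 / 50"
    and c: "0 \<le> c" and \<rho>: "0 \<le> \<rho>" and M: "0 < M" and pos: "0 \<le> x" "0 \<le> \<Delta>" "0 \<le> r"
    and x: "M * x \<le> c * (b + sqrt (2 * b)) + M * \<rho>"
    and G: "G \<le> \<Delta> + (b * (G + c) + sqrt (2 * b) * c) + M * x"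
    and r: "M * r \<le> b * G + b * (c * (b + sqrt (2 * b)) + M * \<rho>) + M * \<rho>"
  shows "(M * r)\<^sup>2 - (1 - 4 * a) * \<Delta>\<^sup>2 + 4 / 3 * a * (M * x)\<^sup>2
    \<le> (1 + \<rho>) * c\<^sup>2 * (50.1 * a ^ 3 + 4.52 * a\<^sup>2) * u + 3 * M\<^sup>2 * (\<rho> + \<rho>\<^sup>2)"
proof -
  define s where "s = sqrt b"
  have b0: "0 \<le> b" "b \<le> a" "b \<le> 9 / 50"
    using u a mult_left_mono[of u 1 a] unfolding b by auto
  have s: "0 \<le> s" "s\<^sup>2 = b" using b0 by (auto simp: s_def)
  have "s \<le> 0.4243"
    using b0 s by (intro power2_le_imp_le[of s]) (auto simp: power2_eq_square)
  moreover have "sqrt 2 \<le> 1.4143" by (rule real_le_lsqrt) (auto simp: power2_eq_square)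
  ultimately have "s + sqrt 2 \<le> 1.84" by simp
  then have "s * (s + sqrt 2) \<le> s * 1.84" using s by (intro mult_left_mono) auto
  moreover have bs: "b + sqrt (2 * b) = s * (s + sqrt 2)"
    using s by (simp add: s_def real_sqrt_mult power2_eq_square algebra_simps)
  ultimately have q: "b + sqrt (2 * b) \<le> 1.84 * s" by simp
  then have cq: "c * (b + sqrt (2 * b)) \<le> 1.84 * (c * s)"
    using mult_left_mono[OF q c] by simp
  have x': "M * x \<le> 1.84 * (c * s) + M * \<rho>" using x cq by simp
  have cs: "0 \<le> c * s" using c s by simp
  have M\<rho>: "0 \<le> M * \<rho>" using M \<rho> by simp
  \<comment> \<open>\<open>r\<close> is controlled by \<open>G\<close>, and \<open>G\<close> in turn
    by \<open>\<Delta>\<close>: moving \<open>b * G\<close> to the left leaves the factor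
    \<open>1 - b \<ge> 0.82\<close>. For the residual,
    \<open>0.18 / 0.82 + 0.18 + 1 \<le> 1.4\<close>.\<close>
  have rG: "M * r \<le> 0.22 * \<Delta> + (6.33 * (b * (c * s)) + 1.4 * M * \<rho>)"
  proof -
    have "G * (1 - b) \<le> \<Delta> + c * (b + sqrt (2 * b)) + M * x"
      using G by (simp add: algebra_simps)
    then have G1: "G * (1 - b) \<le> \<Delta> + 3.68 * (c * s) + M * \<rho>" using cq x' by simp
    have G2: "0.82 * G \<le> \<Delta> + 3.68 * (c * s) + M * \<rho>"
    proof (cases "0 \<le> G")
      case True
      then have "0.82 * G \<le> (1 - b) * G" using b0 by (intro mult_right_mono) auto
      then show ?thesis using G1 by (simp add: mult.commute)
    next
      case False
      then show ?thesis using pos cs M\<rho> by simp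
    qed
    then have "0.82 * (b * G) \<le> b * (\<Delta> + 3.68 * (c * s) + M * \<rho>)"
      using mult_left_mono[OF G2 b0(1)] by simp
    also have "\<dots> = b * \<Delta> + 3.68 * (b * (c * s)) + b * (M * \<rho>)"
      by (simp add: algebra_simps)
    finally have "0.82 * (b * G) \<le> b * \<Delta> + 3.68 * (b * (c * s)) + b * (M * \<rho>)" .
    moreover have "b * \<Delta> \<le> 0.18 * \<Delta>" "b * (M * \<rho>) \<le> 0.18 * (M * \<rho>)"
      using b0 pos M\<rho> mult_right_mono[of b "0.18" \<Delta>] mult_right_mono[of b "0.18" "M * \<rho>"] by simp_all
    moreover have "b * (c * (b + sqrt (2 * b)) + M * \<rho>) \<le> 1.84 * (b * (c * s)) + b * (M * \<rho>)"
      using mult_left_mono[OF cq b0(1)] by (simp add: algebra_simps)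
    moreover have "0 \<le> b * (c * s)" using b0 cs by simp
    ultimately show ?thesis using r pos M\<rho> by simp
  qed
  define y where "y = 6.33 * (b * (c * s)) + 1.4 * M * \<rho>"
  have "(M * r)\<^sup>2 \<le> (0.22 * \<Delta> + y)\<^sup>2"
    using rG pos M unfolding y_def by (intro power_mono) auto
  \<comment> \<open>Young's inequality with the conjugate factors 5 and 5/4:
    \<open>5 * 0.22^2 = 0.242\<close>.\<close>
  also have "\<dots> \<le> 0.242 * \<Delta>\<^sup>2 + 1.25 * y\<^sup>2"
  proof -
    have "0 \<le> (0.88 * \<Delta> - y)\<^sup>2" by simp
    then show ?thesis unfolding power2_diff power2_sum by (simp add: power_mult_distrib power2_eq_square)
  qed
  also have "y\<^sup>2 \<le> (1 + \<rho>) * (6.33 * (b * (c * s)))\<^sup>2 + (1.4 * M)\<^sup>2 * (\<rho> + \<rho>\<^sup>2)"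
    unfolding y_def by (rule sq_add_le[OF \<rho>])
  \<comment> \<open>Replacing \<open>u^3\<close> by the larger \<open>u\<close> means that only the
    mean of \<open>u\<close> is needed later; \<open>6.33^2\<close> is rounded up to 40.08 because
    \<open>1.25 * 40.08 = 50.1\<close>.\<close>
  also have "(6.33 * (b * (c * s)))\<^sup>2 \<le> 40.08 * (a ^ 3 * u) * c\<^sup>2"
  proof -
    have "b ^ 3 \<le> a ^ 3 * u"
    proof -
      have "u ^ 3 \<le> u ^ 1" using u by (intro power_decreasing) auto
      then show ?thesis unfolding b power_mult_distrib using a by (intro mult_left_mono) auto
    qed
    then have "b ^ 3 * c\<^sup>2 \<le> a ^ 3 * u * c\<^sup>2" by (rule mult_right_mono) simp
    moreover have "(6.33 * (b * (c * s)))\<^sup>2 = 40.0689 * (b ^ 3 * c\<^sup>2)"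
      using s by (simp add: power_mult_distrib power3_eq_cube power2_eq_square)
    moreover have "0 \<le> a ^ 3 * u * c\<^sup>2" using a u by simp
    ultimately show ?thesis by simp
  qed
  finally have r2: "(M * r)\<^sup>2 \<le> 0.242 * \<Delta>\<^sup>2 + 1.25 * ((1 + \<rho>) * (40.08 * (a ^ 3 * u) * c\<^sup>2) + (1.4 * M)\<^sup>2 * (\<rho> + \<rho>\<^sup>2))"
    using \<rho> by (simp add: mult_left_mono)
  have "(M * x)\<^sup>2 \<le> (1.84 * (c * s) + M * \<rho>)\<^sup>2"
    using x' M pos by (intro power_mono) auto
  also have "\<dots> \<le> (1 + \<rho>) * (1.84 * (c * s))\<^sup>2 + M\<^sup>2 * (\<rho> + \<rho>\<^sup>2)"
    by (rule sq_add_le[OF \<rho>])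
  also have "(1.84 * (c * s))\<^sup>2 = 3.3856 * (a * u * c\<^sup>2)"
    using s b by (simp add: power_mult_distrib power2_eq_square)
  finally have x2: "4 / 3 * a * (M * x)\<^sup>2 \<le> 4 / 3 * a * ((1 + \<rho>) * (3.3856 * (a * u * c\<^sup>2)) + M\<^sup>2 * (\<rho> + \<rho>\<^sup>2))"
    using a by (intro mult_left_mono) auto
  \<comment> \<open>The absorption: \<open>1 - 4 * a \<ge> 0.28\<close>, so the negative term
    outweighs the \<open>\<Delta>\<close> part of \<open>(M * r)\<^sup>2\<close>.\<close>
  have d: "0.242 * \<Delta>\<^sup>2 \<le> (1 - 4 * a) * \<Delta>\<^sup>2"
    using a by (intro mult_right_mono) auto
  have e: "4 / 3 * a * (M\<^sup>2 * (\<rho> + \<rho>\<^sup>2)) \<le> 0.24 * (M\<^sup>2 * (\<rho> + \<rho>\<^sup>2))"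
    using a \<rho> by (intro mult_right_mono) auto
  have k: "0 \<le> (1 + \<rho>) * (a ^ 3 * u * c\<^sup>2)" "0 \<le> (1 + \<rho>) * (a\<^sup>2 * u * c\<^sup>2)" "0 \<le> M\<^sup>2 * (\<rho> + \<rho>\<^sup>2)"
    using a u \<rho> by auto
  define k1 k2 k3 where "k1 = (1 + \<rho>) * (a ^ 3 * u * c\<^sup>2)" and "k2 = (1 + \<rho>) * (a\<^sup>2 * u * c\<^sup>2)" and "k3 = M\<^sup>2 * (\<rho> + \<rho>\<^sup>2)"
  have "(M * r)\<^sup>2 \<le> 0.242 * \<Delta>\<^sup>2 + 50.1 * k1 + 2.45 * k3"
  proof -
    have "(1 + \<rho>) * (40.08 * (a ^ 3 * u) * c\<^sup>2) = 40.08 * k1"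
      by (simp add: k1_def)
    moreover have "(1.4 * M)\<^sup>2 * (\<rho> + \<rho>\<^sup>2) = 1.96 * k3"
      unfolding k3_def power_mult_distrib by (simp add: power2_eq_square)
    moreover have "1.25 * (40.08 * k1 + 1.96 * k3) = 50.1 * k1 + 2.45 * k3"
      by (simp add: add_divide_distrib)
    ultimately show ?thesis using r2 by (simp only: add.assoc)
  qed
  moreover have "4 / 3 * a * (M * x)\<^sup>2 \<le> 4.52 * k2 + 0.24 * k3"
  proof -
    have "4 / 3 * a * ((1 + \<rho>) * (3.3856 * (a * u * c\<^sup>2)) + M\<^sup>2 * (\<rho> + \<rho>\<^sup>2)) = 4 / 3 * 3.3856 * k2 + 4 / 3 * a * k3"
      by (simp add: k2_def k3_def power2_eq_square algebra_simps)
    then show ?thesis using x2 e k unfolding k1_def[symmetric] k2_def[symmetric] k3_def[symmetric] by simp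
  qed
  moreover have "(1 + \<rho>) * c\<^sup>2 * (50.1 * a ^ 3 + 4.52 * a\<^sup>2) * u + 3 * M\<^sup>2 * (\<rho> + \<rho>\<^sup>2) = 50.1 * k1 + 4.52 * k2 + 3 * k3"
    by (simp add: k1_def k2_def k3_def algebra_simps add_divide_distrib)
  ultimately show ?thesis using d k(3) unfolding k3_def[symmetric] by simp
qed

text \<open>The mean minimizes the sum of squared distances. It is used with \<open>v = B 0\<close>,
  since distances along the chain are controlled from its starting point.\<close>

lemma sum_norm_sq_mean_le:
  fixes B :: "nat \<Rightarrow> 'a::real_inner"
  assumes N: "0 < N" and mean: "real N *\<^sub>R Bm = (\<Sum>i<N. B i)"
  shows "(\<Sum>j<N. (norm (B j - Bm))\<^sup>2) \<le> (\<Sum>j<N. (norm (B j - v))\<^sup>2)"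
proof -
  have "(\<Sum>j<N. (norm (B j - v))\<^sup>2)
      = (\<Sum>j<N. (norm (B j - Bm))\<^sup>2) + 2 * ((\<Sum>j<N. B j - Bm) \<bullet> (Bm - v)) + real N * (norm (Bm - v))\<^sup>2"
  proof -
    have "(norm (B j - v))\<^sup>2 = (norm (B j - Bm))\<^sup>2 + 2 * ((B j - Bm) \<bullet> (Bm - v)) + (norm (Bm - v))\<^sup>2" for j
      using norm_add_sq[of "B j - Bm" "Bm - v"] by simp
    then show ?thesis
      by (simp add: sum.distrib sum_distrib_left inner_sum_left)
  qed
  moreover have "(\<Sum>j<N. B j - Bm) = 0"
    using mean by (simp add: sum_subtractf sum_constant_scaleR)
  ultimately show ?thesis by simp
qed

text \<open>The expansion is made around the mean \<open>Bm\<close> before any norm is taken, so the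
  linear term averages to \<open>D \<bullet> (A j - B j)\<close>: a random midpoint has no bias, and
  the fluctuation of \<open>B\<close> enters only with the factor \<open>h\<^sup>2\<close>.\<close>

lemma average_expansion:
  fixes A B :: "nat \<Rightarrow> 'a::real_inner"
  assumes N: "0 < N"
  shows "(\<Sum>j<N. (norm (D - h *\<^sub>R A j + (h / real N) *\<^sub>R (\<Sum>i<N. B i)))\<^sup>2)
    \<le> (\<Sum>j<N. (norm D)\<^sup>2 - 2 * h * (D \<bullet> (A j - B j)) + 4 * h\<^sup>2 * (norm (A j - B j))\<^sup>2
        + 4 / 3 * h\<^sup>2 * (norm (B j - B 0))\<^sup>2)"
proof -
  define Bm where "Bm = (1 / real N) *\<^sub>R (\<Sum>i<N. B i)"
  have mean: "real N *\<^sub>R Bm = (\<Sum>i<N. B i)" using N by (simp add: Bm_def)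
  have "(norm (D - h *\<^sub>R A j + (h / real N) *\<^sub>R (\<Sum>i<N. B i)))\<^sup>2
      \<le> (norm D)\<^sup>2 - 2 * h * (D \<bullet> (A j - Bm)) + 4 * h\<^sup>2 * (norm (A j - B j))\<^sup>2 + 4 / 3 * h\<^sup>2 * (norm (B j - Bm))\<^sup>2" for j
  proof -
    \<comment> \<open>The conjugate weights 4 and 4/3. The first must be small enough that
      \<open>4 * h\<^sup>2\<close> leaves most of the negative term \<open>h / M\<close>.\<close>
    have "(norm (A j - Bm))\<^sup>2 \<le> 4 * (norm (A j - B j))\<^sup>2 + 4 / 3 * (norm (B j - Bm))\<^sup>2"
    proof -
      have "(norm (A j - Bm))\<^sup>2 = (norm (A j - B j))\<^sup>2 + 2 * ((A j - B j) \<bullet> (B j - Bm)) + (norm (B j - Bm))\<^sup>2"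
        using norm_add_sq[of "A j - B j" "B j - Bm"] by simp
      moreover have "0 \<le> (norm (3 *\<^sub>R (A j - B j) - (B j - Bm)))\<^sup>2" by simp
      ultimately show ?thesis unfolding norm_diff_sq[of "3 *\<^sub>R (A j - B j)"] by (simp add: power_mult_distrib)
    qed
    then have "h\<^sup>2 * (norm (A j - Bm))\<^sup>2 \<le> h\<^sup>2 * (4 * (norm (A j - B j))\<^sup>2 + 4 / 3 * (norm (B j - Bm))\<^sup>2)"
      by (rule mult_left_mono) simp
    moreover have "D - h *\<^sub>R A j + (h / real N) *\<^sub>R (\<Sum>i<N. B i) = D - h *\<^sub>R (A j - Bm)"
      by (simp add: Bm_def algebra_simps)
    moreover have "(norm (D - h *\<^sub>R (A j - Bm)))\<^sup>2 = (norm D)\<^sup>2 - 2 * h * (D \<bullet> (A j - Bm)) + h\<^sup>2 * (norm (A j - Bm))\<^sup>2"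
      unfolding norm_diff_sq[of D] by (simp add: power_mult_distrib)
    ultimately show ?thesis by (simp add: algebra_simps)
  qed
  then have "(\<Sum>j<N. (norm (D - h *\<^sub>R A j + (h / real N) *\<^sub>R (\<Sum>i<N. B i)))\<^sup>2)
    \<le> (\<Sum>j<N. (norm D)\<^sup>2 - 2 * h * (D \<bullet> (A j - Bm)) + 4 * h\<^sup>2 * (norm (A j - B j))\<^sup>2 + 4 / 3 * h\<^sup>2 * (norm (B j - Bm))\<^sup>2)"
    by (intro sum_mono)
  also have "\<dots> = (\<Sum>j<N. (norm D)\<^sup>2 - 2 * h * (D \<bullet> (A j - B j)) + 4 * h\<^sup>2 * (norm (A j - B j))\<^sup>2)
      + 4 / 3 * h\<^sup>2 * (\<Sum>j<N. (norm (B j - Bm))\<^sup>2)"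
  proof -
    have "(\<Sum>j<N. D \<bullet> (A j - Bm)) = (\<Sum>j<N. D \<bullet> (A j - B j))"
      using arg_cong[OF mean, of "\<lambda>v. D \<bullet> v"] by (simp add: inner_diff_right sum_subtractf inner_sum_right)
    moreover have "(\<Sum>j<N. 2 * h * F j) = 2 * h * (\<Sum>j<N. F j)" "(\<Sum>j<N. 4 / 3 * h\<^sup>2 * F j) = 4 / 3 * h\<^sup>2 * (\<Sum>j<N. F j)"
      for F :: "nat \<Rightarrow> real"
      by (simp_all only: sum_distrib_left)
    ultimately show ?thesis
      by (simp only: sum.distrib sum_subtractf)
  qed
  also have "\<dots> \<le> (\<Sum>j<N. (norm D)\<^sup>2 - 2 * h * (D \<bullet> (A j - B j)) + 4 * h\<^sup>2 * (norm (A j - B j))\<^sup>2)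
      + 4 / 3 * h\<^sup>2 * (\<Sum>j<N. (norm (B j - B 0))\<^sup>2)"
    using sum_norm_sq_mean_le[OF N mean, of "B 0"] by (intro add_left_mono mult_left_mono) auto
  finally show ?thesis
    by (simp add: sum.distrib sum_distrib_left)
qed

lemma sum_fraction_le: "(\<Sum>j<N. real j / real N) \<le> real N / 2"
proof -
  have "2 * (\<Sum>j<N. real j) = real N * (real N - 1)"
    by (induction N) (auto simp: algebra_simps)
  then have "(\<Sum>j<N. real j) \<le> real N * real N / 2"
    by (simp add: algebra_simps)
  then show ?thesis
    by (cases "N = 0") (simp_all add: sum_divide_distrib[symmetric] divide_le_eq algebra_simps)
qed

context potential
begin

text \<open>Probability is reduced to \<open>L^2\<close> norms and the pathwise relation
  \<open>rel\<close>. Here \<open>X\<close>, \<open>W\<close> and \<open>R\<close> stand for chain,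
  walk and residual. The same \<open>W\<close> drives the midpoint \<open>\<theta>'\<close> and the
  chain.\<close>

lemma coupled_average_bound:
  fixes P :: "'w measure" and \<theta> :: "'w \<Rightarrow> 'a" and X W R :: "nat \<Rightarrow> 'w \<Rightarrow> 'a"
  assumes N: "0 < N" and h: "0 < h" "M * h \<le> 9 / 50" and \<rho>: "0 \<le> \<rho>" and p: "0 \<le> p"
    and meas: "\<theta> \<in> borel_measurable P" "\<And>i. X i \<in> borel_measurable P"
    and D: "square_integrable P (\<lambda>\<omega>. \<theta> \<omega> - X 0 \<omega>)"
    and gX: "\<And>i. square_integrable P (\<lambda>\<omega>. g (X i \<omega>))" "\<And>i. l2norm P (\<lambda>\<omega>. g (X i \<omega>)) \<le> sqrt (M * p)"
    and W: "\<And>i. square_integrable P (W i)" "\<And>i. l2norm P (W i) \<le> sqrt (real i * p)"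
    and R: "\<And>i. square_integrable P (R i)" "\<And>i. i < N \<Longrightarrow> l2norm P (R i) \<le> \<rho>"
    and rel: "\<And>i \<omega>. X i \<omega> = X 0 \<omega> - (h / N) *\<^sub>R (\<Sum>k<i. g (X k \<omega>)) + sqrt (2 * (h / N)) *\<^sub>R W i \<omega> + R i \<omega>"
  defines "\<theta>' \<equiv> \<lambda>j \<omega>. \<theta> \<omega> - (h / N * real j) *\<^sub>R g (\<theta> \<omega>) + sqrt (2 * (h / N)) *\<^sub>R W j \<omega>"
  defines "Y \<equiv> \<lambda>j \<omega>. \<theta> \<omega> - X 0 \<omega> - h *\<^sub>R g (\<theta>' j \<omega>) + (h / N) *\<^sub>R (\<Sum>i<N. g (X i \<omega>))"
  shows "\<And>j. square_integrable P (Y j)"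
    and "(\<Sum>j<N. (l2norm P (Y j))\<^sup>2) / real N \<le> (1 - m * h) * (l2norm P (\<lambda>\<omega>. \<theta> \<omega> - X 0 \<omega>))\<^sup>2
      + (1 + \<rho>) * (h * p * (M * h)\<^sup>2 * (25.05 * (M * h) + 2.26)) + 3 * h * M * (\<rho> + \<rho>\<^sup>2)"
proof -
  define a where "a = M * h"
  define \<eta> where "\<eta> = h / N"
  define c where "c = sqrt (M * p)"
  note [measurable] = meas W(1)[THEN square_integrable_measurable]
  have M: "0 < M" by (rule M_pos)
  have \<eta>: "0 < \<eta>" using h N by (simp add: \<eta>_def)
  have lip: "square_integrable P (\<lambda>\<omega>. g (F \<omega>) - g (H \<omega>))"
      "l2norm P (\<lambda>\<omega>. g (F \<omega>) - g (H \<omega>)) \<le> M * l2norm P (\<lambda>\<omega>. F \<omega> - H \<omega>)"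
    if FH: "square_integrable P (\<lambda>\<omega>. F \<omega> - H \<omega>)" and [measurable]: "F \<in> borel_measurable P" "H \<in> borel_measurable P"
    for F H :: "'w \<Rightarrow> 'a"
  proof -
    have m: "(\<lambda>\<omega>. g (F \<omega>) - g (H \<omega>)) \<in> borel_measurable P" by measurable
    have le: "norm (g (F \<omega>) - g (H \<omega>)) \<le> norm (M *\<^sub>R (F \<omega> - H \<omega>))" for \<omega>
      using gradient_lipschitz M by simp
    show "square_integrable P (\<lambda>\<omega>. g (F \<omega>) - g (H \<omega>))"
      "l2norm P (\<lambda>\<omega>. g (F \<omega>) - g (H \<omega>)) \<le> M * l2norm P (\<lambda>\<omega>. F \<omega> - H \<omega>)"
      using square_integrable_bound[OF m square_integrable_scaleR[OF FH, of M] le] M by (simp_all add: l2norm_scaleR)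
  qed
  define G where "G = l2norm P (\<lambda>\<omega>. g (\<theta> \<omega>) - g (X 0 \<omega>))"
  have Gi: "square_integrable P (\<lambda>\<omega>. g (\<theta> \<omega>) - g (X 0 \<omega>))" by (rule lip(1)[OF D]) measurable
  \<comment> \<open>The gradient at \<open>\<theta>\<close> has no bound of its own and is compared
    with the stationary gradient at \<open>X 0\<close>; this is the origin of
    \<open>G + c\<close>.\<close>
  have g\<theta>: "square_integrable P (\<lambda>\<omega>. g (\<theta> \<omega>))" "l2norm P (\<lambda>\<omega>. g (\<theta> \<omega>)) \<le> G + c"
    using square_integrable_add[OF Gi gX(1)[of 0]] l2norm_triangle[OF Gi gX(1)[of 0]] gX(2)[of 0]
    by (simp_all add: G_def c_def)
  have \<theta>'m [measurable]: "\<theta>' j \<in> borel_measurable P" for j unfolding \<theta>'_def by measurable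
  have Xi: "square_integrable P (\<lambda>\<omega>. X j \<omega> - X 0 \<omega>)" for j
  proof -
    have "(\<lambda>\<omega>. X j \<omega> - X 0 \<omega>) = (\<lambda>\<omega>. (sqrt (2 * (h / N)) *\<^sub>R W j \<omega> + R j \<omega>) - (h / N) *\<^sub>R (\<Sum>k<j. g (X k \<omega>)))"
      by (subst rel) (auto simp: algebra_simps)
    then show ?thesis
      by (simp add: square_integrable_diff square_integrable_add square_integrable_scaleR square_integrable_sum W R gX)
  qed
  define r where "r j \<omega> = \<theta> \<omega> - X 0 \<omega> - (\<theta>' j \<omega> - X j \<omega>)" for j \<omega>
  \<comment> \<open>The common noise cancels in \<open>r\<close>, so only drift differences and the
    residual remain. This is why \<open>r\<close> is smaller than the displacements
    \<open>X j - X 0\<close> and \<open>\<theta>' j - \<theta>\<close>, whose order is that of the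
    noise.\<close>
  have r_eq: "r j \<omega> = (\<eta> * real j) *\<^sub>R (g (\<theta> \<omega>) - g (X 0 \<omega>)) - \<eta> *\<^sub>R (\<Sum>k<j. g (X k \<omega>) - g (X 0 \<omega>)) + R j \<omega>" for j \<omega>
    unfolding r_def \<theta>'_def \<eta>_def
    by (subst (2) rel) (simp add: sum_subtractf sum_constant_scaleR algebra_simps)
  have ri: "square_integrable P (r j)" for j
    unfolding r_eq by (intro square_integrable_diff square_integrable_add square_integrable_scaleR square_integrable_sum
        R Gi lip(1)[OF Xi] meas)
  have Ei: "square_integrable P (\<lambda>\<omega>. \<theta>' j \<omega> - X j \<omega>)" for j
    using square_integrable_diff[OF D ri[of j]] by (simp add: r_def)
  have \<Delta>i: "square_integrable P (\<lambda>\<omega>. g (\<theta>' j \<omega>) - g (X j \<omega>))" for j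
    by (rule lip(1)[OF Ei]) measurable
  show Yi: "square_integrable P (Y j)" for j
  proof -
    have "square_integrable P (\<lambda>\<omega>. g (\<theta>' j \<omega>))"
      using square_integrable_add[OF \<Delta>i[of j] gX(1)[of j]] by simp
    then show ?thesis
      unfolding Y_def by (intro square_integrable_diff square_integrable_add square_integrable_scaleR square_integrable_sum D gX)
  qed
  define x where "x j = l2norm P (\<lambda>\<omega>. X j \<omega> - X 0 \<omega>)" for j
  define \<Delta> where "\<Delta> j = l2norm P (\<lambda>\<omega>. g (\<theta>' j \<omega>) - g (X j \<omega>))" for j
  define u where "u j = real j / real N" for j
  define b where "b j = a * u j" for j
  have b_eq: "b j = M * (\<eta> * real j)" for j by (simp add: b_def a_def u_def \<eta>_def)
  have Wb: "M * (sqrt (2 * \<eta>) * sqrt (real j * p)) = sqrt (2 * b j) * c" for j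
  proof -
    have "sqrt (2 * b j) * c = sqrt ((M * M) * ((2 * \<eta>) * (real j * p)))"
      unfolding c_def real_sqrt_mult[symmetric] by (simp add: b_eq mult_ac)
    then show ?thesis
      using M by (simp add: real_sqrt_mult)
  qed
  have W': "l2norm P (\<lambda>\<omega>. sqrt (2 * \<eta>) *\<^sub>R W j \<omega>) \<le> sqrt (2 * \<eta>) * sqrt (real j * p)" for j
    using W(2)[of j] \<eta> by (simp add: l2norm_scaleR mult_left_mono)
  have xb: "M * x j \<le> c * (b j + sqrt (2 * b j)) + M * \<rho>" if "j < N" for j
  proof -
    have "x j = l2norm P (\<lambda>\<omega>. (sqrt (2 * \<eta>) *\<^sub>R W j \<omega> + R j \<omega>) - \<eta> *\<^sub>R (\<Sum>k<j. g (X k \<omega>)))"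
      unfolding x_def \<eta>_def by (subst rel) (simp add: algebra_simps)
    also have "\<dots> \<le> l2norm P (\<lambda>\<omega>. sqrt (2 * \<eta>) *\<^sub>R W j \<omega> + R j \<omega>) + l2norm P (\<lambda>\<omega>. \<eta> *\<^sub>R (\<Sum>k<j. g (X k \<omega>)))"
      by (intro l2norm_triangle_diff square_integrable_add square_integrable_scaleR square_integrable_sum W R gX)
    also have "l2norm P (\<lambda>\<omega>. sqrt (2 * \<eta>) *\<^sub>R W j \<omega> + R j \<omega>) \<le> l2norm P (\<lambda>\<omega>. sqrt (2 * \<eta>) *\<^sub>R W j \<omega>) + l2norm P (R j)"
      by (intro l2norm_triangle square_integrable_scaleR W R)
    also have "l2norm P (\<lambda>\<omega>. \<eta> *\<^sub>R (\<Sum>k<j. g (X k \<omega>))) \<le> \<eta> * (\<Sum>k<j. c)"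
    proof -
      have "l2norm P (\<lambda>\<omega>. \<Sum>k<j. g (X k \<omega>)) \<le> (\<Sum>k<j. l2norm P (\<lambda>\<omega>. g (X k \<omega>)))"
        by (intro l2norm_sum gX) simp
      also have "\<dots> \<le> (\<Sum>k<j. c)" unfolding c_def by (intro sum_mono gX)
      finally show ?thesis using \<eta> by (simp add: l2norm_scaleR)
    qed
    finally have "x j \<le> sqrt (2 * \<eta>) * sqrt (real j * p) + \<rho> + \<eta> * (real j * c)"
      using W'[of j] R(2)[OF that] by simp
    then have "M * x j \<le> M * (sqrt (2 * \<eta>) * sqrt (real j * p) + \<rho> + \<eta> * (real j * c))"
      using M by (intro mult_left_mono) auto
    then show ?thesis
      using Wb[of j] by (simp add: b_eq algebra_simps)
  qed
  have Gb: "G \<le> \<Delta> j + (b j * (G + c) + sqrt (2 * b j) * c) + M * x j" for j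
  proof -
    have t: "square_integrable P (\<lambda>\<omega>. \<theta>' j \<omega> - \<theta> \<omega>)" "l2norm P (\<lambda>\<omega>. \<theta>' j \<omega> - \<theta> \<omega>) \<le> \<eta> * real j * (G + c) + sqrt (2 * \<eta>) * sqrt (real j * p)"
    proof -
      have e: "(\<lambda>\<omega>. \<theta>' j \<omega> - \<theta> \<omega>) = (\<lambda>\<omega>. sqrt (2 * \<eta>) *\<^sub>R W j \<omega> - (\<eta> * real j) *\<^sub>R g (\<theta> \<omega>))"
        by (simp add: \<theta>'_def \<eta>_def)
      show "square_integrable P (\<lambda>\<omega>. \<theta>' j \<omega> - \<theta> \<omega>)"
        unfolding e by (intro square_integrable_diff square_integrable_scaleR W g\<theta>)
      have "l2norm P (\<lambda>\<omega>. \<theta>' j \<omega> - \<theta> \<omega>) \<le> l2norm P (\<lambda>\<omega>. sqrt (2 * \<eta>) *\<^sub>R W j \<omega>) + l2norm P (\<lambda>\<omega>. (\<eta> * real j) *\<^sub>R g (\<theta> \<omega>))"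
        unfolding e by (intro l2norm_triangle_diff square_integrable_scaleR W g\<theta>)
      also have "l2norm P (\<lambda>\<omega>. (\<eta> * real j) *\<^sub>R g (\<theta> \<omega>)) \<le> \<eta> * real j * (G + c)"
        using \<eta> g\<theta>(2) by (simp add: l2norm_scaleR mult_left_mono)
      finally show "l2norm P (\<lambda>\<omega>. \<theta>' j \<omega> - \<theta> \<omega>) \<le> \<eta> * real j * (G + c) + sqrt (2 * \<eta>) * sqrt (real j * p)"
        using W'[of j] by simp
    qed
    \<comment> \<open>The gradient difference at time 0 is reached from the one at time
      \<open>j\<close> by moving each of the two points back.\<close>
    have "G = l2norm P (\<lambda>\<omega>. ((g (\<theta>' j \<omega>) - g (X j \<omega>)) - (g (\<theta>' j \<omega>) - g (\<theta> \<omega>))) + (g (X j \<omega>) - g (X 0 \<omega>)))"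
      by (simp add: G_def)
    also have "\<dots> \<le> l2norm P (\<lambda>\<omega>. (g (\<theta>' j \<omega>) - g (X j \<omega>)) - (g (\<theta>' j \<omega>) - g (\<theta> \<omega>))) + l2norm P (\<lambda>\<omega>. g (X j \<omega>) - g (X 0 \<omega>))"
      by (intro l2norm_triangle square_integrable_diff \<Delta>i lip(1)[OF t(1)] lip(1)[OF Xi] meas \<theta>'m)
    also have "l2norm P (\<lambda>\<omega>. (g (\<theta>' j \<omega>) - g (X j \<omega>)) - (g (\<theta>' j \<omega>) - g (\<theta> \<omega>))) \<le> \<Delta> j + l2norm P (\<lambda>\<omega>. g (\<theta>' j \<omega>) - g (\<theta> \<omega>))"
      unfolding \<Delta>_def by (intro l2norm_triangle_diff \<Delta>i lip(1)[OF t(1)] meas \<theta>'m)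
    also have "l2norm P (\<lambda>\<omega>. g (\<theta>' j \<omega>) - g (\<theta> \<omega>)) \<le> M * (\<eta> * real j * (G + c) + sqrt (2 * \<eta>) * sqrt (real j * p))"
      by (rule order_trans[OF lip(2)[OF t(1) \<theta>'m meas(1)] mult_left_mono[OF t(2)]]) (use M in simp)
    also have "\<dots> = b j * (G + c) + sqrt (2 * b j) * c"
      using Wb[of j] by (simp add: b_eq algebra_simps)
    also have "l2norm P (\<lambda>\<omega>. g (X j \<omega>) - g (X 0 \<omega>)) \<le> M * x j"
      unfolding x_def by (rule lip(2)[OF Xi meas(2) meas(2)])
    finally show ?thesis by simp
  qed
  have b_mono: "b k \<le> b j" if "k \<le> j" for k j
    unfolding b_eq using that M \<eta> by (intro mult_left_mono) auto
  have b_nonneg: "0 \<le> b j" for j using M \<eta> by (simp add: b_eq)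
  have c0: "0 \<le> c" using M p by (simp add: c_def)
  have rb: "M * l2norm P (r j) \<le> b j * G + b j * (c * (b j + sqrt (2 * b j)) + M * \<rho>) + M * \<rho>" if j: "j < N" for j
  proof -
    have "l2norm P (r j) \<le> l2norm P (\<lambda>\<omega>. (\<eta> * real j) *\<^sub>R (g (\<theta> \<omega>) - g (X 0 \<omega>)) - \<eta> *\<^sub>R (\<Sum>k<j. g (X k \<omega>) - g (X 0 \<omega>))) + l2norm P (R j)"
      unfolding r_eq by (intro l2norm_triangle square_integrable_diff square_integrable_scaleR square_integrable_sum
        R Gi lip(1)[OF Xi] meas)
    also have "l2norm P (\<lambda>\<omega>. (\<eta> * real j) *\<^sub>R (g (\<theta> \<omega>) - g (X 0 \<omega>)) - \<eta> *\<^sub>R (\<Sum>k<j. g (X k \<omega>) - g (X 0 \<omega>)))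
        \<le> l2norm P (\<lambda>\<omega>. (\<eta> * real j) *\<^sub>R (g (\<theta> \<omega>) - g (X 0 \<omega>))) + l2norm P (\<lambda>\<omega>. \<eta> *\<^sub>R (\<Sum>k<j. g (X k \<omega>) - g (X 0 \<omega>)))"
      by (intro l2norm_triangle_diff square_integrable_scaleR square_integrable_sum Gi lip(1)[OF Xi] meas)
    also have "l2norm P (\<lambda>\<omega>. (\<eta> * real j) *\<^sub>R (g (\<theta> \<omega>) - g (X 0 \<omega>))) = \<eta> * real j * G"
      using \<eta> by (simp add: l2norm_scaleR G_def)
    also have "l2norm P (\<lambda>\<omega>. \<eta> *\<^sub>R (\<Sum>k<j. g (X k \<omega>) - g (X 0 \<omega>))) \<le> \<eta> * (real j * (c * (b j + sqrt (2 * b j)) + M * \<rho>))"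
    proof -
      have "l2norm P (\<lambda>\<omega>. \<Sum>k<j. g (X k \<omega>) - g (X 0 \<omega>)) \<le> (\<Sum>k<j. l2norm P (\<lambda>\<omega>. g (X k \<omega>) - g (X 0 \<omega>)))"
        by (intro l2norm_sum lip(1)[OF Xi] meas) simp
      also have "\<dots> \<le> (\<Sum>k<j. c * (b j + sqrt (2 * b j)) + M * \<rho>)"
      proof (rule sum_mono)
        fix k assume k: "k \<in> {..<j}"
        have "l2norm P (\<lambda>\<omega>. g (X k \<omega>) - g (X 0 \<omega>)) \<le> M * x k"
          unfolding x_def by (rule lip(2)[OF Xi meas(2) meas(2)])
        also have "\<dots> \<le> c * (b k + sqrt (2 * b k)) + M * \<rho>"
          using k j by (intro xb) simp
        also have "\<dots> \<le> c * (b j + sqrt (2 * b j)) + M * \<rho>"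
          using b_mono[of k j] k c0 by (intro add_right_mono mult_left_mono add_mono) auto
        finally show "l2norm P (\<lambda>\<omega>. g (X k \<omega>) - g (X 0 \<omega>)) \<le> c * (b j + sqrt (2 * b j)) + M * \<rho>" .
      qed
      finally show ?thesis using \<eta> by (simp add: l2norm_scaleR)
    qed
    finally have "l2norm P (r j) \<le> \<eta> * real j * G + \<eta> * (real j * (c * (b j + sqrt (2 * b j)) + M * \<rho>)) + \<rho>"
      using R(2)[OF j] by simp
    then have "M * l2norm P (r j) \<le> M * (\<eta> * real j * G + \<eta> * (real j * (c * (b j + sqrt (2 * b j)) + M * \<rho>)) + \<rho>)"
      using M by (intro mult_left_mono) auto
    also have "\<dots> = b j * G + b j * (c * (b j + sqrt (2 * b j)) + M * \<rho>) + M * \<rho>"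
      unfolding b_eq[of j] by (simp add: algebra_simps)
    finally show ?thesis .
  qed
  let ?Q = "(1 - m * h) * (l2norm P (\<lambda>\<omega>. \<theta> \<omega> - X 0 \<omega>))\<^sup>2" and ?S = "h / M * (3 * M\<^sup>2 * (\<rho> + \<rho>\<^sup>2))" and ?K = "(1 + \<rho>) * c\<^sup>2 * (50.1 * a ^ 3 + 4.52 * a\<^sup>2)"
  let ?V = "\<lambda>j. (M * l2norm P (r j))\<^sup>2 - (1 - 4 * a) * (\<Delta> j)\<^sup>2 + 4 / 3 * a * (M * x j)\<^sup>2"
  have numbers: "?V j
    \<le> ?K * u j + 3 * M\<^sup>2 * (\<rho> + \<rho>\<^sup>2)" if "j < N" for j
    using that h M c0 \<rho> by (intro one_step_numbers[where b = "b j" and G = G] xb Gb rb)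
      (auto simp: u_def b_def a_def x_def \<Delta>_def)
  \<comment> \<open>A combination of four squares, so that its integral consists of exactly the
    norms compared in \<open>one_step_numbers\<close>, up to the factor
    \<open>h / M\<close>.\<close>
  define L where "L j \<omega> = (1 - m * h) * (norm (\<theta> \<omega> - X 0 \<omega>))\<^sup>2 + h * M * (norm (r j \<omega>))\<^sup>2
      - (h / M - 4 * h\<^sup>2) * (norm (g (\<theta>' j \<omega>) - g (X j \<omega>)))\<^sup>2 + 4 / 3 * h\<^sup>2 * M\<^sup>2 * (norm (X j \<omega> - X 0 \<omega>))\<^sup>2" for j \<omega>
  \<comment> \<open>Only the sum over \<open>j\<close> can be bounded: every \<open>Y j\<close>
    contains the mean over the whole chain.\<close>
  have pw: "(\<Sum>j<N. (norm (Y j \<omega>))\<^sup>2) \<le> (\<Sum>j<N. L j \<omega>)" for \<omega>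
  proof -
    let ?D = "\<theta> \<omega> - X 0 \<omega>"
    have "(\<Sum>j<N. (norm (Y j \<omega>))\<^sup>2) \<le> (\<Sum>j<N. (norm ?D)\<^sup>2 - 2 * h * (?D \<bullet> (g (\<theta>' j \<omega>) - g (X j \<omega>)))
        + 4 * h\<^sup>2 * (norm (g (\<theta>' j \<omega>) - g (X j \<omega>)))\<^sup>2 + 4 / 3 * h\<^sup>2 * (norm (g (X j \<omega>) - g (X 0 \<omega>)))\<^sup>2)"
      unfolding Y_def by (rule average_expansion[OF N, where B = "\<lambda>i. g (X i \<omega>)"])
    also have "\<dots> \<le> (\<Sum>j<N. L j \<omega>)"
    proof (rule sum_mono)
      fix j
      have "m * (norm ?D)\<^sup>2 + (norm (g (\<theta>' j \<omega>) - g (X j \<omega>)))\<^sup>2 / M - M * (norm (r j \<omega>))\<^sup>2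
          \<le> 2 * (?D \<bullet> (g (\<theta>' j \<omega>) - g (X j \<omega>)))"
        using perturbed_contraction[of "\<theta>' j \<omega>" "X j \<omega>" "r j \<omega>"] by (simp add: r_def)
      then have "h * (m * (norm ?D)\<^sup>2 + (norm (g (\<theta>' j \<omega>) - g (X j \<omega>)))\<^sup>2 / M - M * (norm (r j \<omega>))\<^sup>2)
          \<le> h * (2 * (?D \<bullet> (g (\<theta>' j \<omega>) - g (X j \<omega>))))"
        using h by (intro mult_left_mono) auto
      moreover have "4 / 3 * h\<^sup>2 * (norm (g (X j \<omega>) - g (X 0 \<omega>)))\<^sup>2 \<le> 4 / 3 * h\<^sup>2 * (M * norm (X j \<omega> - X 0 \<omega>))\<^sup>2"
        using gradient_lipschitz by (intro mult_left_mono power_mono) auto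
      ultimately show "(norm ?D)\<^sup>2 - 2 * h * (?D \<bullet> (g (\<theta>' j \<omega>) - g (X j \<omega>)))
        + 4 * h\<^sup>2 * (norm (g (\<theta>' j \<omega>) - g (X j \<omega>)))\<^sup>2 + 4 / 3 * h\<^sup>2 * (norm (g (X j \<omega>) - g (X 0 \<omega>)))\<^sup>2 \<le> L j \<omega>"
        unfolding L_def power_mult_distrib by (simp add: algebra_simps)
    qed
    finally show ?thesis .
  qed
  note int = Yi[THEN square_integrable_integrable] D[THEN square_integrable_integrable]
    ri[THEN square_integrable_integrable] \<Delta>i[THEN square_integrable_integrable] Xi[THEN square_integrable_integrable]
  have Li: "integrable P (L j)" for j
    unfolding L_def using int by simp
  have LI: "(\<integral>\<omega>. L j \<omega> \<partial>P) = ?Q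
      + h / M * ?V j" for j
  proof -
    have "(\<integral>\<omega>. L j \<omega> \<partial>P) = ?Q + h * M * (l2norm P (r j))\<^sup>2
      - (h / M - 4 * h\<^sup>2) * (\<Delta> j)\<^sup>2 + 4 / 3 * h\<^sup>2 * M\<^sup>2 * (x j)\<^sup>2"
      unfolding L_def \<Delta>_def x_def l2norm_sq using int by simp
    also have "\<dots> = ?Q
      + h / M * ?V j"
      using M by (simp add: a_def power2_eq_square field_simps)
    finally show ?thesis .
  qed
  have "(\<Sum>j<N. (l2norm P (Y j))\<^sup>2) = (\<integral>\<omega>. (\<Sum>j<N. (norm (Y j \<omega>))\<^sup>2) \<partial>P)"
    unfolding l2norm_sq using int(1) by simp
  also have "\<dots> \<le> (\<integral>\<omega>. (\<Sum>j<N. L j \<omega>) \<partial>P)"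
    using int(1) Li pw by (intro integral_mono) auto
  also have "\<dots> = (\<Sum>j<N. \<integral>\<omega>. L j \<omega> \<partial>P)"
    using Li by simp
  also have "\<dots> \<le> (\<Sum>j<N. (?Q + ?S)
      + h / M * (?K) * u j)"
  proof (rule sum_mono)
    have regroup: "v \<le> k * (q * w + q') \<Longrightarrow> z + v \<le> (z + k * q') + k * q * w" for v k q w q' z :: real
      by (simp add: algebra_simps)
    fix j assume "j \<in> {..<N}"
    then have "h / M * ?V j
        \<le> h / M * (?K * u j + 3 * M\<^sup>2 * (\<rho> + \<rho>\<^sup>2))"
      using h M by (intro mult_left_mono numbers) auto
    then show "(\<integral>\<omega>. L j \<omega> \<partial>P) \<le> (?Q + ?S)
      + h / M * (?K) * u j"
      unfolding LI by (rule regroup)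
  qed
  also have "\<dots> = real N * (?Q + ?S)
      + h / M * (?K) * (\<Sum>j<N. u j)"
    by (simp add: sum.distrib sum_distrib_left)
  \<comment> \<open>Averaging \<open>u j\<close> gives at most 1/2, which halves 50.1 and
    4.52.\<close>
  also have "\<dots> \<le> real N * (?Q + ?S)
      + h / M * (?K) * (real N / 2)"
    using h M \<rho> sum_fraction_le[of N] unfolding u_def
    by (intro add_left_mono mult_left_mono) (auto simp: a_def)
  also have "\<dots> = real N * (?Q
      + (1 + \<rho>) * (h * p * a\<^sup>2 * (25.05 * a + 2.26)) + 3 * h * M * (\<rho> + \<rho>\<^sup>2))"
  proof -
    have "c\<^sup>2 = M * p" using M p by (simp add: c_def)
    then have "h / M * (?K) * (real N / 2)
        = real N * ((1 + \<rho>) * (h * p * a\<^sup>2 * (25.05 * a + 2.26)))"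
      using M by (simp add: power2_eq_square power3_eq_cube algebra_simps add_divide_distrib)
    moreover have "?S = 3 * h * M * (\<rho> + \<rho>\<^sup>2)"
      using M by (simp add: power2_eq_square)
    ultimately show ?thesis by (simp only: distrib_left)
  qed
  finally show "(\<Sum>j<N. (l2norm P (Y j))\<^sup>2) / real N \<le> (1 - m * h) * (l2norm P (\<lambda>\<omega>. \<theta> \<omega> - X 0 \<omega>))\<^sup>2
      + (1 + \<rho>) * (h * p * (M * h)\<^sup>2 * (25.05 * (M * h) + 2.26)) + 3 * h * M * (\<rho> + \<rho>\<^sup>2)"
    using N unfolding a_def by (simp add: divide_le_eq mult.commute)
qed

end

section \<open>One step of the randomized midpoint method\<close>

definition transport_cost :: "('a::euclidean_space \<times> 'a) measure \<Rightarrow> ennreal" where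
  "transport_cost \<gamma> = (\<integral>\<^sup>+ (x, y). ennreal ((norm (x - y))\<^sup>2) \<partial>\<gamma>)"

text \<open>The endpoint 1 is excluded because its cell would have the index
  \<open>N\<close>.\<close>

lemma AE_unif01_cell:
  assumes N: "0 < N"
  shows "AE u in unif01. 0 \<le> u \<and> u < 1 \<and> nat \<lfloor>u * real N\<rfloor> < N
    \<and> real (nat \<lfloor>u * real N\<rfloor>) \<le> u * real N \<and> u * real N < real (nat \<lfloor>u * real N\<rfloor>) + 1"
proof -
  have "AE u in unif01. u \<in> {0..1}"
    by (rule AE_uniform_measureI) auto
  moreover have "AE u in unif01. u \<noteq> 1"
    by (rule AE_uniform_measureI) (auto intro: AE_mp[OF AE_lborel_singleton])
  ultimately show ?thesis
  proof eventually_elim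
    case (elim u)
    then have u: "0 \<le> u" "u < 1" by auto
    then have "0 \<le> u * real N" by simp
    then have k: "real (nat \<lfloor>u * real N\<rfloor>) \<le> u * real N" "u * real N < real (nat \<lfloor>u * real N\<rfloor>) + 1"
      by linarith+
    have "u * real N < 1 * real N" using u N by (intro mult_strict_right_mono) auto
    then have "nat \<lfloor>u * real N\<rfloor> < N" using k by linarith
    with u k show ?case by blast
  qed
qed

lemma nn_integral_unif01_floor:
  fixes F :: "nat \<Rightarrow> ennreal"
  assumes N: "0 < N"
  shows "(\<integral>\<^sup>+u. F (nat \<lfloor>u * real N\<rfloor>) \<partial>unif01) = (\<Sum>j<N. F j) * ennreal (1 / real N)"
proof -
  let ?I = "\<lambda>j. {real j / real N..<(real j + 1) / real N}"
  have ae: "AE u in unif01. F (nat \<lfloor>u * real N\<rfloor>) = (\<Sum>j<N. F j * indicator (?I j) u)"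
    using AE_unif01_cell[OF N]
  proof eventually_elim
    case (elim u)
    define k where "k = nat \<lfloor>u * real N\<rfloor>"
    have k: "real k \<le> u * real N" "u * real N < real k + 1" and kN: "k < N"
      using elim by (auto simp: k_def)
    have "indicator (?I j) u = (if j = k then 1 else 0 :: ennreal)" for j
    proof -
      have "u \<in> ?I j \<longleftrightarrow> j = k"
      proof
        assume "u \<in> ?I j"
        then have "real j \<le> u * real N" "u * real N < real j + 1"
          using N by (auto simp: divide_le_eq less_divide_eq)
        then show "j = k" using k by linarith
      next
        assume "j = k"
        then show "u \<in> ?I j" using k N by (auto simp: divide_le_eq less_divide_eq)
      qed
      then show ?thesis by (auto simp: indicator_def)
    qed
    then have "(\<Sum>j<N. F j * indicator (?I j) u) = (\<Sum>j<N. if j = k then F j else 0)"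
      by (intro sum.cong) auto
    also have "\<dots> = F k" using kN by simp
    finally show ?case unfolding k_def[symmetric] by simp
  qed
  have "(\<integral>\<^sup>+u. F (nat \<lfloor>u * real N\<rfloor>) \<partial>unif01) = (\<integral>\<^sup>+u. (\<Sum>j<N. F j * indicator (?I j) u) \<partial>unif01)"
    by (rule nn_integral_cong_AE[OF ae])
  also have "\<dots> = (\<Sum>j<N. F j * emeasure unif01 (?I j))"
    by (subst nn_integral_sum) (auto simp: nn_integral_cmult_indicator)
  also have "\<dots> = (\<Sum>j<N. F j * ennreal (1 / real N))"
  proof (rule sum.cong[OF refl])
    fix j assume "j \<in> {..<N}"
    then have "(real j + 1) / real N \<le> 1" using N by simp
    then have "?I j \<subseteq> {0..1}"
      by (auto intro: order_trans less_imp_le simp: divide_nonneg_nonneg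
          elim!: order_trans[rotated])
    then have "{0..1} \<inter> ?I j = ?I j" by auto
    moreover have "(real j + 1) / real N - real j / real N = 1 / real N"
      by (simp add: diff_divide_distrib[symmetric])
    ultimately show "F j * emeasure unif01 (?I j) = F j * ennreal (1 / real N)"
      by (simp add: divide_right_mono divide_ennreal_def)
  qed
  finally show ?thesis by (simp add: sum_distrib_right)
qed

lemma abs_sqrt_diff_le: "\<bar>sqrt a - sqrt b\<bar> \<le> sqrt \<bar>a - b\<bar>" if "0 \<le> a" "0 \<le> b"
proof -
  have *: "sqrt x \<le> sqrt y + sqrt (x - y)" if "0 \<le> y" "y \<le> x" for x y :: real
    using sqrt_add_le_add_sqrt[of y "x - y"] that by simp
  show ?thesis
    using *[of b a] *[of a b] that by (cases "a \<le> b") (auto simp: abs_if)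
qed

context potential
begin

text \<open>\<^const>\<open>rlmc_step\<close> with \<open>g\<close> in place of the gradient of \<open>f\<close>.\<close>

definition rstep :: "real \<Rightarrow> real \<Rightarrow> 'a \<Rightarrow> 'a \<Rightarrow> 'a \<Rightarrow> 'a" where
  "rstep h u z' z'' x = x - h *\<^sub>R g (x - (h * u) *\<^sub>R g x + sqrt (2 * h * u) *\<^sub>R z')
    + sqrt (2 * h) *\<^sub>R (sqrt u *\<^sub>R z' + sqrt (1 - u) *\<^sub>R z'')"

lemma measurable_rstep [measurable (raw)]:
  assumes [measurable]: "u \<in> borel_measurable N" "z' \<in> borel_measurable N" "z'' \<in> borel_measurable N" "x \<in> borel_measurable N"
  shows "(\<lambda>\<omega>. rstep h (u \<omega>) (z' \<omega>) (z'' \<omega>) (x \<omega>)) \<in> borel_measurable N"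
  unfolding rstep_def by measurable

text \<open>The price of rounding \<open>u\<close> to the grid. The square root is only Hoelder
  continuous of order 1/2, so the error has order \<open>sqrt \<delta>\<close>; this suffices, as
  \<open>\<delta> = 1 / N\<close> tends to 0.\<close>

lemma rstep_diff_le:
  assumes h: "0 < h" and u: "0 \<le> u" "u \<le> 1" and v: "0 \<le> v" "v \<le> 1" and uv: "\<bar>u - v\<bar> \<le> \<delta>"
  shows "norm (rstep h u z' z'' x - rstep h v z' z'' x)
    \<le> h * M * (h * \<delta>) * norm (g x) + (h * M + 1) * sqrt (2 * h * \<delta>) * norm z' + sqrt (2 * h * \<delta>) * norm z''"
proof -
  have \<delta>: "0 \<le> \<delta>" using uv by simp
  define mid where "mid u = x - (h * u) *\<^sub>R g x + sqrt (2 * h * u) *\<^sub>R z'" for u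
  have s: "\<bar>sqrt (2 * h * a) - sqrt (2 * h * b)\<bar> \<le> sqrt (2 * h * \<delta>)" if "0 \<le> a" "0 \<le> b" "\<bar>a - b\<bar> \<le> \<delta>" for a b
  proof -
    have "\<bar>sqrt (2 * h * a) - sqrt (2 * h * b)\<bar> \<le> sqrt \<bar>2 * h * a - 2 * h * b\<bar>"
      using that h by (intro abs_sqrt_diff_le) auto
    also have "\<dots> = sqrt (2 * h * \<bar>a - b\<bar>)"
      using h by (simp add: right_diff_distrib[symmetric] abs_mult)
    also have "\<dots> \<le> sqrt (2 * h * \<delta>)" using that h by (intro real_sqrt_le_mono mult_left_mono) auto
    finally show ?thesis .
  qed
  have "norm (mid v - mid u) = norm ((h * (u - v)) *\<^sub>R g x + (sqrt (2 * h * v) - sqrt (2 * h * u)) *\<^sub>R z')"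
    by (simp add: mid_def algebra_simps)
  also have "\<dots> \<le> \<bar>h * (u - v)\<bar> * norm (g x) + \<bar>sqrt (2 * h * v) - sqrt (2 * h * u)\<bar> * norm z'"
    by (rule order_trans[OF norm_triangle_ineq]) simp
  also have "\<dots> \<le> (h * \<delta>) * norm (g x) + sqrt (2 * h * \<delta>) * norm z'"
    using s[of v u] u v uv h by (intro add_mono mult_right_mono) (auto simp: abs_mult abs_minus_commute)
  finally have mid: "norm (mid v - mid u) \<le> (h * \<delta>) * norm (g x) + sqrt (2 * h * \<delta>) * norm z'" .
  have "rstep h u z' z'' x - rstep h v z' z'' x = h *\<^sub>R (g (mid v) - g (mid u))
      + ((sqrt (2 * h * u) - sqrt (2 * h * v)) *\<^sub>R z' + (sqrt (2 * h * (1 - u)) - sqrt (2 * h * (1 - v))) *\<^sub>R z'')"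
  proof -
    have "rstep h u z' z'' x = x - h *\<^sub>R g (mid u) + (sqrt (2 * h * u) *\<^sub>R z' + sqrt (2 * h * (1 - u)) *\<^sub>R z'')" for u
      unfolding rstep_def mid_def[symmetric] scaleR_add_right scaleR_scaleR real_sqrt_mult[symmetric] by (rule refl)
    then show ?thesis
      by (simp add: scaleR_diff_left scaleR_diff_right)
  qed
  also have "norm \<dots> \<le> h * norm (g (mid v) - g (mid u)) + (\<bar>sqrt (2 * h * u) - sqrt (2 * h * v)\<bar> * norm z'
      + \<bar>sqrt (2 * h * (1 - u)) - sqrt (2 * h * (1 - v))\<bar> * norm z'')"
    using h by (intro order_trans[OF norm_triangle_ineq] add_mono) (auto intro: order_trans[OF norm_triangle_ineq])
  also have "\<dots> \<le> h * (M * ((h * \<delta>) * norm (g x) + sqrt (2 * h * \<delta>) * norm z'))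
      + (sqrt (2 * h * \<delta>) * norm z' + sqrt (2 * h * \<delta>) * norm z'')"
  proof (intro add_mono mult_left_mono mult_right_mono)
    show "norm (g (mid v) - g (mid u)) \<le> M * (h * \<delta> * norm (g x) + sqrt (2 * h * \<delta>) * norm z')"
      using order_trans[OF gradient_lipschitz mult_left_mono[OF mid]] M_pos by simp
  qed (use s u v uv h in auto)
  finally show ?thesis by (simp add: algebra_simps)
qed

text \<open>At the grid time \<open>j / N\<close> the two Gaussian inputs are the normalized walks
  before and after \<open>j\<close>, so midpoint and full step use the increments that drive the
  chain. At \<open>j = 0\<close> there is nothing to normalize: a spare Gaussian
  \<open>\<zeta>\<close> preserves the law of \<open>z'\<close>, and its coefficient is
  \<open>sqrt 0\<close>.\<close>

lemma rstep_grid: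
  assumes N: "0 < N" "j < N" and h: "0 < h"
  shows "rstep h (real j / real N) (if j = 0 then \<zeta> else (1 / sqrt (real j)) *\<^sub>R w') ((1 / sqrt (real (N - j))) *\<^sub>R w'') x
    = x - h *\<^sub>R g (x - (h / N * real j) *\<^sub>R g x + sqrt (2 * (h / N)) *\<^sub>R (if j = 0 then 0 else w'))
      + sqrt (2 * (h / N)) *\<^sub>R ((if j = 0 then 0 else w') + w'')"
proof -
  define z' where "z' = (if j = 0 then \<zeta> else (1 / sqrt (real j)) *\<^sub>R w')"
  define v where "v = (if j = 0 then 0 else w')"
  have 1: "sqrt (real j) *\<^sub>R z' = v" by (simp add: z'_def v_def)
  have 2: "sqrt (real (N - j)) *\<^sub>R (1 / sqrt (real (N - j))) *\<^sub>R w'' = w''" using N by simp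
  have 3: "sqrt (2 * h * (real j / real N)) *\<^sub>R z' = sqrt (2 * (h / N)) *\<^sub>R v"
    unfolding 1[symmetric] by (simp add: real_sqrt_mult[symmetric])
  have 4: "1 - real j / real N = real (N - j) / real N" using N by (simp add: of_nat_diff field_simps)
  have 5: "sqrt (2 * h) *\<^sub>R (sqrt (real j / real N) *\<^sub>R z' + sqrt (1 - real j / real N) *\<^sub>R (1 / sqrt (real (N - j))) *\<^sub>R w'')
      = sqrt (2 * (h / N)) *\<^sub>R (sqrt (real j) *\<^sub>R z' + sqrt (real (N - j)) *\<^sub>R (1 / sqrt (real (N - j))) *\<^sub>R w'')"
    unfolding 4 scaleR_add_right scaleR_scaleR by (simp add: real_sqrt_mult real_sqrt_divide)
  show ?thesis
    unfolding rstep_def z'_def[symmetric] v_def[symmetric] 5 1 2 3 by simp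
qed

end

section \<open>Coupling a midpoint step with the stationary chain\<close>

lemma measurable_compose3:
  assumes "(\<lambda>(x, y, z). H x y z) \<in> A \<Otimes>\<^sub>M B \<Otimes>\<^sub>M C \<rightarrow>\<^sub>M D"
    and [measurable]: "X \<in> N \<rightarrow>\<^sub>M A" "Y \<in> N \<rightarrow>\<^sub>M B" "Z \<in> N \<rightarrow>\<^sub>M C"
  shows "(\<lambda>w. H (X w) (Y w) (Z w)) \<in> N \<rightarrow>\<^sub>M D"
  using measurable_compose[OF _ assms(1), of "\<lambda>w. (X w, Y w, Z w)" N] by simp

text \<open>The coupled starting pair \<open>(\<theta>, X 0)\<close>, the spare Gaussian for
  \<open>j = 0\<close>, and the noise stream of the chain.\<close>

type_synonym 'a path = "('a \<times> 'a) \<times> 'a \<times> ('a \<times> real) stream"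

text \<open>Increments before and after \<open>j\<close> are independent. By \<open>j < N\<close>
  the second walk has at least one increment to normalize.\<close>

lemma nn_integral_normalized_walks:
  fixes K :: "'a::euclidean_space \<Rightarrow> 'a \<Rightarrow> ennreal"
  assumes K: "(\<lambda>(z, w). K z w) \<in> borel_measurable (borel \<Otimes>\<^sub>M borel)" and j: "j < N"
  shows "(\<integral>\<^sup>+\<zeta>. \<integral>\<^sup>+\<omega>. K (if j = 0 then \<zeta> else (1 / sqrt (real j)) *\<^sub>R walk j \<omega>)
      ((1 / sqrt (real (N - j))) *\<^sub>R walk (N - j) (sdrop j \<omega>)) \<partial>noise_stream \<partial>std_gaussian)
    = (\<integral>\<^sup>+z'. \<integral>\<^sup>+z''. K z' z'' \<partial>std_gaussian \<partial>std_gaussian)"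
proof -
  note [measurable] = K
  interpret G: prob_space "std_gaussian :: 'a measure" by (rule prob_space_std_gaussian)
  interpret S: prob_space "noise_stream :: ('a \<times> real) stream measure" by (rule prob_space_noise_stream)
  have last: "(\<integral>\<^sup>+\<omega>. K z ((1 / sqrt (real k)) *\<^sub>R walk k \<omega>) \<partial>noise_stream) = (\<integral>\<^sup>+w. K z w \<partial>std_gaussian)"
    if "0 < k" for z k
    using nn_integral_walk[of "\<lambda>y \<omega>. K z ((1 / sqrt (real k)) *\<^sub>R y)" k] that S.emeasure_space_1 by simp
  show ?thesis
  proof (cases "j = 0")
    case True
    then show ?thesis using last[of N] j by simp
  next
    case False
    have "(\<integral>\<^sup>+\<omega>. K ((1 / sqrt (real j)) *\<^sub>R walk j \<omega>)
        ((1 / sqrt (real (N - j))) *\<^sub>R walk (N - j) (sdrop j \<omega>)) \<partial>noise_stream)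
      = (\<integral>\<^sup>+z. \<integral>\<^sup>+\<omega>. K z ((1 / sqrt (real (N - j))) *\<^sub>R walk (N - j) \<omega>) \<partial>noise_stream \<partial>std_gaussian)"
      using nn_integral_walk[of "\<lambda>y \<omega>. K ((1 / sqrt (real j)) *\<^sub>R y) ((1 / sqrt (real (N - j))) *\<^sub>R walk (N - j) \<omega>)" j] False
      by simp
    then show ?thesis
      using False last[of "N - j"] j G.emeasure_space_1 by simp
  qed
qed

context potential
begin

text \<open>For every \<open>n\<close> a coupling \<open>\<kappa>\<close> of the two target laws is
  built from \<open>Suc n\<close> chain steps, at a cost of at most \<open>bound n\<close>. The
  infimum on the left does not depend on \<open>n\<close>, so the couplings need not converge;
  \<open>bound\<close> does, and its limit is the claim.\<close>

lemma rstep_transport_cost: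
  assumes h: "0 < h" "M * h \<le> 9 / 50" and \<gamma>: "\<gamma> \<in> couplings \<mu> (gibbs f)"
    and sets_\<nu>: "sets \<nu> = sets borel"
    and law: "\<And>F. F \<in> borel_measurable borel \<Longrightarrow> (\<integral>\<^sup>+y. F y \<partial>\<nu>)
      = (\<integral>\<^sup>+u. \<integral>\<^sup>+x. \<integral>\<^sup>+z'. \<integral>\<^sup>+z''. F (rstep h u z' z'' x) \<partial>std_gaussian \<partial>std_gaussian \<partial>\<mu> \<partial>unif01)"
    and C: "transport_cost \<gamma> = ennreal C" "0 \<le> C"
  shows "(INF \<gamma>\<in>couplings \<nu> (gibbs f). transport_cost \<gamma>)
    \<le> ennreal ((1 - m * h) * C + h * DIM('a) * (M * h)\<^sup>2 * (25.05 * (M * h) + 2.26))"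
proof -
  define p where "p = real DIM('a)"
  have p: "0 \<le> p" by (simp add: p_def)
  have M: "0 < M" by (rule M_pos)
  define P where "P = \<gamma> \<Otimes>\<^sub>M ((std_gaussian :: 'a measure) \<Otimes>\<^sub>M (noise_stream :: ('a \<times> real) stream measure))"
  have sets_\<gamma> [measurable_cong]: "sets \<gamma> = sets (borel \<Otimes>\<^sub>M borel)"
    and \<gamma>1: "distr \<gamma> borel fst = \<mu>" and \<gamma>2: "distr \<gamma> borel snd = gibbs f"
    using \<gamma> by (auto simp: couplings_def)
  have sets_P [measurable_cong]:
    "sets P = sets ((borel \<Otimes>\<^sub>M borel) \<Otimes>\<^sub>M ((borel :: 'a measure) \<Otimes>\<^sub>M (noise_stream :: ('a \<times> real) stream measure)))"
    unfolding P_def by (intro sets_pair_measure_cong sets_\<gamma> sets_std_gaussian refl)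
  \<comment> \<open>Couplings are specified by their marginals only, and the second one fixes the
    total mass.\<close>
  interpret \<gamma>: prob_space \<gamma>
    by (rule prob_space_distrD[of snd \<gamma> borel]) (use \<gamma>2 prob_space_gibbs in auto)
  interpret G: prob_space "std_gaussian :: 'a measure" by (rule prob_space_std_gaussian)
  interpret S: prob_space "noise_stream :: ('a \<times> real) stream measure" by (rule prob_space_noise_stream)
  interpret U: prob_space unif01 by (rule prob_space_unif01)
  interpret GS: prob_space "(std_gaussian :: 'a measure) \<Otimes>\<^sub>M (noise_stream :: ('a \<times> real) stream measure)"
    by (intro prob_space_pair prob_space_std_gaussian prob_space_noise_stream)
  interpret P: prob_space P
    unfolding P_def by (intro prob_space_pair \<gamma>.prob_space_axioms GS.prob_space_axioms)
  have sets_\<mu> [measurable_cong]: "sets \<mu> = sets borel" using \<gamma>1 by auto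
  have int_P: "(\<integral>\<^sup>+w. F w \<partial>P) = (\<integral>\<^sup>+c. \<integral>\<^sup>+\<zeta>. \<integral>\<^sup>+\<omega>. F (c, \<zeta>, \<omega>) \<partial>noise_stream \<partial>std_gaussian \<partial>\<gamma>)"
    if F: "F \<in> borel_measurable P" for F
  proof -
    have [measurable]: "F \<in> borel_measurable (\<gamma> \<Otimes>\<^sub>M (std_gaussian \<Otimes>\<^sub>M noise_stream))"
      using F by (simp add: P_def)
    have "(\<integral>\<^sup>+w. F w \<partial>P) = (\<integral>\<^sup>+c. \<integral>\<^sup>+y. F (c, y) \<partial>(std_gaussian \<Otimes>\<^sub>M noise_stream) \<partial>\<gamma>)"
      unfolding P_def by (simp add: GS.nn_integral_fst)
    also have "\<dots> = (\<integral>\<^sup>+c. \<integral>\<^sup>+\<zeta>. \<integral>\<^sup>+\<omega>. F (c, \<zeta>, \<omega>) \<partial>noise_stream \<partial>std_gaussian \<partial>\<gamma>)"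
    proof (rule nn_integral_cong)
      fix c assume c: "c \<in> space \<gamma>"
      have "(\<lambda>y. F (c, y)) \<in> borel_measurable (std_gaussian \<Otimes>\<^sub>M noise_stream)"
        by (rule measurable_compose[OF measurable_Pair1'[OF c]]) measurable
      from S.nn_integral_fst[OF this]
      show "(\<integral>\<^sup>+y. F (c, y) \<partial>(std_gaussian \<Otimes>\<^sub>M noise_stream)) = (\<integral>\<^sup>+\<zeta>. \<integral>\<^sup>+\<omega>. F (c, \<zeta>, \<omega>) \<partial>noise_stream \<partial>std_gaussian)"
        by simp
    qed
    finally show ?thesis .
  qed
  have law_X: "(\<integral>\<^sup>+w. H (snd (fst w)) (snd (snd w)) \<partial>P) = (\<integral>\<^sup>+x. \<integral>\<^sup>+\<omega>. H x \<omega> \<partial>noise_stream \<partial>gibbs f)"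
    if [measurable]: "(\<lambda>(x, \<omega>). H x \<omega>) \<in> borel_measurable (borel \<Otimes>\<^sub>M noise_stream)" for H
  proof -
    have "(\<integral>\<^sup>+w. H (snd (fst w)) (snd (snd w)) \<partial>P) = (\<integral>\<^sup>+c. \<integral>\<^sup>+\<omega>. H (snd c) \<omega> \<partial>noise_stream \<partial>\<gamma>)"
      using G.emeasure_space_1 by (subst int_P) auto
    also have "\<dots> = (\<integral>\<^sup>+x. \<integral>\<^sup>+\<omega>. H x \<omega> \<partial>noise_stream \<partial>distr \<gamma> borel snd)"
      by (subst nn_integral_distr) auto
    finally show ?thesis unfolding \<gamma>2 .
  qed
  have law_\<theta>: "(\<integral>\<^sup>+w. H (fst (fst w)) (fst (snd w)) (snd (snd w)) \<partial>P)
      = (\<integral>\<^sup>+x. \<integral>\<^sup>+\<zeta>. \<integral>\<^sup>+\<omega>. H x \<zeta> \<omega> \<partial>noise_stream \<partial>std_gaussian \<partial>\<mu>)"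
    if H: "(\<lambda>(x, \<zeta>, \<omega>). H x \<zeta> \<omega>) \<in> borel_measurable (borel \<Otimes>\<^sub>M borel \<Otimes>\<^sub>M noise_stream)" for H
  proof -
    note [measurable (raw)] = measurable_compose3[OF H]
    have "(\<integral>\<^sup>+w. H (fst (fst w)) (fst (snd w)) (snd (snd w)) \<partial>P) = (\<integral>\<^sup>+c. \<integral>\<^sup>+\<zeta>. \<integral>\<^sup>+\<omega>. H (fst c) \<zeta> \<omega> \<partial>noise_stream \<partial>std_gaussian \<partial>\<gamma>)"
      by (subst int_P) auto
    also have "\<dots> = (\<integral>\<^sup>+x. \<integral>\<^sup>+\<zeta>. \<integral>\<^sup>+\<omega>. H x \<zeta> \<omega> \<partial>noise_stream \<partial>std_gaussian \<partial>distr \<gamma> borel fst)"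
      by (subst nn_integral_distr) auto
    finally show ?thesis unfolding \<gamma>1 .
  qed
  define \<theta> where "\<theta> w = fst (fst w)" for w :: "'a path"
  define W where "W i w = walk i (snd (snd w))" for i and w :: "'a path"
  have [measurable]: "\<theta> \<in> borel_measurable P" "W i \<in> borel_measurable P" for i
    unfolding \<theta>_def W_def by measurable
  have W: "square_integrable P (W i)" "l2norm P (W i) \<le> sqrt (real i * p)" for i
  proof -
    have "(\<integral>\<^sup>+w. ennreal ((norm (W i w))\<^sup>2) \<partial>P) = (\<integral>\<^sup>+\<omega>. ennreal ((norm (walk i \<omega> :: 'a))\<^sup>2) \<partial>noise_stream)"
      using law_X[of "\<lambda>x \<omega>. ennreal ((norm (walk i \<omega>))\<^sup>2)"] prob_space.emeasure_space_1[OF prob_space_gibbs]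
      by (simp add: W_def)
    also have "\<dots> = (\<integral>\<^sup>+z. ennreal ((norm (sqrt (real i) *\<^sub>R z :: 'a))\<^sup>2) \<partial>std_gaussian)"
      using nn_integral_walk[of "\<lambda>z \<omega>. ennreal ((norm (z :: 'a))\<^sup>2)" i] S.emeasure_space_1 by simp
    also have "\<dots> = (\<integral>\<^sup>+z. ennreal (real i) * ennreal ((norm (z :: 'a))\<^sup>2) \<partial>std_gaussian)"
      by (simp add: power_mult_distrib ennreal_mult')
    also have "\<dots> = ennreal (real i * p)"
      by (subst nn_integral_cmult)
        (auto simp: nn_integral_std_gaussian_norm_sq p_def ennreal_mult' ennreal_of_nat_eq_real_of_nat)
    finally have e: "(\<integral>\<^sup>+w. ennreal ((norm (W i w))\<^sup>2) \<partial>P) \<le> ennreal (real i * p)" by simp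
    show "square_integrable P (W i)" "l2norm P (W i) \<le> sqrt (real i * p)"
      using square_integrable_nn_integral[OF _ e] p by auto
  qed
  have D: "square_integrable P (\<lambda>w. \<theta> w - snd (fst w))" "(l2norm P (\<lambda>w. \<theta> w - snd (fst w)))\<^sup>2 = C"
  proof -
    have "(\<integral>\<^sup>+w. ennreal ((norm (\<theta> w - snd (fst w)))\<^sup>2) \<partial>P) = (\<integral>\<^sup>+c. ennreal ((norm (fst c - snd c))\<^sup>2) \<partial>\<gamma>)"
      using G.emeasure_space_1 S.emeasure_space_1 by (subst int_P) (auto simp: \<theta>_def)
    also have "\<dots> = ennreal C"
      using C by (simp add: transport_cost_def case_prod_unfold)
    finally have e: "(\<integral>\<^sup>+w. ennreal ((norm (\<theta> w - snd (fst w)))\<^sup>2) \<partial>P) = ennreal C" .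
    show 1: "square_integrable P (\<lambda>w. \<theta> w - snd (fst w))"
      by (rule square_integrable_nn_integral(1)[where c = C]) (use e C in auto)
    show "(l2norm P (\<lambda>w. \<theta> w - snd (fst w)))\<^sup>2 = C"
      using e C unfolding nn_integral_norm_sq[OF 1] by simp
  qed
  have gX0: "square_integrable P (\<lambda>w. g (snd (fst w)))"
  proof -
    have "(\<integral>\<^sup>+w. ennreal ((norm (g (snd (fst w))))\<^sup>2) \<partial>P) = ennreal ((l2norm (gibbs f) g)\<^sup>2)"
      using law_X[of "\<lambda>x \<omega>. ennreal ((norm (g x))\<^sup>2)"] S.emeasure_space_1
      by (simp add: nn_integral_norm_sq[OF square_integrable_gibbs(2)])
    then show ?thesis by (intro square_integrable_nn_integral(1)[where c = "(l2norm (gibbs f) g)\<^sup>2"]) auto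
  qed
  \<comment> \<open>No moment of \<open>\<mu>\<close> is given: integrability comes from the finite
    cost of \<open>\<gamma>\<close> and from the stationary gradient.\<close>
  have g\<theta>: "square_integrable P (\<lambda>w. g (\<theta> w))"
  proof -
    have "square_integrable P (\<lambda>w. g (\<theta> w) - g (snd (fst w)))"
      by (rule square_integrable_bound(1)[OF _ square_integrable_scaleR[OF D(1), of M]])
        (use gradient_lipschitz M in auto)
    from square_integrable_add[OF this gX0] show ?thesis by simp
  qed
  define Gn where "Gn = l2norm P (\<lambda>w. g (\<theta> w))"
  define \<eta> where "\<eta> n = h / real (Suc n)" for n
  have \<eta>: "0 < \<eta> n" "\<eta> n \<le> h" for n using h by (auto simp: \<eta>_def field_simps)
  have \<eta>0: "\<eta> \<longlonglongrightarrow> 0"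
    unfolding \<eta>_def using tendsto_mult_right_zero[OF LIMSEQ_inverse_real_of_nat, of h]
    by (simp add: divide_inverse)
  obtain \<epsilon> :: "nat \<Rightarrow> real" where \<epsilon>: "\<And>n. 0 \<le> \<epsilon> n" "\<epsilon> \<longlonglongrightarrow> 0"
    "\<And>n. (\<integral>\<^sup>+x. \<integral>\<^sup>+s. ennreal ((norm (mala (\<eta> n) x s - proposal (\<eta> n) x (fst s)))\<^sup>2) \<partial>noise \<partial>gibbs f)
      \<le> ennreal ((\<eta> n * \<epsilon> n)\<^sup>2)"
    using mala_error_rate[OF \<eta> \<eta>0] by blast
  define \<rho> where "\<rho> n = h * \<epsilon> n" for n
  \<comment> \<open>The bound of \<open>rstep_diff_le\<close> in \<open>L^2\<close> norms with
    \<open>\<delta> = 1 / Suc n\<close>, for which \<open>h * \<delta> = \<eta> n\<close>;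
    \<open>\<rho> n\<close> bounds the residual of up to \<open>Suc n\<close> steps.\<close>
  define \<sigma> where "\<sigma> n = h * M * \<eta> n * Gn + (h * M + 1) * sqrt (2 * \<eta> n) * sqrt p + sqrt (2 * \<eta> n) * sqrt p" for n
  define s where "s n = \<rho> n + \<sigma> n" for n
  have nonneg: "0 \<le> \<rho> n" "0 \<le> \<sigma> n" "0 \<le> s n" for n
    using \<epsilon>(1)[of n] \<eta>(1)[of n] h M p by (auto simp: \<rho>_def \<sigma>_def s_def Gn_def)
  define \<Phi> where "\<Phi> n = (1 - m * h) * C + (1 + \<rho> n) * (h * p * (M * h)\<^sup>2 * (25.05 * (M * h) + 2.26))
      + 3 * h * M * (\<rho> n + (\<rho> n)\<^sup>2)" for n
  \<comment> \<open>The result of \<open>sq_add_le\<close> with \<open>c = 1\<close> when the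
    \<open>L^2\<close> error \<open>s n\<close> is added to \<open>Y\<close>.\<close>
  define bound where "bound n = (1 + s n) * \<Phi> n + (s n + (s n)\<^sup>2)" for n
  have key: "(INF \<gamma>\<in>couplings \<nu> (gibbs f). transport_cost \<gamma>) \<le> ennreal (bound n)" for n
  proof -
    define N where "N = Suc n"
    have N: "0 < N" by (simp add: N_def)
    have \<eta>N: "\<eta> n = h / real N" by (simp add: \<eta>_def N_def)
    define X where "X i w = chain (\<eta> n) i (snd (fst w)) (snd (snd w))" for i and w :: "'a path"
    define R where "R i w = residual (\<eta> n) i (snd (fst w)) (snd (snd w))" for i and w :: "'a path"
    have Xm [measurable]: "X i \<in> borel_measurable P" for i unfolding X_def by measurable
    define e where "e i w = mala (\<eta> n) (X i w) (snd (snd w) !! i) - proposal (\<eta> n) (X i w) (fst (snd (snd w) !! i))"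
      for i and w :: "'a path"
    have noise_id: "(\<lambda>x. x) \<in> borel_measurable noise" by (simp add: measurable_cong_sets[OF sets_noise refl])
    have em: "(\<lambda>w. mala (\<eta> n) (Y w) (s w) - proposal (\<eta> n) (Y w) (fst (s w))) \<in> borel_measurable Q"
      if [measurable]: "Y \<in> borel_measurable Q" "s \<in> Q \<rightarrow>\<^sub>M noise" for Y s and Q :: "'q measure"
    proof -
      have [measurable]: "s \<in> borel_measurable Q"
        using measurable_compose[OF that(2) noise_id] by simp
      show ?thesis by measurable
    qed
    have e: "square_integrable P (e i)" "l2norm P (e i) \<le> \<eta> n * \<epsilon> n" for i
    proof -
      have "(\<integral>\<^sup>+w. ennreal ((norm (e i w))\<^sup>2) \<partial>P) = (\<integral>\<^sup>+x. \<integral>\<^sup>+\<omega>. ennreal ((norm (mala (\<eta> n) (chain (\<eta> n) i x \<omega>) (\<omega> !! i)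
          - proposal (\<eta> n) (chain (\<eta> n) i x \<omega>) (fst (\<omega> !! i))))\<^sup>2) \<partial>noise_stream \<partial>gibbs f)"
        unfolding e_def X_def by (rule law_X) (use em in measurable)
      also have "\<dots> = (\<integral>\<^sup>+x. \<integral>\<^sup>+s. ennreal ((norm (mala (\<eta> n) x s - proposal (\<eta> n) x (fst s)))\<^sup>2) \<partial>noise \<partial>gibbs f)"
        by (rule nn_integral_chain[OF \<eta>(1)]) (use em in measurable)
      also have "\<dots> \<le> ennreal ((\<eta> n * \<epsilon> n)\<^sup>2)" by (rule \<epsilon>(3))
      finally have *: "(\<integral>\<^sup>+w. ennreal ((norm (e i w))\<^sup>2) \<partial>P) \<le> ennreal ((\<eta> n * \<epsilon> n)\<^sup>2)" .
      have "e i \<in> borel_measurable P" unfolding e_def by (rule em) measurable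
      from square_integrable_nn_integral[OF this *]
      show "square_integrable P (e i)" "l2norm P (e i) \<le> \<eta> n * \<epsilon> n"
        using \<eta>(1)[of n] \<epsilon>(1)[of n] by (auto simp: real_sqrt_mult)
    qed
    have R_eq: "R i = (\<lambda>w. \<Sum>k<i. e k w)" for i
      by (rule ext) (simp add: R_def residual_def e_def X_def)
    have R: "square_integrable P (R i)" for i
      unfolding R_eq by (intro square_integrable_sum e)
    \<comment> \<open>The index \<open>i = N\<close> is included: \<open>R N\<close> belongs to the
      endpoint of the chain.\<close>
    have Rn: "l2norm P (R i) \<le> \<rho> n" if "i \<le> N" for i
    proof -
      have "l2norm P (R i) \<le> (\<Sum>k<i. l2norm P (e k))"
        unfolding R_eq by (intro l2norm_sum e) simp
      also have "\<dots> \<le> (\<Sum>k<i. \<eta> n * \<epsilon> n)" by (intro sum_mono e)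
      also have "\<dots> = real i * (\<eta> n * \<epsilon> n)" by simp
      also have "\<dots> \<le> real N * (\<eta> n * \<epsilon> n)"
        using that \<eta>(1)[of n] \<epsilon>(1)[of n] by (intro mult_right_mono) auto
      also have "\<dots> = \<rho> n" using N by (simp add: \<eta>N \<rho>_def)
      finally show ?thesis .
    qed
    have gX: "square_integrable P (\<lambda>w. g (X i w))" "l2norm P (\<lambda>w. g (X i w)) \<le> sqrt (M * p)" for i
    proof -
      have "(\<integral>\<^sup>+w. ennreal ((norm (g (X i w)))\<^sup>2) \<partial>P)
          = (\<integral>\<^sup>+x. \<integral>\<^sup>+\<omega>. ennreal ((norm (g (chain (\<eta> n) i x \<omega>)))\<^sup>2) \<partial>noise_stream \<partial>gibbs f)"
        unfolding X_def by (rule law_X) measurable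
      also have "\<dots> = ennreal ((l2norm (gibbs f) g)\<^sup>2)"
        using nn_integral_chain[OF \<eta>(1), of "\<lambda>y s. ennreal ((norm (g y))\<^sup>2)" n i]
          prob_space.emeasure_space_1[OF prob_space_noise[where 'a='a]]
        by (simp add: nn_integral_norm_sq[OF square_integrable_gibbs(2)])
      also have "\<dots> \<le> ennreal (M * p)"
        using power_mono[OF l2norm_gibbs_gradient, of 2] M by (simp add: p_def ennreal_leI)
      finally have *: "(\<integral>\<^sup>+w. ennreal ((norm (g (X i w)))\<^sup>2) \<partial>P) \<le> ennreal (M * p)" .
      show "square_integrable P (\<lambda>w. g (X i w))" "l2norm P (\<lambda>w. g (X i w)) \<le> sqrt (M * p)"
        using square_integrable_nn_integral[OF _ *] M p by auto
    qed
    have X0: "X 0 w = snd (fst w)" for w by (simp add: X_def)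
    have rel: "X i w = X 0 w - (h / N) *\<^sub>R (\<Sum>k<i. g (X k w)) + sqrt (2 * (h / N)) *\<^sub>R W i w + R i w" for i w
      unfolding X_def W_def R_def \<eta>N[symmetric] chain.simps(1) by (rule chain_decomposition)
    have D0: "square_integrable P (\<lambda>w. \<theta> w - X 0 w)" using D(1) by (simp add: X0)
    have Rn': "l2norm P (R i) \<le> \<rho> n" if "i < N" for i using Rn that by simp
    have \<theta>m: "\<theta> \<in> borel_measurable P" by measurable
    note coupled = coupled_average_bound[OF N h nonneg(1) p \<theta>m Xm D0 gX W R Rn' rel]
    define \<theta>' where "\<theta>' j w = \<theta> w - (h / N * real j) *\<^sub>R g (\<theta> w) + sqrt (2 * (h / N)) *\<^sub>R W j w" for j w
    define Y where "Y j w = \<theta> w - X 0 w - h *\<^sub>R g (\<theta>' j w) + (h / N) *\<^sub>R (\<Sum>i<N. g (X i w))" for j w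
    have Y: "square_integrable P (Y j)" for j
      unfolding Y_def \<theta>'_def
      by (rule coupled(1))
    have Yb: "(\<Sum>j<N. (l2norm P (Y j))\<^sup>2) / real N \<le> \<Phi> n"
    proof -
      have "(\<Sum>j<N. (l2norm P (Y j))\<^sup>2) / real N \<le> (1 - m * h) * (l2norm P (\<lambda>\<omega>. \<theta> \<omega> - X 0 \<omega>))\<^sup>2
        + (1 + \<rho> n) * (h * p * (M * h)\<^sup>2 * (25.05 * (M * h) + 2.26)) + 3 * h * M * (\<rho> n + (\<rho> n)\<^sup>2)"
        unfolding Y_def \<theta>'_def
        by (rule coupled(2))
      then show ?thesis unfolding X0 D(2) \<Phi>_def .
    qed
    \<comment> \<open>The minimum keeps the index below \<open>N\<close> for every \<open>u\<close>,
      including \<open>u = 1\<close> and values outside the unit interval, so \<open>law_z\<close>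
      applies without exceptional sets.\<close>
    define J where "J u = min (nat \<lfloor>u * real N\<rfloor>) (N - 1)" for u :: real
    have J: "J u < N" for u using N by (simp add: J_def)
    define z' where "z' j w = (if j = 0 then fst (snd w) else (1 / sqrt (real j)) *\<^sub>R walk j (snd (snd w)))"
      for j and w :: "'a path"
    define z'' where "z'' j w = (1 / sqrt (real (N - j))) *\<^sub>R walk (N - j) (sdrop j (snd (snd w)))"
      for j and w :: "'a path"
    have z_meas [measurable]: "z' j \<in> borel_measurable P" "z'' j \<in> borel_measurable P" for j
      unfolding z'_def z''_def by measurable
    have law_z: "(\<integral>\<^sup>+w. H (\<theta> w) (z' j w) (z'' j w) \<partial>P)
        = (\<integral>\<^sup>+x. \<integral>\<^sup>+z'. \<integral>\<^sup>+z''. H x z' z'' \<partial>std_gaussian \<partial>std_gaussian \<partial>\<mu>)"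
      if H: "(\<lambda>(x, z', z''). H x z' z'') \<in> borel_measurable (borel \<Otimes>\<^sub>M borel \<Otimes>\<^sub>M borel)" and j: "j < N" for H j
    proof -
      note [measurable (raw)] = measurable_compose3[OF H]
      show ?thesis
        unfolding \<theta>_def z'_def z''_def
        by (subst law_\<theta>[of "\<lambda>x \<zeta> \<omega>. H x (if j = 0 then \<zeta> else (1 / sqrt (real j)) *\<^sub>R walk j \<omega>)
            ((1 / sqrt (real (N - j))) *\<^sub>R walk (N - j) (sdrop j \<omega>))"], measurable)
          (subst nn_integral_normalized_walks[OF _ j], auto)
    qed
    have mu1: "(\<integral>\<^sup>+x. 1 \<partial>\<mu>) = 1"
      unfolding \<gamma>1[symmetric] using \<gamma>.emeasure_space_1 by (subst nn_integral_distr) auto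
    have z_int: "square_integrable P (z' j)" "l2norm P (z' j) \<le> sqrt p"
      "square_integrable P (z'' j)" "l2norm P (z'' j) \<le> sqrt p" if j: "j < N" for j
    proof -
      have p': "(\<integral>\<^sup>+z. ennreal ((norm (z::'a))\<^sup>2) \<partial>std_gaussian) = ennreal p"
        by (simp add: nn_integral_std_gaussian_norm_sq p_def ennreal_of_nat_eq_real_of_nat)
      have "(\<integral>\<^sup>+x. ennreal p \<partial>\<mu>) = ennreal p"
        using mu1 by (simp add: nn_integral_const)
      then have 1: "(\<integral>\<^sup>+w. ennreal ((norm (z' j w))\<^sup>2) \<partial>P) \<le> ennreal p"
        and 2: "(\<integral>\<^sup>+w. ennreal ((norm (z'' j w))\<^sup>2) \<partial>P) \<le> ennreal p"
        using law_z[OF _ j, of "\<lambda>x z' z''. ennreal ((norm z')\<^sup>2)"] law_z[OF _ j, of "\<lambda>x z' z''. ennreal ((norm z'')\<^sup>2)"]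
          p' G.emeasure_space_1 by simp_all
      show "square_integrable P (z' j)" "l2norm P (z' j) \<le> sqrt p"
        "square_integrable P (z'' j)" "l2norm P (z'' j) \<le> sqrt p"
        using square_integrable_nn_integral[OF z_meas(1) 1] square_integrable_nn_integral[OF z_meas(2) 2] p by auto
    qed
    \<comment> \<open>\<open>u\<close> itself is not rounded; it only selects the time at which the
      walk is cut into \<open>z'\<close> and \<open>z''\<close>. For each fixed \<open>u\<close>
      these are independent standard Gaussians, independent of \<open>\<theta>\<close>, so
      \<open>T\<close> has exactly the law of one step.\<close>
    define T where "T u w = rstep h u (z' (J u) w) (z'' (J u) w) (\<theta> w)" for u w
    have J_meas [measurable]: "J \<in> borel \<rightarrow>\<^sub>M count_space UNIV"
      unfolding J_def by measurable
    have sets_Q [measurable_cong]: "sets (unif01 \<Otimes>\<^sub>M P) = sets (borel \<Otimes>\<^sub>M P)"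
      by (intro sets_pair_measure_cong) auto
    have T_meas [measurable]: "(\<lambda>q. T (fst q) (snd q)) \<in> borel_measurable (unif01 \<Otimes>\<^sub>M P)"
    proof -
      have a: "(\<lambda>q. J (fst q)) \<in> unif01 \<Otimes>\<^sub>M P \<rightarrow>\<^sub>M count_space UNIV"
        \<comment> \<open>The index takes countably many values, which reduces joint measurability
          to fixed \<open>j\<close>.\<close>
        by measurable
      have "(\<lambda>q. z' (J (fst q)) (snd q)) \<in> borel_measurable (unif01 \<Otimes>\<^sub>M P)"
        "(\<lambda>q. z'' (J (fst q)) (snd q)) \<in> borel_measurable (unif01 \<Otimes>\<^sub>M P)"
        by (rule measurable_compose_countable[OF _ a]; measurable)+
      then show ?thesis unfolding T_def by measurable
    qed
    define \<kappa> where "\<kappa> = distr (unif01 \<Otimes>\<^sub>M P) (borel \<Otimes>\<^sub>M borel) (\<lambda>q. (T (fst q) (snd q), X N (snd q)))"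
    have int_Q: "(\<integral>\<^sup>+q. F q \<partial>(unif01 \<Otimes>\<^sub>M P)) = (\<integral>\<^sup>+u. \<integral>\<^sup>+w. F (u, w) \<partial>P \<partial>unif01)"
      if "F \<in> borel_measurable (unif01 \<Otimes>\<^sub>M P)" for F
      using P.nn_integral_fst[OF that] by simp
    have "\<kappa> \<in> couplings \<nu> (gibbs f)"
    proof -
      have "distr \<kappa> borel fst = \<nu>"
      proof (rule measure_eqI)
        fix A assume "A \<in> sets (distr \<kappa> borel fst)"
        then have [measurable]: "A \<in> sets borel" by simp
        have "emeasure (distr \<kappa> borel fst) A = (\<integral>\<^sup>+y. indicator A y \<partial>distr \<kappa> borel fst)" by simp
        also have "\<dots> = (\<integral>\<^sup>+q. indicator A (T (fst q) (snd q)) \<partial>(unif01 \<Otimes>\<^sub>M P))"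
          unfolding \<kappa>_def by (simp add: nn_integral_distr del: nn_integral_indicator)
        also have "\<dots> = (\<integral>\<^sup>+u. \<integral>\<^sup>+w. indicator A (T u w) \<partial>P \<partial>unif01)"
          by (subst int_Q) auto
        also have "\<dots> = (\<integral>\<^sup>+u. \<integral>\<^sup>+x. \<integral>\<^sup>+z'. \<integral>\<^sup>+z''. indicator A (rstep h u z' z'' x) \<partial>std_gaussian \<partial>std_gaussian \<partial>\<mu> \<partial>unif01)"
        proof (rule nn_integral_cong)
          fix u
          show "(\<integral>\<^sup>+w. indicator A (T u w) \<partial>P) = (\<integral>\<^sup>+x. \<integral>\<^sup>+z'. \<integral>\<^sup>+z''. indicator A (rstep h u z' z'' x) \<partial>std_gaussian \<partial>std_gaussian \<partial>\<mu>)"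
            unfolding T_def by (rule law_z[OF _ J]) measurable
        qed
        also have "\<dots> = (\<integral>\<^sup>+y. indicator A y \<partial>\<nu>)" by (rule law[symmetric]) measurable
        finally show "emeasure (distr \<kappa> borel fst) A = emeasure \<nu> A" by (simp add: sets_\<nu>)
      qed (simp add: sets_\<nu>)
      moreover have "distr \<kappa> borel snd = gibbs f"
      proof (rule measure_eqI)
        fix A assume "A \<in> sets (distr \<kappa> borel snd)"
        then have [measurable]: "A \<in> sets borel" by simp
        have "emeasure (distr \<kappa> borel snd) A = (\<integral>\<^sup>+y. indicator A y \<partial>distr \<kappa> borel snd)" by simp
        also have "\<dots> = (\<integral>\<^sup>+q. indicator A (X N (snd q)) \<partial>(unif01 \<Otimes>\<^sub>M P))"
          unfolding \<kappa>_def by (simp add: nn_integral_distr del: nn_integral_indicator)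
        also have "\<dots> = (\<integral>\<^sup>+w. indicator A (X N w) \<partial>P)"
          using U.emeasure_space_1 by (subst int_Q) auto
        also have "\<dots> = (\<integral>\<^sup>+x. \<integral>\<^sup>+\<omega>. indicator A (chain (\<eta> n) N x \<omega>) \<partial>noise_stream \<partial>gibbs f)"
          unfolding X_def by (rule law_X) measurable
        also have "\<dots> = (\<integral>\<^sup>+x. indicator A x \<partial>gibbs f)"
          using nn_integral_chain[OF \<eta>(1), of "\<lambda>y s. indicator A y" n N]
            prob_space.emeasure_space_1[OF prob_space_noise[where 'a='a]] by simp
        finally show "emeasure (distr \<kappa> borel snd) A = emeasure (gibbs f) A" by simp
      qed simp
      ultimately show ?thesis by (simp add: couplings_def \<kappa>_def)
    qed
    then have "(INF \<gamma>\<in>couplings \<nu> (gibbs f). transport_cost \<gamma>) \<le> transport_cost \<kappa>"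
      by (rule INF_lower)
    also have "transport_cost \<kappa> = (\<integral>\<^sup>+u. \<integral>\<^sup>+w. ennreal ((norm (T u w - X N w))\<^sup>2) \<partial>P \<partial>unif01)"
      unfolding transport_cost_def \<kappa>_def
      by (subst nn_integral_distr, measurable) (subst int_Q, auto)
    also have "\<dots> \<le> (\<integral>\<^sup>+u. ennreal ((1 + s n) * (l2norm P (Y (nat \<lfloor>u * real N\<rfloor>)))\<^sup>2 + (s n + (s n)\<^sup>2)) \<partial>unif01)"
    proof (rule nn_integral_mono_AE)
      show "AE u in unif01. (\<integral>\<^sup>+w. ennreal ((norm (T u w - X N w))\<^sup>2) \<partial>P)
          \<le> ennreal ((1 + s n) * (l2norm P (Y (nat \<lfloor>u * real N\<rfloor>)))\<^sup>2 + (s n + (s n)\<^sup>2))"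
        using AE_unif01_cell[OF N]
      proof eventually_elim
        case (elim u)
        define j where "j = nat \<lfloor>u * real N\<rfloor>"
        have u: "0 \<le> u" "u < 1" and jN: "j < N" and k: "real j \<le> u * real N" "u * real N < real j + 1"
          using elim by (auto simp: j_def)
        have Ju: "J u = j" using jN by (simp add: J_def j_def[symmetric])
        define v where "v = real j / real N"
        have v: "0 \<le> v" "v \<le> 1" using jN by (auto simp: v_def)
        have "\<bar>u - v\<bar> = \<bar>u * real N - real j\<bar> / real N"
          using N by (simp add: v_def abs_if field_simps)
        also have "\<dots> \<le> 1 / real N" using k N by (intro divide_right_mono) auto
        finally have uv: "\<bar>u - v\<bar> \<le> 1 / real N" .
        define V where "V w = rstep h u (z' j w) (z'' j w) (\<theta> w) - rstep h v (z' j w) (z'' j w) (\<theta> w)" for w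
        have V: "square_integrable P V" "l2norm P V \<le> \<sigma> n"
        proof -
          define B where "B w = (h * M * \<eta> n) *\<^sub>R norm (g (\<theta> w)) + ((h * M + 1) * sqrt (2 * \<eta> n)) *\<^sub>R norm (z' j w)
            + sqrt (2 * \<eta> n) *\<^sub>R norm (z'' j w)" for w
          have nrm: "square_integrable P (\<lambda>w. norm (F w))" "l2norm P (\<lambda>w. norm (F w)) = l2norm P F"
            if "square_integrable P F" for F :: "_ \<Rightarrow> 'a"
            using that by (auto simp: square_integrable_def l2norm_def)
          note i = nrm(1)[OF g\<theta>] nrm(1)[OF z_int(1)[OF jN]] nrm(1)[OF z_int(3)[OF jN]]
          have B: "square_integrable P B"
            unfolding B_def by (intro square_integrable_add square_integrable_scaleR i)
          have "l2norm P B \<le> l2norm P (\<lambda>w. (h * M * \<eta> n) *\<^sub>R norm (g (\<theta> w)) + ((h * M + 1) * sqrt (2 * \<eta> n)) *\<^sub>R norm (z' j w))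
              + l2norm P (\<lambda>w. sqrt (2 * \<eta> n) *\<^sub>R norm (z'' j w))"
            unfolding B_def by (intro l2norm_triangle square_integrable_add square_integrable_scaleR i)
          also have "l2norm P (\<lambda>w. (h * M * \<eta> n) *\<^sub>R norm (g (\<theta> w)) + ((h * M + 1) * sqrt (2 * \<eta> n)) *\<^sub>R norm (z' j w))
              \<le> l2norm P (\<lambda>w. (h * M * \<eta> n) *\<^sub>R norm (g (\<theta> w))) + l2norm P (\<lambda>w. ((h * M + 1) * sqrt (2 * \<eta> n)) *\<^sub>R norm (z' j w))"
            by (intro l2norm_triangle square_integrable_scaleR i)
          also have "l2norm P (\<lambda>w. (h * M * \<eta> n) *\<^sub>R norm (g (\<theta> w))) = h * M * \<eta> n * Gn"
            unfolding l2norm_scaleR nrm(2)[OF g\<theta>] Gn_def using h M \<eta>(1)[of n] by simp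
          also have "l2norm P (\<lambda>w. ((h * M + 1) * sqrt (2 * \<eta> n)) *\<^sub>R norm (z' j w)) \<le> (h * M + 1) * sqrt (2 * \<eta> n) * sqrt p"
            unfolding l2norm_scaleR nrm(2)[OF z_int(1)[OF jN]] using h M \<eta>(1)[of n] z_int(2)[OF jN]
            by (simp add: mult_left_mono)
          also have "l2norm P (\<lambda>w. sqrt (2 * \<eta> n) *\<^sub>R norm (z'' j w)) \<le> sqrt (2 * \<eta> n) * sqrt p"
            unfolding l2norm_scaleR nrm(2)[OF z_int(3)[OF jN]] using \<eta>(1)[of n] z_int(4)[OF jN]
            by (simp add: mult_left_mono)
          finally have Bn: "l2norm P B \<le> \<sigma> n" by (simp add: \<sigma>_def)
          have Vm: "V \<in> borel_measurable P" unfolding V_def by measurable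
          have "norm (V w) \<le> norm (B w)" for w
          proof -
            have "norm (V w) \<le> B w"
              unfolding V_def B_def using rstep_diff_le[OF h(1) u(1) less_imp_le[OF u(2)] v uv, of "z' j w" "z'' j w" "\<theta> w"]
              by (simp add: \<eta>N)
            then show ?thesis by simp
          qed
          from square_integrable_bound[OF Vm B this] Bn
          show "square_integrable P V" "l2norm P V \<le> \<sigma> n" by auto
        qed
        \<comment> \<open>Three contributions: the grid-time difference \<open>Y j\<close>, in which
          the full noise \<open>W N\<close> has cancelled against that of the chain, the residual of
          the chain, and the rounding error \<open>V\<close>.\<close>
        have split: "T u w - X N w = (Y j w - R N w) + V w" for w
        proof -
          have "rstep h v (z' j w) (z'' j w) (\<theta> w) = \<theta> w - h *\<^sub>R g (\<theta>' j w) + sqrt (2 * (h / N)) *\<^sub>R W N w"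
          proof -
            have "(if j = 0 then 0 else walk j (snd (snd w))) = walk j (snd (snd w))" by simp
            then show ?thesis
              unfolding v_def z'_def z''_def rstep_grid[OF N jN h(1)] \<theta>'_def W_def
              using walk_split[of j N "snd (snd w)"] jN by simp
          qed
          then show ?thesis
            using rel[of N w] by (simp add: T_def Ju V_def Y_def)
        qed
        have TX: "square_integrable P (\<lambda>w. T u w - X N w)"
          unfolding split by (intro square_integrable_add square_integrable_diff Y R V)
        have "l2norm P (\<lambda>w. T u w - X N w) \<le> l2norm P (\<lambda>w. Y j w - R N w) + l2norm P V"
          unfolding split by (intro l2norm_triangle square_integrable_diff Y R V)
        also have "l2norm P (\<lambda>w. Y j w - R N w) \<le> l2norm P (Y j) + l2norm P (R N)"
          by (intro l2norm_triangle_diff Y R)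
        finally have "l2norm P (\<lambda>w. T u w - X N w) \<le> l2norm P (Y j) + 1 * s n"
          using V(2) Rn[of N] by (simp add: s_def)
        then have "(l2norm P (\<lambda>w. T u w - X N w))\<^sup>2 \<le> (l2norm P (Y j) + 1 * s n)\<^sup>2"
          by (rule power_mono) simp
        also have "\<dots> \<le> (1 + s n) * (l2norm P (Y j))\<^sup>2 + 1\<^sup>2 * (s n + (s n)\<^sup>2)"
          by (rule sq_add_le[OF nonneg(3)])
        finally show ?case
          unfolding nn_integral_norm_sq[OF TX] j_def[symmetric] by (intro ennreal_leI) simp
      qed
    qed
    also have "\<dots> = (\<Sum>j<N. ennreal ((1 + s n) * (l2norm P (Y j))\<^sup>2 + (s n + (s n)\<^sup>2))) * ennreal (1 / real N)"
      by (rule nn_integral_unif01_floor[OF N])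
    also have "\<dots> = ennreal ((\<Sum>j<N. (1 + s n) * (l2norm P (Y j))\<^sup>2 + (s n + (s n)\<^sup>2)) * (1 / real N))"
      using nonneg[of n] by (subst sum_ennreal, simp, subst ennreal_mult''[symmetric]) simp_all
    also have "\<dots> \<le> ennreal (bound n)"
    proof (rule ennreal_leI)
      have "(\<Sum>j<N. (1 + s n) * (l2norm P (Y j))\<^sup>2 + (s n + (s n)\<^sup>2)) * (1 / real N)
          = (1 + s n) * ((\<Sum>j<N. (l2norm P (Y j))\<^sup>2) / real N) + (s n + (s n)\<^sup>2)"
        using N by (simp add: sum.distrib sum_distrib_left[symmetric] field_simps)
      also have "\<dots> \<le> bound n"
        unfolding bound_def using Yb nonneg[of n] by (intro add_right_mono mult_left_mono) auto
      finally show "(\<Sum>j<N. (1 + s n) * (l2norm P (Y j))\<^sup>2 + (s n + (s n)\<^sup>2)) * (1 / real N) \<le> bound n" .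
    qed
    finally show ?thesis .
  qed
  have \<rho>0: "\<rho> \<longlonglongrightarrow> 0" unfolding \<rho>_def by (rule tendsto_mult_right_zero[OF \<epsilon>(2)])
  have "\<sigma> \<longlonglongrightarrow> h * M * 0 * Gn + (h * M + 1) * sqrt (2 * 0) * sqrt p + sqrt (2 * 0) * sqrt p"
    unfolding \<sigma>_def by (intro tendsto_intros \<eta>0)
  then have "s \<longlonglongrightarrow> 0 + 0"
    unfolding s_def by (intro tendsto_add \<rho>0) simp
  then have s0: "s \<longlonglongrightarrow> 0" by simp
  define B where "B = h * p * (M * h)\<^sup>2 * (25.05 * (M * h) + 2.26)"
  have "bound \<longlonglongrightarrow> (1 + 0) * ((1 - m * h) * C + (1 + 0) * B + 3 * h * M * (0 + 0\<^sup>2)) + (0 + 0\<^sup>2)"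
    unfolding bound_def \<Phi>_def B_def[symmetric] by (intro tendsto_intros s0 \<rho>0)
  then have "bound \<longlonglongrightarrow> (1 - m * h) * C + B" by simp
  then have "(\<lambda>n. ennreal (bound n)) \<longlonglongrightarrow> ennreal ((1 - m * h) * C + B)"
    by (rule tendsto_ennrealI)
  then show ?thesis
    unfolding B_def p_def by (rule LIMSEQ_le_const) (use key in auto)
qed

end

section \<open>The law of the iterates\<close>

context rlmc_inputs
begin

definition input_events :: "rlmc_index \<Rightarrow> 'w set set" where
  "input_events i = (case i of
      Init \<Rightarrow> sets (vimage_algebra (space \<Omega>) \<theta>0 borel)
    | Unif k \<Rightarrow> sets (vimage_algebra (space \<Omega>) (U k) borel)
    | Noise1 k \<Rightarrow> sets (vimage_algebra (space \<Omega>) (\<xi>' k) borel)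
    | Noise2 k \<Rightarrow> sets (vimage_algebra (space \<Omega>) (\<xi>'' k) borel))"

lemma indep_input_events: "indep_sets input_events UNIV"
proof -
  have "input_events = (\<lambda>i. case i of
      Init \<Rightarrow> sets (vimage_algebra (space \<Omega>) \<theta>0 borel)
    | Unif k \<Rightarrow> sets (vimage_algebra (space \<Omega>) (U k) borel)
    | Noise1 k \<Rightarrow> sets (vimage_algebra (space \<Omega>) (\<xi>' k) borel)
    | Noise2 k \<Rightarrow> sets (vimage_algebra (space \<Omega>) (\<xi>'' k) borel))"
    by (rule ext) (simp add: input_events_def)
  then show ?thesis using indep_inputs by simp
qed

lemma input_events_subset: "input_events i \<subseteq> events"
  using indep_input_events by (auto simp: indep_sets_def)

definition known :: "rlmc_index set \<Rightarrow> 'w measure" where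
  "known A = sigma (space \<Omega>) (\<Union>i\<in>A. input_events i)"

lemma input_events_space: "(\<Union>i\<in>A. input_events i) \<subseteq> Pow (space \<Omega>)"
  using input_events_subset sets.space_closed by blast

lemma space_known: "space (known A) = space \<Omega>"
  unfolding known_def using input_events_space by (rule space_measure_of)

lemma sets_known: "sets (known A) = sigma_sets (space \<Omega>) (\<Union>i\<in>A. input_events i)"
  unfolding known_def using input_events_space by (rule sets_measure_of)

lemma sets_known_subset: "sets (known A) \<subseteq> events"
  unfolding sets_known using input_events_subset by (intro sets.sigma_sets_subset) blast

lemma known_mono:
  assumes V: "V \<in> known A \<rightarrow>\<^sub>M N" and AB: "A \<subseteq> B"
  shows "V \<in> known B \<rightarrow>\<^sub>M N"
proof -
  have "sets (known A) \<subseteq> sets (known B)"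
    unfolding sets_known using AB by (intro sigma_sets_mono') blast
  with V show ?thesis
    unfolding measurable_def space_known by blast
qed

lemma known_measurable: "V \<in> known A \<rightarrow>\<^sub>M N \<Longrightarrow> V \<in> \<Omega> \<rightarrow>\<^sub>M N"
  using sets_known_subset[of A] by (auto simp: measurable_def space_known)

lemma known_vimage:
  assumes "sets (vimage_algebra (space \<Omega>) V borel) = input_events i" "i \<in> A"
  shows "V \<in> borel_measurable (known A)"
proof (rule measurableI)
  fix S :: "'a set" assume "S \<in> sets borel"
  then have "V -` S \<inter> space \<Omega> \<in> input_events i"
    unfolding assms(1)[symmetric] by (rule in_vimage_algebra)
  then show "V -` S \<inter> space (known A) \<in> sets (known A)"
    unfolding sets_known space_known using assms(2) by blast
qed simp

lemma inputs_known:
  "Init \<in> A \<Longrightarrow> \<theta>0 \<in> borel_measurable (known A)"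
  "Unif k \<in> A \<Longrightarrow> U k \<in> borel_measurable (known A)"
  "Noise1 k \<in> A \<Longrightarrow> \<xi>' k \<in> borel_measurable (known A)"
  "Noise2 k \<in> A \<Longrightarrow> \<xi>'' k \<in> borel_measurable (known A)"
  by (rule known_vimage; simp add: input_events_def)+

text \<open>Disjoint index sets generate independent \<sigma>-algebras, because the input events are
  stable under intersection. Working with \<sigma>-algebras allows variables with values in
  different spaces.\<close>

lemma known_joint_law:
  assumes V: "V \<in> known A \<rightarrow>\<^sub>M N1" and W: "W \<in> known B \<rightarrow>\<^sub>M N2" and AB: "A \<inter> B = {}"
  shows "distr \<Omega> (N1 \<Otimes>\<^sub>M N2) (\<lambda>\<omega>. (V \<omega>, W \<omega>)) = distr \<Omega> N1 V \<Otimes>\<^sub>M distr \<Omega> N2 W"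
proof -
  have "indep_sets (\<lambda>b. sigma_sets (space \<Omega>) (\<Union>i\<in>(case b of True \<Rightarrow> A | False \<Rightarrow> B). input_events i)) (UNIV :: bool set)"
  proof (rule indep_sets_collect_sigma)
    show "indep_sets input_events (\<Union>b\<in>UNIV. case b of True \<Rightarrow> A | False \<Rightarrow> B)"
      by (rule indep_sets_mono_index[OF _ indep_input_events]) simp
    show "Int_stable (input_events i)" for i
      by (auto simp: input_events_def intro!: sets.Int_stable split: rlmc_index.split)
    show "disjoint_family_on (case_bool A B) UNIV"
      using AB by (auto simp: disjoint_family_on_def split: bool.split)
  qed
  then have indep: "indep_set (sets (known A)) (sets (known B))"
    unfolding indep_set_def sets_known by (rule indep_sets_mono_sets) (auto split: bool.split)
  have Vm [measurable]: "V \<in> \<Omega> \<rightarrow>\<^sub>M N1" and Wm [measurable]: "W \<in> \<Omega> \<rightarrow>\<^sub>M N2"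
    using known_measurable[OF V] known_measurable[OF W] .
  interpret V: prob_space "distr \<Omega> N1 V" by (rule prob_space_distr[OF Vm])
  interpret W: prob_space "distr \<Omega> N2 W" by (rule prob_space_distr[OF Wm])
  show ?thesis
  proof (rule pair_measure_eqI[symmetric])
    fix S T assume "S \<in> sets (distr \<Omega> N1 V)" "T \<in> sets (distr \<Omega> N2 W)"
    then have S [measurable]: "S \<in> sets N1" and T [measurable]: "T \<in> sets N2" by auto
    have "prob ((V -` S \<inter> space \<Omega>) \<inter> (W -` T \<inter> space \<Omega>)) = prob (V -` S \<inter> space \<Omega>) * prob (W -` T \<inter> space \<Omega>)"
      by (rule indep_setD[OF indep])
        (use measurable_sets[OF V S] measurable_sets[OF W T] in \<open>simp_all add: space_known\<close>)
    moreover have "(\<lambda>\<omega>. (V \<omega>, W \<omega>)) -` (S \<times> T) \<inter> space \<Omega> = (V -` S \<inter> space \<Omega>) \<inter> (W -` T \<inter> space \<Omega>)"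
      by auto
    ultimately show "emeasure (distr \<Omega> N1 V) S * emeasure (distr \<Omega> N2 W) T
        = emeasure (distr \<Omega> (N1 \<Otimes>\<^sub>M N2) (\<lambda>\<omega>. (V \<omega>, W \<omega>))) (S \<times> T)"
      by (simp add: emeasure_distr emeasure_eq_measure ennreal_mult)
  qed (auto intro: V.sigma_finite_measure_axioms W.sigma_finite_measure_axioms)
qed

text \<open>All indices are strictly below \<open>k\<close>: iterate \<open>k\<close> reads the
  inputs of the steps \<open>0, ..., k - 1\<close>, so those with index \<open>k\<close> are
  fresh.\<close>

definition past :: "nat \<Rightarrow> rlmc_index set" where
  "past k = insert Init (Unif ` {..<k} \<union> Noise1 ` {..<k} \<union> Noise2 ` {..<k})"

lemma rlmc_known:
  assumes [measurable]: "grad f \<in> borel_measurable borel"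
  shows "rlmc f h \<theta>0 U \<xi>' \<xi>'' k \<in> borel_measurable (known (past k))"
proof (induction k)
  case 0
  have "rlmc f h \<theta>0 U \<xi>' \<xi>'' 0 = \<theta>0" by (rule ext) simp
  then show ?case by (simp add: inputs_known past_def)
next
  case (Suc k)
  have [measurable]: "rlmc f h \<theta>0 U \<xi>' \<xi>'' k \<in> borel_measurable (known (past (Suc k)))"
    by (rule known_mono[OF Suc.IH]) (auto simp: past_def)
  have [measurable]: "U k \<in> borel_measurable (known (past (Suc k)))" "\<xi>' k \<in> borel_measurable (known (past (Suc k)))"
    "\<xi>'' k \<in> borel_measurable (known (past (Suc k)))"
    by (auto intro!: inputs_known simp: past_def)
  show ?case
    unfolding rlmc.simps rlmc_step_def rlmc_mid_def by measurable
qed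

text \<open>The product law is assembled from the noises outwards. The uniform variable is outermost
  because the coupling treats each \<open>u\<close> separately.\<close>

lemma rlmc_law_Suc:
  assumes [measurable]: "grad f \<in> borel_measurable borel" and F: "F \<in> borel_measurable borel"
  shows "(\<integral>\<^sup>+y. F y \<partial>distr \<Omega> borel (rlmc f h \<theta>0 U \<xi>' \<xi>'' (Suc k)))
    = (\<integral>\<^sup>+u. \<integral>\<^sup>+x. \<integral>\<^sup>+z'. \<integral>\<^sup>+z''. F (rlmc_step f h u z' z'' x)
        \<partial>std_gaussian \<partial>std_gaussian \<partial>distr \<Omega> borel (rlmc f h \<theta>0 U \<xi>' \<xi>'' k) \<partial>unif01)"
proof -
  note [measurable] = F
  let ?X = "rlmc f h \<theta>0 U \<xi>' \<xi>'' k"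
  let ?G = "std_gaussian :: (real ^ 'p) measure"
  have X: "?X \<in> borel_measurable (known (past k))" by (rule rlmc_known) fact
  have [measurable]: "?X \<in> borel_measurable \<Omega>" "U k \<in> borel_measurable \<Omega>" "\<xi>' k \<in> borel_measurable \<Omega>" "\<xi>'' k \<in> borel_measurable \<Omega>"
    using known_measurable[OF X] measurable_unif measurable_noise1 measurable_noise2 by auto
  have step [measurable (raw)]: "(\<lambda>w. rlmc_step f h (u w) (z' w) (z'' w) (x w)) \<in> borel_measurable N"
    if [measurable]: "u \<in> borel_measurable N" "z' \<in> borel_measurable N" "z'' \<in> borel_measurable N" "x \<in> borel_measurable N"
    for u z' z'' x and N :: "'q measure"
    unfolding rlmc_step_def rlmc_mid_def by measurable
  interpret G: prob_space ?G by (rule prob_space_std_gaussian)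
  interpret X: prob_space "distr \<Omega> borel ?X" by (rule prob_space_distr) measurable
  interpret GG: prob_space "?G \<Otimes>\<^sub>M ?G" by (intro prob_space_pair prob_space_std_gaussian)
  interpret XGG: prob_space "distr \<Omega> borel ?X \<Otimes>\<^sub>M (?G \<Otimes>\<^sub>M ?G)"
    by (intro prob_space_pair X.prob_space_axioms GG.prob_space_axioms)
  have 1: "distr \<Omega> (borel \<Otimes>\<^sub>M borel) (\<lambda>\<omega>. (\<xi>' k \<omega>, \<xi>'' k \<omega>)) = ?G \<Otimes>\<^sub>M ?G"
    using known_joint_law[OF inputs_known(3)[of k "{Noise1 k}"] inputs_known(4)[of k "{Noise2 k}"]]
    by (simp add: distr_noise1 distr_noise2)
  have 2: "distr \<Omega> (borel \<Otimes>\<^sub>M (borel \<Otimes>\<^sub>M borel)) (\<lambda>\<omega>. (?X \<omega>, \<xi>' k \<omega>, \<xi>'' k \<omega>))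
      = distr \<Omega> borel ?X \<Otimes>\<^sub>M (?G \<Otimes>\<^sub>M ?G)"
  proof -
    have "(\<lambda>\<omega>. (\<xi>' k \<omega>, \<xi>'' k \<omega>)) \<in> known {Noise1 k, Noise2 k} \<rightarrow>\<^sub>M borel \<Otimes>\<^sub>M borel"
      by (intro measurable_Pair inputs_known) auto
    from known_joint_law[OF X this] show ?thesis
      unfolding 1 by (auto simp: past_def)
  qed
  have 3: "distr \<Omega> (borel \<Otimes>\<^sub>M (borel \<Otimes>\<^sub>M (borel \<Otimes>\<^sub>M borel))) (\<lambda>\<omega>. (U k \<omega>, ?X \<omega>, \<xi>' k \<omega>, \<xi>'' k \<omega>))
      = unif01 \<Otimes>\<^sub>M (distr \<Omega> borel ?X \<Otimes>\<^sub>M (?G \<Otimes>\<^sub>M ?G))"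
  proof -
    have "(\<lambda>\<omega>. (?X \<omega>, \<xi>' k \<omega>, \<xi>'' k \<omega>)) \<in> known (insert (Noise1 k) (insert (Noise2 k) (past k))) \<rightarrow>\<^sub>M borel \<Otimes>\<^sub>M (borel \<Otimes>\<^sub>M borel)"
      by (intro measurable_Pair inputs_known known_mono[OF X]) auto
    from known_joint_law[OF inputs_known(2)[of k "{Unif k}"] this] show ?thesis
      unfolding 2 by (auto simp: past_def distr_unif)
  qed
  define H where "H = (\<lambda>(u, x, z', z''). F (rlmc_step f h u z' z'' x))"
  have H: "H \<in> borel_measurable (borel \<Otimes>\<^sub>M (borel \<Otimes>\<^sub>M (borel \<Otimes>\<^sub>M borel)))"
    unfolding H_def by measurable
  have [measurable]: "rlmc f h \<theta>0 U \<xi>' \<xi>'' (Suc k) \<in> borel_measurable \<Omega>"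
    unfolding rlmc.simps by measurable
  have "(\<integral>\<^sup>+y. F y \<partial>distr \<Omega> borel (rlmc f h \<theta>0 U \<xi>' \<xi>'' (Suc k)))
      = (\<integral>\<^sup>+\<omega>. H (U k \<omega>, ?X \<omega>, \<xi>' k \<omega>, \<xi>'' k \<omega>) \<partial>\<Omega>)"
    by (subst nn_integral_distr) (auto simp: H_def)
  also have "\<dots> = (\<integral>\<^sup>+w. H w \<partial>(unif01 \<Otimes>\<^sub>M (distr \<Omega> borel ?X \<Otimes>\<^sub>M (?G \<Otimes>\<^sub>M ?G))))"
    unfolding 3[symmetric] using H by (subst nn_integral_distr) auto
  also have "\<dots> = (\<integral>\<^sup>+u. \<integral>\<^sup>+x. \<integral>\<^sup>+z'. \<integral>\<^sup>+z''. H (u, x, z', z'') \<partial>?G \<partial>?G \<partial>distr \<Omega> borel ?X \<partial>unif01)"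
  proof -
    have "(\<integral>\<^sup>+w. H w \<partial>(unif01 \<Otimes>\<^sub>M (distr \<Omega> borel ?X \<Otimes>\<^sub>M (?G \<Otimes>\<^sub>M ?G))))
        = (\<integral>\<^sup>+u. \<integral>\<^sup>+w. H (u, w) \<partial>(distr \<Omega> borel ?X \<Otimes>\<^sub>M (?G \<Otimes>\<^sub>M ?G)) \<partial>unif01)"
      unfolding H_def by (subst XGG.nn_integral_fst[symmetric]) auto
    also have "\<dots> = (\<integral>\<^sup>+u. \<integral>\<^sup>+x. \<integral>\<^sup>+w. H (u, x, w) \<partial>(?G \<Otimes>\<^sub>M ?G) \<partial>distr \<Omega> borel ?X \<partial>unif01)"
      unfolding H_def by (subst GG.nn_integral_fst[symmetric]) auto
    also have "\<dots> = (\<integral>\<^sup>+u. \<integral>\<^sup>+x. \<integral>\<^sup>+z'. \<integral>\<^sup>+z''. H (u, x, z', z'') \<partial>?G \<partial>?G \<partial>distr \<Omega> borel ?X \<partial>unif01)"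
      unfolding H_def by (subst G.nn_integral_fst[symmetric]) auto
    finally show ?thesis .
  qed
  finally show ?thesis by (simp add: H_def)
qed

end

section \<open>Iterating the one-step bound\<close>

text \<open>The infimum over couplings need not be attained: an index within \<open>e / q\<close> of
  it costs only \<open>e\<close>.\<close>

lemma INF_affine_ennreal:
  fixes \<phi> :: "'i \<Rightarrow> ennreal"
  assumes q: "0 < q" and le: "\<And>i. i \<in> I \<Longrightarrow> x \<le> ennreal q * \<phi> i + b"
  shows "x \<le> ennreal q * (INF i\<in>I. \<phi> i) + b"
proof (cases "(INF i\<in>I. \<phi> i) = \<top>")
  case True
  then show ?thesis using q by (simp add: ennreal_mult_top)
next
  case False
  show ?thesis
  proof (rule ennreal_le_epsilon)
    fix e :: real assume e: "0 < e"
    have "(INF i\<in>I. \<phi> i) < (INF i\<in>I. \<phi> i) + ennreal (e / q)"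
      using False e q
      by (cases "INF i\<in>I. \<phi> i") (auto simp: ennreal_plus[symmetric] ennreal_less_iff simp del: ennreal_plus)
    then obtain i where i: "i \<in> I" "\<phi> i < (INF i\<in>I. \<phi> i) + ennreal (e / q)"
      by (auto simp: INF_less_iff)
    have "x \<le> ennreal q * \<phi> i + b" by (rule le[OF i(1)])
    also have "\<dots> \<le> ennreal q * ((INF i\<in>I. \<phi> i) + ennreal (e / q)) + b"
      using i(2) by (intro add_right_mono mult_left_mono) auto
    also have "\<dots> = ennreal q * (INF i\<in>I. \<phi> i) + b + ennreal e"
      using q e by (simp add: distrib_left ennreal_mult'[symmetric] add_ac)
    finally show "x \<le> ennreal q * (INF i\<in>I. \<phi> i) + b + ennreal e" .
  qed
qed

lemma sqrt_ennreal_mono: "x \<le> y \<Longrightarrow> sqrt_ennreal x \<le> sqrt_ennreal y"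
  unfolding sqrt_ennreal_def by (auto simp: enn2real_mono less_top top_unique intro!: ennreal_leI)

lemma W2_eq_transport_cost: "W2 \<mu> \<nu> = sqrt_ennreal (INF \<gamma>\<in>couplings \<mu> \<nu>. transport_cost \<gamma>)"
  by (simp add: W2_def transport_cost_def)

text \<open>Since \<open>\<kappa> \<ge> 1\<close>, the assumption gives
  \<open>a + a * sqrt a \<le> 1 / 4\<close>. For \<open>a > 0.18\<close> the left side exceeds
  \<open>0.18 * 1.42\<close>, which is more than 1/4.\<close>

lemma step_size_bound:
  fixes a :: real
  assumes a: "0 < a" and \<kappa>: "1 \<le> \<kappa>" and le: "a + sqrt \<kappa> * a powr (3 / 2) \<le> 1 / 4"
  shows "a \<le> 9 / 50"
proof (rule ccontr)
  assume "\<not> a \<le> 9 / 50"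
  then have a': "9 / 50 < a" by simp
  have "a powr (3 / 2) = a powr 1 * a powr (1 / 2)"
    by (subst powr_add[symmetric]) simp
  then have p: "a powr (3 / 2) = a * sqrt a"
    using a by (simp add: powr_half_sqrt)
  have "0.42 \<le> sqrt a"
    using a' by (intro real_le_rsqrt) (simp add: power2_eq_square)
  then have "9 / 50 * 0.42 \<le> a * sqrt a"
    using a' by (intro mult_mono) auto
  also have "a * sqrt a \<le> sqrt \<kappa> * (a * sqrt a)"
    using a \<kappa> mult_right_mono[of 1 "sqrt \<kappa>" "a * sqrt a"] by simp
  finally show False using le a' unfolding p by simp
qed

text \<open>Compares the error of the recursion, divided by \<open>m * h\<close>, with the square of
  the claimed error. It suffices to take \<open>\<kappa> = 1\<close>; with
  \<open>t = sqrt a \<le> 0.4243\<close> the excess \<open>19.29 * t^2\<close> is absorbed by the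
  mixed term \<open>8.496 * t\<close>, and \<open>1.77^2\<close> exceeds 2.26.\<close>

lemma one_step_error_bound:
  fixes a \<kappa> :: real
  assumes a: "0 < a" "a \<le> 9 / 50" and \<kappa>: "1 \<le> \<kappa>"
  shows "25.05 * a + 2.26 \<le> (2.4 * sqrt (\<kappa> * a) + 1.77)\<^sup>2"
proof -
  define t where "t = sqrt a"
  have t: "0 \<le> t" "t\<^sup>2 = a" using a by (auto simp: t_def)
  have "t \<le> 0.4243"
    using a t by (intro power2_le_imp_le[of t]) (auto simp: power2_eq_square)
  then have "t * t \<le> 0.4243 * t" using t by (intro mult_right_mono) auto
  then have "25.05 * t\<^sup>2 + 2.26 \<le> (2.4 * t + 1.77)\<^sup>2"
    using t by (simp add: power2_eq_square algebra_simps)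
  also have "\<dots> \<le> (2.4 * sqrt (\<kappa> * a) + 1.77)\<^sup>2"
    using t a \<kappa> mult_right_mono[of 1 \<kappa> a] by (intro power_mono) (auto simp: t_def intro!: real_sqrt_le_mono)
  finally show ?thesis using t by simp
qed

theorem theorem1:
  fixes f :: "real ^ 'p \<Rightarrow> real"
    and m M \<kappa> h :: real
    and \<Omega> :: "'w measure"
    and \<nu>0 :: "(real ^ 'p) measure"
    and \<theta>0 :: "'w \<Rightarrow> real ^ 'p"
    and U :: "nat \<Rightarrow> 'w \<Rightarrow> real"
    and \<xi>' \<xi>'' :: "nat \<Rightarrow> 'w \<Rightarrow> real ^ 'p"
    and n :: nat
  assumes "0 < m" and "m \<le> M" and "\<kappa> = M / m"
    and "twice_differentiable f"
    and "\<And>x. m *\<^sub>R mat 1 \<preceq>\<^sub>L hessian f x"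
    and "\<And>x. hessian f x \<preceq>\<^sub>L M *\<^sub>R mat 1"
    and "0 < h" and "M * h + sqrt \<kappa> * (M * h) powr (3 / 2) \<le> 1 / 4"
    and "rlmc_inputs \<Omega> \<nu>0 \<theta>0 U \<xi>' \<xi>''"
    and "1 \<le> n"
  shows "W2 (distr \<Omega> borel (rlmc f h \<theta>0 U \<xi>' \<xi>'' n)) (gibbs f)
    \<le> ennreal (1.11 * exp (- m * real n * h / 2)) * W2 \<nu>0 (gibbs f)
      + ennreal ((2.4 * sqrt (\<kappa> * M * h) + 1.77) * M * h * sqrt (real CARD('p) / m))"
proof -
  interpret potential f "grad f" m M
    using assms by (intro potential_grad) auto
  interpret rlmc_inputs \<Omega> \<nu>0 \<theta>0 U \<xi>' \<xi>'' by fact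
  have m: "0 < m" and M: "0 < M" and h: "0 < h" using assms M_pos by auto
  have \<kappa>: "1 \<le> \<kappa>" using assms by simp
  have a: "M * h \<le> 9 / 50" using assms M by (intro step_size_bound[OF _ \<kappa>]) auto
  have "m * h \<le> M * h" using assms by (intro mult_right_mono) auto
  then have mh: "m * h < 1" using a by simp
  define q where "q = 1 - m * h"
  have q: "0 < q" using mh by (simp add: q_def)
  define K where "K = (2.4 * sqrt (\<kappa> * M * h) + 1.77) * M * h * sqrt (real CARD('p) / m)"
  have K: "0 \<le> K" using M h m \<kappa> by (simp add: K_def)
  define B where "B = h * real CARD('p) * (M * h)\<^sup>2 * (25.05 * (M * h) + 2.26)"
  \<comment> \<open>Equivalently \<open>q * K\<^sup>2 + B \<le> K\<^sup>2\<close>: the square of the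
    claimed error is a supersolution of the recursion.\<close>
  have B: "0 \<le> B" "B \<le> m * h * K\<^sup>2"
  proof -
    show "0 \<le> B" using M h by (simp add: B_def)
    have "B \<le> h * real CARD('p) * (M * h)\<^sup>2 * (2.4 * sqrt (\<kappa> * (M * h)) + 1.77)\<^sup>2"
      unfolding B_def using one_step_error_bound[OF _ a \<kappa>] M h by (intro mult_left_mono) auto
    also have "\<dots> = m * h * K\<^sup>2"
      using m by (simp add: K_def power_mult_distrib mult_ac)
    finally show "B \<le> m * h * K\<^sup>2" .
  qed
  define \<nu> where "\<nu> k = distr \<Omega> borel (rlmc f h \<theta>0 U \<xi>' \<xi>'' k)" for k
  define c where "c k = (INF \<gamma>\<in>couplings (\<nu> k) (gibbs f). transport_cost \<gamma>)" for k
  have step: "c (Suc k) \<le> ennreal q * c k + ennreal B" for k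
    unfolding c_def
  proof (rule INF_affine_ennreal[OF q])
    fix \<gamma> assume \<gamma>: "\<gamma> \<in> couplings (\<nu> k) (gibbs f)"
    show "(INF \<gamma>\<in>couplings (\<nu> (Suc k)) (gibbs f). transport_cost \<gamma>) \<le> ennreal q * transport_cost \<gamma> + ennreal B"
    proof (cases "transport_cost \<gamma>")
      case top
      then show ?thesis using q by (simp add: ennreal_mult_top)
    next
      case (real C)
      have "(INF \<gamma>\<in>couplings (\<nu> (Suc k)) (gibbs f). transport_cost \<gamma>)
          \<le> ennreal ((1 - m * h) * C + h * DIM(real ^ 'p) * (M * h)\<^sup>2 * (25.05 * (M * h) + 2.26))"
      proof (rule rstep_transport_cost[OF h a \<gamma>])
        show "sets (\<nu> (Suc k)) = sets borel" by (simp add: \<nu>_def)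
        have "rlmc_step f h u z' z'' x = rstep h u z' z'' x" for u z' z'' x
          by (simp add: rlmc_step_def rlmc_mid_def rstep_def)
        then show "(\<integral>\<^sup>+y. F y \<partial>\<nu> (Suc k)) = (\<integral>\<^sup>+u. \<integral>\<^sup>+x. \<integral>\<^sup>+z'. \<integral>\<^sup>+z''. F (rstep h u z' z'' x)
            \<partial>std_gaussian \<partial>std_gaussian \<partial>\<nu> k \<partial>unif01)" if "F \<in> borel_measurable borel" for F
          using rlmc_law_Suc[OF borel_measurable_g that, of h k] by (simp add: \<nu>_def)
      qed (use real in auto)
      also have "\<dots> = ennreal q * transport_cost \<gamma> + ennreal B"
        using real q B by (simp add: q_def B_def ennreal_mult'[symmetric] ennreal_plus[symmetric] del: ennreal_plus)
      finally show ?thesis .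
    qed
  qed
  have iter: "c k \<le> ennreal (q ^ k) * c 0 + ennreal (K\<^sup>2)" for k
  proof (induction k)
    case (Suc k)
    have "c (Suc k) \<le> ennreal q * (ennreal (q ^ k) * c 0 + ennreal (K\<^sup>2)) + ennreal B"
      using step[of k] Suc.IH by (meson add_right_mono mult_left_mono order_trans zero_le)
    also have "\<dots> = ennreal (q ^ Suc k) * c 0 + ennreal (q * K\<^sup>2 + B)"
      using q B by (simp add: distrib_left ennreal_mult' mult_ac add_ac)
    also have "\<dots> \<le> ennreal (q ^ Suc k) * c 0 + ennreal (K\<^sup>2)"
      using B by (intro add_left_mono ennreal_leI) (simp add: q_def algebra_simps)
    finally show ?case .
  qed simp
  have "rlmc f h \<theta>0 U \<xi>' \<xi>'' 0 = \<theta>0" by (rule ext) simp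
  then have \<nu>0: "\<nu> 0 = \<nu>0" by (simp add: \<nu>_def distr_init)
  let ?e = "1.11 * exp (- m * real n * h / 2)"
  have "W2 (\<nu> n) (gibbs f) \<le> ennreal ?e * W2 \<nu>0 (gibbs f) + ennreal K"
  proof (cases "c 0")
    \<comment> \<open>If no coupling of \<open>\<nu>0\<close> with \<pi> has finite cost, the
      right-hand side is infinite, its coefficient being positive.\<close>
    case top
    then have "W2 \<nu>0 (gibbs f) = \<top>"
      by (simp add: W2_eq_transport_cost c_def \<nu>0 sqrt_ennreal_def)
    then show ?thesis by (simp add: ennreal_mult_top)
  next
    case (real C)
    have qn: "q ^ n \<le> (exp (- m * real n * h / 2))\<^sup>2"
    proof -
      have "q \<le> exp (- (m * h))"
        using exp_ge_add_one_self[of "- (m * h)"] by (simp add: q_def)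
      then have "q ^ n \<le> exp (- (m * h)) ^ n" using q by (intro power_mono) auto
      also have "\<dots> = (exp (- m * real n * h / 2))\<^sup>2"
        by (simp add: exp_of_nat_mult[symmetric] exp_double[symmetric] mult_ac)
      finally show ?thesis .
    qed
    have "c n \<le> ennreal (q ^ n * C + K\<^sup>2)"
      using iter[of n] real q by (simp add: ennreal_mult'[symmetric] ennreal_plus[symmetric] del: ennreal_plus)
    then have "W2 (\<nu> n) (gibbs f) \<le> sqrt_ennreal (ennreal (q ^ n * C + K\<^sup>2))"
      unfolding W2_eq_transport_cost c_def by (rule sqrt_ennreal_mono)
    also have "\<dots> = ennreal (sqrt (q ^ n * C + K\<^sup>2))"
      using q real by (simp add: sqrt_ennreal_def del: ennreal_plus)
    also have "\<dots> \<le> ennreal (?e * sqrt C + K)"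
    proof (rule ennreal_leI)
      have "sqrt (q ^ n * C + K\<^sup>2) \<le> sqrt (q ^ n * C) + sqrt (K\<^sup>2)"
        using q real by (intro sqrt_add_le_add_sqrt) auto
      also have "sqrt (q ^ n * C) \<le> sqrt ((exp (- m * real n * h / 2))\<^sup>2 * C)"
        using qn real by (intro real_sqrt_le_mono mult_right_mono) auto
      also have "\<dots> = exp (- m * real n * h / 2) * sqrt C"
        by (simp add: real_sqrt_mult)
      \<comment> \<open>The recursion contracts with prefactor 1, which is at most 1.11.\<close>
      also have "\<dots> \<le> ?e * sqrt C" using real by (intro mult_right_mono) auto
      finally show "sqrt (q ^ n * C + K\<^sup>2) \<le> ?e * sqrt C + K" using K by simp
    qed
    also have "\<dots> = ennreal ?e * W2 \<nu>0 (gibbs f) + ennreal K"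
    proof -
      have "W2 \<nu>0 (gibbs f) = ennreal (sqrt C)"
        using real by (simp add: W2_eq_transport_cost c_def[of 0, unfolded \<nu>0, symmetric] sqrt_ennreal_def)
      then show ?thesis
        using real K by (simp add: ennreal_mult'[symmetric] ennreal_plus[symmetric] del: ennreal_plus)
    qed
    finally show ?thesis .
  qed
  then show ?thesis by (simp add: \<nu>_def K_def)
qed

end
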